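(* Let $(J,\rho)$ be a cuspidal pair in $\mathcal J_G$, where the associated $(\tilde J,\tilde\rho)$ is chosen so that $\tilde J=\mathcal I_G(\rho)$ and $\mathrm{Res}^{\tilde J}_J\tilde\rho=\rho$ is irreducible. Then $({}^\natural J,{}^\natural\rho)=({}^0J,{}^0\rho)$. Moreover, $$\mathcal H(G,\rho)\simeq\bigoplus_{\nu\in X({}^0J/J)}\mathcal H(G,{}^0\rho\otimes{}^0\nu),$$ where ${}^0\nu$ denotes the restriction to ${}^0J$ of an extension $\bar\nu\in X(G/{}^\flat G)$ of $\nu$.
   Context: Setting: $F$ is a non-archimedean local field, $\mathbf G$ a connected reductive $F$-group with center $\mathbf Z$, $G=\mathbf G(F)$, $Z=\mathbf Z(F)$. Representations are smooth and complex; $\mathrm{ind}$ is compact induction. For a group $H$, $X(H)=\mathrm{Hom}(H,\mathbb C^\times)$; for a normal subgroup $H'$, $X(H/H')$ is identified with the characters of $H$ trivial on $H'$. For $g\in G$: $H^g=gHg^{-1}$ and $\sigma^g(x)=\sigma(g^{-1}xg)$. ${}^0G$ is the intersection of the kernels of all unramified characters $g\mapsto|\chi(g)|_F^s$ of $G$ ($\chi$ an $F$-rational character of $\mathbf G$, $s\in\mathbb C$). Fix an open normal subgroup ${}^\flat G$ of $G$, contained in ${}^0G$ with finite index and containing the commutator subgroup of $G$. $\Omega(G)$ is the set of open compact subgroups of $G$; $\Omega(G/Z)$ the set of open subgroups of $G$ containing $Z$ and compact modulo $Z$. For a representation $\sigma$ of $H\subset G$, $\mathcal I_G(\sigma)=\{g\in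 G:\mathrm{Hom}_{H\cap H^g}(\sigma,\sigma^g)\neq0\}$. $\mathcal J_G$ is the set of pairs $(J,\rho)$, $J\in\Omega(G)$, $\rho\in\mathrm{Irr}(J)$, such that there exist $\tilde J\in\Omega(G/Z)$ with $J=\tilde J\cap{}^\flat G$ and $\tilde\rho\in\mathrm{Irr}(\tilde J)$ containing $\rho$ with $\mathcal I_G(\tilde\rho)=\tilde J$ (equivalently $\pi:=\mathrm{ind}_{\tilde J}^G\tilde\rho$ is irreducible, hence supercuspidal). A pair is cuspidal if $\mathcal I_G(\rho)\subset\tilde J$ and $m_J(\tilde\rho)=1$, where $m_J(\tilde\rho)$ is the common multiplicity of the irreducible constituents of $\tilde\rho|_J$ (for a cuspidal pair one may replace $(\tilde J,\tilde\rho)$ so that $\tilde J=\mathcal I_G(\rho)$ and $\tilde\rho|_J=\rho$). For $(J,\rho)\in\mathcal J_G$: ${}^0J=\tilde J\cap{}^0G$; ${}^0\rho\in\mathrm{Irr}({}^0J)$ is a fixed representation contained in $\tilde\rho$ and containing $\rho$; ${}^\sharp J=\bigcap\ker\chi$ over $\chi\in X({}^0J/J)$ with ${}^0\rho\otimes\chi\simeq{}^0\rho$; ${}^\sharp\rho$ is the unique irreducible representation of ${}^\sharp J$ occurring in ${}^0\rho|_{{}^\sharp J}$ with ${}^\sharp\rho|_J=\rho$; ${}^\dagger({}^\flat G)=\bigcap\ker\chi$ over $\chi\in X(G/{}^\flat G)$ with $\pi\otimes\chi\simeq\pi$; ${}^\natural J={}^\dagger({}^\flat G)\cap{}^0J\subset{}^\sharp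 J$; ${}^\natural\rho={}^\sharp\rho|_{{}^\natural J}$. For a representation $\tau$ of a compact open $H$, $\mathcal H(G,\tau)=\mathrm{End}_G(\mathrm{ind}_H^G\tau)$; the displayed isomorphism is one of $\mathbb C$-algebras. *)

theory Defs
  imports
    "HOL-Analysis.Analysis"
    "HOL-Library.Function_Algebras"
    "HOL-Algebra.Algebraic_Closure_Type"
    "HOL-Algebra.Generated_Groups"
    "HOL-Algebra.QuotRing"
    "HOL-Algebra.Module"
begin

section \<open>Non-archimedean local fields\<close>

text \<open>The absolute value is the normalised one: its value group is generated by the inverse of
  the cardinality of the residue field. The set counted below is the set of cosets of the maximal
  ideal in the ring of integers.\<close>

class nonarch_local_field = field + complete_space +
  fixes nabs :: "'a \<Rightarrow> real"
  assumes dist_nabs: "dist x y = nabs (x - y)"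
    and nabs_mult: "nabs (x * y) = nabs x * nabs y"
    and nabs_ultrametric: "nabs (x + y) \<le> max (nabs x) (nabs y)"
    and finite_residue_field: "finite ((\<lambda>x. {y. nabs (x - y) < 1}) ` {x. nabs x \<le> 1})"
    and uniformizer:
      "\<exists>w. nabs w = 1 / real (card ((\<lambda>x. {y. nabs (x - y) < 1}) ` {x. nabs x \<le> 1})) \<and>
           (\<forall>x. x \<noteq> 0 \<longrightarrow> (\<exists>k::int. nabs x = nabs w powi k))"


section \<open>Linear algebraic groups\<close>

text \<open>Linear algebraic groups are given as Zariski closed subgroups of \<open>GL\<^sub>n\<close> over the algebraic
  closure of \<open>F\<close>, identified with their sets of geometric points.\<close>

definition GL :: "('a::field ^ 'n ^ 'n::finite) monoid" where
  "GL = \<lparr>carrier = {A. invertible A}, monoid.mult = (**), one = mat 1\<rparr>"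

definition units_monoid :: "'a::field monoid" where
  "units_monoid = \<lparr>carrier = - {0}, monoid.mult = (*), one = 1\<rparr>"

text \<open>Functions on \<open>GL\<^sub>n\<close> representing the elements of the coordinate ring
  \<open>A[x\<^sub>i\<^sub>j, 1/det]\<close>; only their values on invertible matrices matter.\<close>

inductive_set reg_funs :: "'a set \<Rightarrow> ('a::field ^ 'n ^ 'n::finite \<Rightarrow> 'a) set" for A where
  const: "c \<in> A \<Longrightarrow> (\<lambda>_. c) \<in> reg_funs A"
| entry: "(\<lambda>g. g $ i $ j) \<in> reg_funs A"
| inv_det: "(\<lambda>g. inverse (det g)) \<in> reg_funs A"
| add: "p \<in> reg_funs A \<Longrightarrow> q \<in> reg_funs A \<Longrightarrow> (\<lambda>g. p g + q g) \<in> reg_funs A"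
| mult: "p \<in> reg_funs A \<Longrightarrow> q \<in> reg_funs A \<Longrightarrow> (\<lambda>g. p g * q g) \<in> reg_funs A"

definition zariski_closed :: "('a::field ^ 'n ^ 'n::finite) set \<Rightarrow> bool" where
  "zariski_closed S \<longleftrightarrow>
     (\<exists>P \<subseteq> reg_funs UNIV. S = {g \<in> carrier GL. \<forall>p\<in>P. p g = 0})"

definition zariski_connected :: "('a::field ^ 'n ^ 'n::finite) set \<Rightarrow> bool" where
  "zariski_connected S \<longleftrightarrow>
     \<not> (\<exists>A B. zariski_closed A \<and> zariski_closed B \<and> A \<noteq> {} \<and> B \<noteq> {} \<and> A \<inter> B = {} \<and> A \<union> B = S)"

text \<open>The subset \<open>S\<close> of \<open>GL\<^sub>n\<close> over the algebraic closure is defined over \<open>F\<close>: its vanishing ideal is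
  spanned by the functions with coefficients in \<open>F\<close> that it contains. For \<open>F\<close> imperfect this is
  stronger than being cut out by equations over \<open>F\<close>.\<close>

definition defined_over_base :: "('f::field alg_closure ^ 'n ^ 'n::finite) set \<Rightarrow> bool" where
  "defined_over_base S \<longleftrightarrow>
     (\<forall>p \<in> reg_funs UNIV. (\<forall>g\<in>S. p g = 0) \<longrightarrow>
        (\<exists>Q c. finite Q \<and> Q \<subseteq> reg_funs (range to_ac) \<and> (\<forall>q\<in>Q. \<forall>g\<in>S. q g = 0) \<and>
               (\<forall>g \<in> carrier GL. p g = (\<Sum>q\<in>Q. c q * q g))))"

definition unipotent :: "'a::field ^ 'n ^ 'n::finite \<Rightarrow> bool" where
  "unipotent g \<longleftrightarrow> (\<exists>k. ((\<lambda>M. (g - mat 1) ** M) ^^ k) (mat 1) = 0)"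

text \<open>Reductivity is triviality of the geometric unipotent radical, that is, of the largest
  connected unipotent closed normal subgroup over the algebraic closure.\<close>

definition connected_reductive_group :: "('f::field alg_closure ^ 'n ^ 'n::finite) set \<Rightarrow> bool" where
  "connected_reductive_group \<G> \<longleftrightarrow>
     subgroup \<G> GL \<and> zariski_closed \<G> \<and> defined_over_base \<G> \<and> zariski_connected \<G> \<and>
     (\<forall>U. U \<lhd> (GL\<lparr>carrier := \<G>\<rparr>) \<and> zariski_closed U \<and> zariski_connected U \<and> (\<forall>u\<in>U. unipotent u)
        \<longrightarrow> U = {mat 1})"

definition rational_points ::
    "('f::field alg_closure ^ 'n ^ 'n::finite) set \<Rightarrow> ('f ^ 'n ^ 'n) monoid" where
  "rational_points \<G> = GL\<lparr>carrier := {g \<in> carrier GL. map_matrix to_ac g \<in> \<G>}\<rparr>"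

text \<open>\<open>F\<close>-points of the centre of the algebraic group (rather than the centre of the abstract group
  of \<open>F\<close>-points).\<close>

definition center_points ::
    "('f::field alg_closure ^ 'n ^ 'n::finite) set \<Rightarrow> ('f ^ 'n ^ 'n) set" where
  "center_points \<G> =
     {g \<in> carrier (rational_points \<G>). \<forall>x\<in>\<G>. map_matrix to_ac g ** x = x ** map_matrix to_ac g}"

definition rational_characters ::
    "('f::field alg_closure ^ 'n ^ 'n::finite) set \<Rightarrow> ('f alg_closure ^ 'n ^ 'n \<Rightarrow> 'f alg_closure) set"
  where
  "rational_characters \<G> =
     {\<psi> \<in> hom (GL\<lparr>carrier := \<G>\<rparr>) units_monoid. \<exists>p \<in> reg_funs (range to_ac). \<forall>g\<in>\<G>. \<psi> g = p g}"

text \<open>The character \<open>g \<mapsto> |\<psi>(g)|\<^sup>s\<close>; an \<open>F\<close>-rational character takes values in \<open>F\<close> on \<open>F\<close>-points.\<close>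

definition unramified_character ::
    "('f::nonarch_local_field alg_closure ^ 'n ^ 'n::finite \<Rightarrow> 'f alg_closure) \<Rightarrow> complex \<Rightarrow>
     'f ^ 'n ^ 'n \<Rightarrow> complex" where
  "unramified_character \<psi> s g =
     complex_of_real (nabs (the_inv to_ac (\<psi> (map_matrix to_ac g)))) powr s"

definition zero_subgroup ::
    "('f::nonarch_local_field alg_closure ^ 'n ^ 'n::finite) set \<Rightarrow> ('f ^ 'n ^ 'n) set" where
  "zero_subgroup \<G> =
     {g \<in> carrier (rational_points \<G>).
        \<forall>\<psi> \<in> rational_characters \<G>. \<forall>s. unramified_character \<psi> s g = 1}"


section \<open>Open subgroups and characters of a topological group\<close>

text \<open>In what follows \<open>G\<close> is a group whose carrier has the subspace topology of its type, and
  \<open>H\<close>, \<open>J\<close> are subgroups of \<open>G\<close>, given by their carriers.\<close>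

definition open_subgroup :: "('g::topological_space) monoid \<Rightarrow> 'g set \<Rightarrow> bool" where
  "open_subgroup G H \<longleftrightarrow> subgroup H G \<and> openin (top_of_set (carrier G)) H"

definition Omega :: "('g::topological_space) monoid \<Rightarrow> 'g set set" where
  "Omega G = {H. open_subgroup G H \<and> compact H}"

text \<open>The image of \<open>H\<close> in \<open>G/Z\<close> is compact. The condition \<open>quotient_map\<close> determines \<open>Y\<close> to be the
  set of cosets with the quotient topology.\<close>

definition compact_mod :: "('g::topological_space) monoid \<Rightarrow> 'g set \<Rightarrow> 'g set \<Rightarrow> bool" where
  "compact_mod G Z H \<longleftrightarrow>
     (\<exists>Y. quotient_map (top_of_set (carrier G)) Y (\<lambda>g. Z #>\<^bsub>G\<^esub> g) \<and>
          compactin Y ((\<lambda>g. Z #>\<^bsub>G\<^esub> g) ` H))"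

definition Omega_mod :: "('g::topological_space) monoid \<Rightarrow> 'g set \<Rightarrow> 'g set set" where
  "Omega_mod G Z = {H. open_subgroup G H \<and> Z \<subseteq> H \<and> compact_mod G Z H}"

text \<open>\<open>X(H/N)\<close> as a set of functions on \<open>H\<close>, made \<open>undefined\<close> off \<open>H\<close> so that each character is
  represented exactly once.\<close>

definition chars :: "'g monoid \<Rightarrow> 'g set \<Rightarrow> 'g set \<Rightarrow> ('g \<Rightarrow> complex) set" where
  "chars G H N =
     {\<psi> \<in> hom (G\<lparr>carrier := H\<rparr>) units_monoid. \<psi> \<in> extensional H \<and> (\<forall>x\<in>N. \<psi> x = 1)}"

definition conj_subgroup :: "'g monoid \<Rightarrow> 'g \<Rightarrow> 'g set \<Rightarrow> 'g set" where
  "conj_subgroup G g H = (\<lambda>h. g \<otimes>\<^bsub>G\<^esub> h \<otimes>\<^bsub>G\<^esub> inv\<^bsub>G\<^esub> g) ` H"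


section \<open>Complex vector spaces\<close>

class complex_vector = ab_group_add +
  fixes scaleC :: "complex \<Rightarrow> 'a \<Rightarrow> 'a"  (infixr \<open>*\<^sub>C\<close> 75)
  assumes scaleC_add_right: "a *\<^sub>C (x + y) = a *\<^sub>C x + a *\<^sub>C y"
    and scaleC_add_left: "(a + b) *\<^sub>C x = a *\<^sub>C x + b *\<^sub>C x"
    and scaleC_scaleC: "a *\<^sub>C (b *\<^sub>C x) = (a * b) *\<^sub>C x"
    and scaleC_one: "1 *\<^sub>C x = x"

global_interpretation cvec: vector_space "scaleC :: complex \<Rightarrow> 'a \<Rightarrow> 'a::complex_vector"
  by unfold_locales
    (simp_all add: scaleC_add_right scaleC_add_left scaleC_scaleC scaleC_one)

instantiation "fun" :: (type, complex_vector) complex_vector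
begin

definition scaleC_fun :: "complex \<Rightarrow> ('a \<Rightarrow> 'b) \<Rightarrow> 'a \<Rightarrow> 'b" where
  "scaleC_fun c f = (\<lambda>x. c *\<^sub>C f x)"

instance
  by standard
    (simp_all add: scaleC_fun_def fun_eq_iff scaleC_add_right scaleC_add_left scaleC_scaleC
      scaleC_one)

end


section \<open>Smooth representations\<close>

text \<open>A representation consists of a subspace of an ambient complex vector space and an action. The
  group is not part of the data, so that the restriction of a representation of \<open>H\<close> to a subgroup
  \<open>K\<close> is the same record, regarded as a representation of \<open>K\<close>.\<close>

record ('g, 'v) rep =
  rep_space :: "'v set"
  act :: "'g \<Rightarrow> 'v \<Rightarrow> 'v"

definition smooth_rep ::
    "('g::topological_space) monoid \<Rightarrow> 'g set \<Rightarrow> ('g, 'v::complex_vector) rep \<Rightarrow> bool" where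
  "smooth_rep G H \<sigma> \<longleftrightarrow>
     cvec.subspace (rep_space \<sigma>) \<and>
     (\<forall>h\<in>H. \<forall>v \<in> rep_space \<sigma>. act \<sigma> h v \<in> rep_space \<sigma>) \<and>
     (\<forall>h\<in>H. \<forall>u \<in> rep_space \<sigma>. \<forall>v \<in> rep_space \<sigma>. act \<sigma> h (u + v) = act \<sigma> h u + act \<sigma> h v) \<and>
     (\<forall>h\<in>H. \<forall>c. \<forall>v \<in> rep_space \<sigma>. act \<sigma> h (c *\<^sub>C v) = c *\<^sub>C act \<sigma> h v) \<and>
     (\<forall>v \<in> rep_space \<sigma>. act \<sigma> \<one>\<^bsub>G\<^esub> v = v) \<and>
     (\<forall>h\<in>H. \<forall>k\<in>H. \<forall>v \<in> rep_space \<sigma>. act \<sigma> (h \<otimes>\<^bsub>G\<^esub> k) v = act \<sigma> h (act \<sigma> k v)) \<and>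
     (\<forall>v \<in> rep_space \<sigma>. openin (top_of_set H) {h \<in> H. act \<sigma> h v = v})"

definition irrep ::
    "('g::topological_space) monoid \<Rightarrow> 'g set \<Rightarrow> ('g, 'v::complex_vector) rep \<Rightarrow> bool" where
  "irrep G H \<sigma> \<longleftrightarrow>
     smooth_rep G H \<sigma> \<and> rep_space \<sigma> \<noteq> {0} \<and>
     (\<forall>W \<subseteq> rep_space \<sigma>. cvec.subspace W \<and> (\<forall>h\<in>H. \<forall>w\<in>W. act \<sigma> h w \<in> W)
        \<longrightarrow> W = {0} \<or> W = rep_space \<sigma>)"

text \<open>\<open>Hom\<^sub>H(\<sigma>,\<tau>)\<close>, each map extended by \<open>0\<close> outside the space of \<open>\<sigma>\<close> so that the \<open>H\<close>-maps form
  a subspace of the space of all functions.\<close>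

definition rep_hom ::
    "'g set \<Rightarrow> ('g, 'v::complex_vector) rep \<Rightarrow> ('g, 'w::complex_vector) rep \<Rightarrow> ('v \<Rightarrow> 'w) set" where
  "rep_hom H \<sigma> \<tau> =
     {\<phi>. (\<forall>v \<in> rep_space \<sigma>. \<phi> v \<in> rep_space \<tau>) \<and>
         (\<forall>u \<in> rep_space \<sigma>. \<forall>v \<in> rep_space \<sigma>. \<phi> (u + v) = \<phi> u + \<phi> v) \<and>
         (\<forall>c. \<forall>v \<in> rep_space \<sigma>. \<phi> (c *\<^sub>C v) = c *\<^sub>C \<phi> v) \<and>
         (\<forall>h\<in>H. \<forall>v \<in> rep_space \<sigma>. \<phi> (act \<sigma> h v) = act \<tau> h (\<phi> v)) \<and>
         (\<forall>v. v \<notin> rep_space \<sigma> \<longrightarrow> \<phi> v = 0)}"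

definition rep_iso ::
    "'g set \<Rightarrow> ('g, 'v::complex_vector) rep \<Rightarrow> ('g, 'w::complex_vector) rep \<Rightarrow> bool" where
  "rep_iso H \<sigma> \<tau> \<longleftrightarrow> (\<exists>\<phi> \<in> rep_hom H \<sigma> \<tau>. bij_betw \<phi> (rep_space \<sigma>) (rep_space \<tau>))"

definition occurs_in ::
    "'g set \<Rightarrow> ('g, 'v::complex_vector) rep \<Rightarrow> ('g, 'w::complex_vector) rep \<Rightarrow> bool" where
  "occurs_in H \<sigma> \<tau> \<longleftrightarrow> (\<exists>\<phi> \<in> rep_hom H \<sigma> \<tau>. inj_on \<phi> (rep_space \<sigma>))"

definition twist ::
    "('g, 'v::complex_vector) rep \<Rightarrow> ('g \<Rightarrow> complex) \<Rightarrow> ('g, 'v) rep" where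
  "twist \<sigma> \<psi> = \<sigma>\<lparr>act := (\<lambda>h v. \<psi> h *\<^sub>C act \<sigma> h v)\<rparr>"

definition conj_rep :: "'g monoid \<Rightarrow> 'g \<Rightarrow> ('g, 'v) rep \<Rightarrow> ('g, 'v) rep" where
  "conj_rep G g \<sigma> = \<sigma>\<lparr>act := (\<lambda>x. act \<sigma> (inv\<^bsub>G\<^esub> g \<otimes>\<^bsub>G\<^esub> x \<otimes>\<^bsub>G\<^esub> g))\<rparr>"

definition intertwining :: "'g monoid \<Rightarrow> 'g set \<Rightarrow> ('g, 'v::complex_vector) rep \<Rightarrow> 'g set" where
  "intertwining G H \<sigma> =
     {g \<in> carrier G. rep_hom (H \<inter> conj_subgroup G g H) \<sigma> (conj_rep G g \<sigma>) \<noteq> {0}}"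

definition multiplicity_in ::
    "'g set \<Rightarrow> ('g, 'v::complex_vector) rep \<Rightarrow> ('g, 'w::complex_vector) rep \<Rightarrow> nat" where
  "multiplicity_in H \<sigma> \<tau> = cvec.dim (rep_hom H \<sigma> \<tau>)"

text \<open>All irreducible constituents of the restriction of \<open>\<sigma>\<close> to \<open>H\<close> occur with multiplicity \<open>m\<close>.
  Constituents are taken as irreducible subrepresentations; the restrictions to which this is
  applied are semisimple.\<close>

definition common_multiplicity ::
    "('g::topological_space) monoid \<Rightarrow> 'g set \<Rightarrow> ('g, 'v::complex_vector) rep \<Rightarrow> nat \<Rightarrow> bool" where
  "common_multiplicity G H \<sigma> m \<longleftrightarrow>
     (\<forall>W \<subseteq> rep_space \<sigma>. irrep G H (\<sigma>\<lparr>rep_space := W\<rparr>)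
        \<longrightarrow> multiplicity_in H (\<sigma>\<lparr>rep_space := W\<rparr>) \<sigma> = m)"

text \<open>Compact induction: \<open>G\<close> acts by right translation on the smooth functions \<open>f\<close> with
  \<open>f(hx) = \<sigma>(h) f(x)\<close> that are compactly supported modulo \<open>H\<close>. Functions vanish off \<open>G\<close>.\<close>

definition ind_space ::
    "('g::topological_space) monoid \<Rightarrow> 'g set \<Rightarrow> ('g, 'v::complex_vector) rep \<Rightarrow> ('g \<Rightarrow> 'v) set" where
  "ind_space G H \<sigma> =
     {f. (\<forall>x \<in> carrier G. f x \<in> rep_space \<sigma>) \<and> (\<forall>x. x \<notin> carrier G \<longrightarrow> f x = 0) \<and>
         (\<forall>h\<in>H. \<forall>x \<in> carrier G. f (h \<otimes>\<^bsub>G\<^esub> x) = act \<sigma> h (f x)) \<and>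
         (\<exists>K. open_subgroup G K \<and> (\<forall>k\<in>K. \<forall>x \<in> carrier G. f (x \<otimes>\<^bsub>G\<^esub> k) = f x)) \<and>
         (\<exists>C \<subseteq> carrier G. compact C \<and> {x \<in> carrier G. f x \<noteq> 0} \<subseteq> H <#>\<^bsub>G\<^esub> C)}"

definition c_ind ::
    "('g::topological_space) monoid \<Rightarrow> 'g set \<Rightarrow> ('g, 'v::complex_vector) rep \<Rightarrow> ('g, 'g \<Rightarrow> 'v) rep"
  where
  "c_ind G H \<sigma> =
     \<lparr>rep_space = ind_space G H \<sigma>,
      act = (\<lambda>g f x. if x \<in> carrier G then f (x \<otimes>\<^bsub>G\<^esub> g) else 0)\<rparr>"


section \<open>Hecke algebras\<close>

definition hecke_algebra ::
    "('g::topological_space) monoid \<Rightarrow> 'g set \<Rightarrow> ('g, 'v::complex_vector) rep \<Rightarrow>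
     (complex, ('g \<Rightarrow> 'v) \<Rightarrow> 'g \<Rightarrow> 'v) module" where
  "hecke_algebra G H \<sigma> =
     \<lparr>carrier = rep_hom (carrier G) (c_ind G H \<sigma>) (c_ind G H \<sigma>),
      monoid.mult = (\<circ>),
      one = (\<lambda>f. if f \<in> ind_space G H \<sigma> then f else 0),
      ring.zero = 0,
      add = (+),
      smult = (*\<^sub>C)\<rparr>"

definition direct_sum_algebra ::
    "'i set \<Rightarrow> ('i \<Rightarrow> (complex, 'x) module) \<Rightarrow> (complex, 'i \<Rightarrow> 'x) module" where
  "direct_sum_algebra I A =
     \<lparr>carrier = {f \<in> \<Pi>\<^sub>E i\<in>I. carrier (A i). finite {i \<in> I. f i \<noteq> \<zero>\<^bsub>A i\<^esub>}},
      monoid.mult = (\<lambda>f g. \<lambda>i\<in>I. f i \<otimes>\<^bsub>A i\<^esub> g i),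
      one = (\<lambda>i\<in>I. \<one>\<^bsub>A i\<^esub>),
      ring.zero = (\<lambda>i\<in>I. \<zero>\<^bsub>A i\<^esub>),
      add = (\<lambda>f g. \<lambda>i\<in>I. f i \<oplus>\<^bsub>A i\<^esub> g i),
      smult = (\<lambda>c f. \<lambda>i\<in>I. c \<odot>\<^bsub>A i\<^esub> f i)\<rparr>"

definition algebra_iso :: "(complex, 'x) module \<Rightarrow> (complex, 'y) module \<Rightarrow> bool" where
  "algebra_iso A B \<longleftrightarrow>
     (\<exists>\<phi> \<in> ring_iso A B. \<forall>c. \<forall>x \<in> carrier A. \<phi> (c \<odot>\<^bsub>A\<^esub> x) = c \<odot>\<^bsub>B\<^esub> \<phi> x)"


section \<open>Cuspidal pairs\<close>

text \<open>\<open>(J, \<rho>)\<close> belongs to \<open>\<J>\<^sub>G\<close>, as witnessed by \<open>(J', \<rho>')\<close>.\<close>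

definition JG_pair ::
    "('g::topological_space) monoid \<Rightarrow> 'g set \<Rightarrow> 'g set \<Rightarrow> 'g set \<Rightarrow> ('g, 'v::complex_vector) rep \<Rightarrow>
     'g set \<Rightarrow> ('g, 'w::complex_vector) rep \<Rightarrow> bool" where
  "JG_pair G Z Gflat J \<rho> J' \<rho>' \<longleftrightarrow>
     J \<in> Omega G \<and> irrep G J \<rho> \<and>
     J' \<in> Omega_mod G Z \<and> J = J' \<inter> Gflat \<and>
     irrep G J' \<rho>' \<and> occurs_in J \<rho> \<rho>' \<and> intertwining G J' \<rho>' = J'"

definition cuspidal_pair ::
    "('g::topological_space) monoid \<Rightarrow> 'g set \<Rightarrow> 'g set \<Rightarrow> 'g set \<Rightarrow> ('g, 'v::complex_vector) rep \<Rightarrow>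
     'g set \<Rightarrow> ('g, 'w::complex_vector) rep \<Rightarrow> bool" where
  "cuspidal_pair G Z Gflat J \<rho> J' \<rho>' \<longleftrightarrow>
     JG_pair G Z Gflat J \<rho> J' \<rho>' \<and> intertwining G J \<rho> \<subseteq> J' \<and> common_multiplicity G J \<rho>' 1"

text \<open>The intersection of the kernels of those \<open>\<psi> \<in> X(H/N)\<close> with \<open>\<sigma> \<otimes> \<psi> \<simeq> \<sigma>\<close>.\<close>

definition twist_kernel ::
    "'g monoid \<Rightarrow> 'g set \<Rightarrow> 'g set \<Rightarrow> ('g, 'v::complex_vector) rep \<Rightarrow> 'g set" where
  "twist_kernel G H N \<sigma> =
     {x \<in> H. \<forall>\<psi> \<in> chars G H N. rep_iso H (twist \<sigma> \<psi>) \<sigma> \<longrightarrow> \<psi> x = 1}"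

end

theory Submission
  imports Defs
begin

text \<open>
  The quotient \<open>J0/J\<close> is a finite abelian group: it embeds in the abelian group \<open>G/Gflat\<close>, and
  \<open>Gflat\<close> has finite index in \<open>G0\<close>. Because \<open>\<rho>tilde\<close> is already irreducible on \<open>J\<close>, the
  representation \<open>\<rho>0\<close> is the restriction of \<open>\<rho>tilde\<close> to \<open>J0\<close>, and it restricts to \<open>\<rho>\<close>. An
  irreducible representation of the compact group \<open>J\<close> is finite-dimensional, so Schur's lemma turns
  every \<open>J\<close>-endomorphism of \<open>\<rho>\<close> into a scalar; a nonzero map between two twists of \<open>\<rho>0\<close> by characters
  trivial on \<open>J\<close> is therefore a scalar, and its equivariance forces the two characters to
  coincide (\<open>schur_twists\<close>).

  The second input is that \<open>\<rho>\<close> is intertwined only by elements of \<open>Jtilde\<close>. A nonzero \<open>G\<close>-map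
  between compactly induced representations yields, for some \<open>g\<close>, a nonzero map between the
  inducing representations over \<open>H \<inter> gHg\<inverse>\<close> (\<open>intertwining_of_induced_map\<close>). On \<open>J \<inter> gJg\<inverse>\<close> it
  intertwines \<open>\<rho>\<close>, whence \<open>g \<in> Jtilde\<close>. Composing with \<open>\<rho>tilde(g)\<close> gives a map of
  \<open>H\<close>-representations, since conjugation by \<open>g\<close> moves elements of \<open>Jtilde\<close> only by commutators, which
  lie in \<open>J\<close>. Thus, for \<open>J \<subseteq> H \<subseteq> Jtilde\<close>, representations induced from different twists on
  \<open>H\<close> are disjoint (\<open>induced_twists_agree\<close>). Let \<open>\<pi>\<close> be the representation of \<open>G\<close> induced from
  \<open>\<rho>tilde\<close>. For \<open>H = Jtilde\<close> the argument shows that a character \<open>\<psi>\<close> of \<open>G/Gflat\<close> with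
  \<open>\<pi> \<otimes> \<psi> \<simeq> \<pi>\<close> is trivial on \<open>Jtilde\<close>, hence \<open>Jnat = J0\<close>. Schur's lemma for twists also gives
  \<open>Jsharp = J0\<close>, and then \<open>\<rho>sharp \<simeq> \<rho>0\<close>.

  For the Hecke algebra one induces \<open>\<rho>\<close> from \<open>J\<close> to \<open>G\<close> in two stages. Averaging over \<open>J0/J\<close> against
  \<open>\<nu>\<inverse>\<close> projects the result onto the representation induced from \<open>\<rho>0 \<otimes> \<nu>\<close>, and the projections
  add up to the identity by the orthogonality relation for the characters of \<open>J0/J\<close>
  (\<open>sum_of_characters\<close>). The summands are pairwise disjoint by the case \<open>H = J0\<close> above, so the
  endomorphism algebra of the sum is the sum of the endomorphism algebras
  (\<open>endo_algebra_direct_sum\<close>). The orthogonality relation and the extension of \<open>\<nu>\<close> to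
  \<open>G/Gflat\<close> both come from the divisibility of the multiplicative group of \<open>\<complex>\<close>, by which characters
  extend from subgroups of abelian groups (\<open>partial_character_extends\<close>).
\<close>

section \<open>Equivariant maps\<close>

lemma rep_homI:
  assumes "\<And>v. v \<in> rep_space \<sigma> \<Longrightarrow> \<phi> v \<in> rep_space \<tau>"
    and "\<And>u v. u \<in> rep_space \<sigma> \<Longrightarrow> v \<in> rep_space \<sigma> \<Longrightarrow> \<phi> (u + v) = \<phi> u + \<phi> v"
    and "\<And>c v. v \<in> rep_space \<sigma> \<Longrightarrow> \<phi> (c *\<^sub>C v) = c *\<^sub>C \<phi> v"
    and "\<And>h v. h \<in> H \<Longrightarrow> v \<in> rep_space \<sigma> \<Longrightarrow> \<phi> (act \<sigma> h v) = act \<tau> h (\<phi> v)"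
    and "\<And>v. v \<notin> rep_space \<sigma> \<Longrightarrow> \<phi> v = 0"
  shows "\<phi> \<in> rep_hom H \<sigma> \<tau>"
  using assms by (simp add: rep_hom_def)

lemma rep_homD:
  assumes "\<phi> \<in> rep_hom H \<sigma> \<tau>"
  shows rep_hom_in: "v \<in> rep_space \<sigma> \<Longrightarrow> \<phi> v \<in> rep_space \<tau>"
    and rep_hom_add: "u \<in> rep_space \<sigma> \<Longrightarrow> v \<in> rep_space \<sigma> \<Longrightarrow> \<phi> (u + v) = \<phi> u + \<phi> v"
    and rep_hom_scale: "v \<in> rep_space \<sigma> \<Longrightarrow> \<phi> (c *\<^sub>C v) = c *\<^sub>C \<phi> v"
    and rep_hom_act: "h \<in> H \<Longrightarrow> v \<in> rep_space \<sigma> \<Longrightarrow> \<phi> (act \<sigma> h v) = act \<tau> h (\<phi> v)"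
    and rep_hom_outside: "v \<notin> rep_space \<sigma> \<Longrightarrow> \<phi> v = 0"
  using assms by (simp_all add: rep_hom_def)

lemma rep_hom_zero:
  assumes "\<phi> \<in> rep_hom H \<sigma> \<tau>" shows "\<phi> 0 = 0"
proof (cases "0 \<in> rep_space \<sigma>")
  case True
  then have "\<phi> (0 *\<^sub>C 0) = 0 *\<^sub>C \<phi> 0" by (rule rep_hom_scale[OF assms])
  then show ?thesis by simp
qed (rule rep_hom_outside[OF assms])

lemma rep_hom_sum:
  assumes "\<phi> \<in> rep_hom H \<sigma> \<tau>" "cvec.subspace (rep_space \<sigma>)" "\<And>i. i \<in> I \<Longrightarrow> f i \<in> rep_space \<sigma>"
  shows "\<phi> (\<Sum>i\<in>I. f i) = (\<Sum>i\<in>I. \<phi> (f i))"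
  using assms(3)
proof (induction I rule: infinite_finite_induct)
  case (insert i I)
  then have "(\<Sum>i\<in>I. f i) \<in> rep_space \<sigma>" by (intro cvec.subspace_sum[OF assms(2)]) auto
  with insert show ?case by (simp add: rep_hom_add[OF assms(1)])
qed (simp_all add: rep_hom_zero[OF assms(1)])

lemma rep_hom_mono: "K \<subseteq> H \<Longrightarrow> \<phi> \<in> rep_hom H \<sigma> \<tau> \<Longrightarrow> \<phi> \<in> rep_hom K \<sigma> \<tau>"
  by (auto simp: rep_hom_def)

lemma rep_hom_comp:
  assumes "\<psi> \<in> rep_hom H \<tau> \<upsilon>" "\<phi> \<in> rep_hom H \<sigma> \<tau>"
  shows "\<psi> \<circ> \<phi> \<in> rep_hom H \<sigma> \<upsilon>"
  using assms rep_hom_zero[OF assms(1)] by (auto simp: rep_hom_def)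

lemma rep_hom_zero_map:
  assumes "\<And>h. h \<in> H \<Longrightarrow> act \<tau> h 0 = 0" "0 \<in> rep_space \<tau>"
  shows "(\<lambda>v. 0) \<in> rep_hom H \<sigma> \<tau>"
  by (rule rep_homI) (use assms in auto)

lemma subspace_image:
  assumes "\<phi> \<in> rep_hom H \<sigma> \<tau>" "cvec.subspace W" "W \<subseteq> rep_space \<sigma>"
  shows "cvec.subspace (\<phi> ` W)"
  unfolding cvec.subspace_def
proof (intro conjI ballI allI)
  show "0 \<in> \<phi> ` W"
    using rep_hom_zero[OF assms(1)] cvec.subspace_0[OF assms(2)] by (metis image_eqI)
next
  fix x y assume "x \<in> \<phi> ` W" "y \<in> \<phi> ` W"
  then obtain u v where "x = \<phi> u" "y = \<phi> v" "u \<in> W" "v \<in> W" by auto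
  then have "x + y = \<phi> (u + v)" using assms(3) by (metis rep_hom_add[OF assms(1)] subsetD)
  then show "x + y \<in> \<phi> ` W" using \<open>u \<in> W\<close> \<open>v \<in> W\<close> cvec.subspace_add[OF assms(2)] by auto
next
  fix c x assume "x \<in> \<phi> ` W"
  then obtain u where "x = \<phi> u" "u \<in> W" by auto
  then have "c *\<^sub>C x = \<phi> (c *\<^sub>C u)" using assms(3) by (metis rep_hom_scale[OF assms(1)] subsetD)
  then show "c *\<^sub>C x \<in> \<phi> ` W" using \<open>u \<in> W\<close> cvec.subspace_scale[OF assms(2)] by auto
qed

text \<open>The image of an equivariant map is an invariant subspace of the target.\<close>

lemma rep_hom_onto_irrep:
  assumes \<phi>: "\<phi> \<in> rep_hom H \<sigma> \<tau>" and nz: "\<phi> v \<noteq> 0" and irr: "irrep G H \<tau>"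
    and sub: "cvec.subspace (rep_space \<sigma>)"
    and st: "\<And>h v. h \<in> H \<Longrightarrow> v \<in> rep_space \<sigma> \<Longrightarrow> act \<sigma> h v \<in> rep_space \<sigma>"
  shows "\<phi> ` rep_space \<sigma> = rep_space \<tau>"
proof -
  have "\<phi> ` rep_space \<sigma> \<subseteq> rep_space \<tau>" using rep_hom_in[OF \<phi>] by auto
  moreover have "cvec.subspace (\<phi> ` rep_space \<sigma>)" by (rule subspace_image[OF \<phi> sub]) simp
  moreover have "\<forall>h\<in>H. \<forall>w\<in>\<phi> ` rep_space \<sigma>. act \<tau> h w \<in> \<phi> ` rep_space \<sigma>"
    using st by (auto simp: rep_hom_act[OF \<phi>, symmetric])
  ultimately have "\<phi> ` rep_space \<sigma> = {0} \<or> \<phi> ` rep_space \<sigma> = rep_space \<tau>"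
    using irr unfolding irrep_def by blast
  moreover have "v \<in> rep_space \<sigma>" using nz rep_hom_outside[OF \<phi>] by blast
  ultimately show ?thesis using nz by auto
qed

text \<open>The value \<open>0\<close> off the space of \<open>\<tau>\<close> makes the inverse a member of \<open>rep_hom\<close> again.\<close>

definition hom_inverse ::
    "('g, 'v::complex_vector) rep \<Rightarrow> ('g, 'w::complex_vector) rep \<Rightarrow> ('v \<Rightarrow> 'w) \<Rightarrow> 'w \<Rightarrow> 'v" where
  "hom_inverse \<sigma> \<tau> \<phi> w = (if w \<in> rep_space \<tau> then inv_into (rep_space \<sigma>) \<phi> w else 0)"

lemma hom_inverse:
  assumes \<phi>: "\<phi> \<in> rep_hom H \<sigma> \<tau>" and bij: "bij_betw \<phi> (rep_space \<sigma>) (rep_space \<tau>)"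
    and sub: "cvec.subspace (rep_space \<sigma>)"
    and st: "\<forall>h\<in>H. \<forall>v \<in> rep_space \<sigma>. act \<sigma> h v \<in> rep_space \<sigma>"
  shows hom_inverse_left: "v \<in> rep_space \<sigma> \<Longrightarrow> hom_inverse \<sigma> \<tau> \<phi> (\<phi> v) = v"
    and hom_inverse_right: "w \<in> rep_space \<tau> \<Longrightarrow> \<phi> (hom_inverse \<sigma> \<tau> \<phi> w) = w"
    and hom_inverse_rep_hom: "hom_inverse \<sigma> \<tau> \<phi> \<in> rep_hom H \<tau> \<sigma>"
proof -
  let ?\<psi> = "hom_inverse \<sigma> \<tau> \<phi>"
  show l: "?\<psi> (\<phi> v) = v" if "v \<in> rep_space \<sigma>" for v
    using that bij rep_hom_in[OF \<phi>] by (auto simp: hom_inverse_def bij_betw_def)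
  show r: "\<phi> (?\<psi> w) = w" if "w \<in> rep_space \<tau>" for w
    using that bij by (auto simp: hom_inverse_def bij_betw_def f_inv_into_f)
  have ex: "\<exists>v\<in>rep_space \<sigma>. w = \<phi> v" if "w \<in> rep_space \<tau>" for w
    using that bij by (auto simp: bij_betw_def)
  show hom: "?\<psi> \<in> rep_hom H \<tau> \<sigma>"
  proof (rule rep_homI)
    fix w assume w: "w \<in> rep_space \<tau>"
    then obtain v where v: "v \<in> rep_space \<sigma>" "w = \<phi> v" using ex by blast
    then show "?\<psi> w \<in> rep_space \<sigma>" by (simp add: l)
    show "?\<psi> (c *\<^sub>C w) = c *\<^sub>C ?\<psi> w" for c
      using v by (simp add: l rep_hom_scale[OF \<phi>, symmetric] cvec.subspace_scale[OF sub])
    show "?\<psi> (act \<tau> h w) = act \<sigma> h (?\<psi> w)" if "h \<in> H" for h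
      using v that by (simp add: l rep_hom_act[OF \<phi>, symmetric] st)
    fix w' assume "w' \<in> rep_space \<tau>"
    then obtain v' where v': "v' \<in> rep_space \<sigma>" "w' = \<phi> v'" using ex by blast
    show "?\<psi> (w + w') = ?\<psi> w + ?\<psi> w'"
      using v v' by (simp add: l rep_hom_add[OF \<phi>, symmetric] cvec.subspace_add[OF sub])
  qed (simp add: hom_inverse_def)
qed

lemma smooth_repD:
  assumes "smooth_rep G H \<sigma>"
  shows smooth_rep_subspace: "cvec.subspace (rep_space \<sigma>)"
    and smooth_rep_in: "h \<in> H \<Longrightarrow> v \<in> rep_space \<sigma> \<Longrightarrow> act \<sigma> h v \<in> rep_space \<sigma>"
    and smooth_rep_add:
      "h \<in> H \<Longrightarrow> u \<in> rep_space \<sigma> \<Longrightarrow> v \<in> rep_space \<sigma> \<Longrightarrow> act \<sigma> h (u + v) = act \<sigma> h u + act \<sigma> h v"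
    and smooth_rep_scale:
      "h \<in> H \<Longrightarrow> v \<in> rep_space \<sigma> \<Longrightarrow> act \<sigma> h (c *\<^sub>C v) = c *\<^sub>C act \<sigma> h v"
    and smooth_rep_one: "v \<in> rep_space \<sigma> \<Longrightarrow> act \<sigma> \<one>\<^bsub>G\<^esub> v = v"
    and smooth_rep_mult: "h \<in> H \<Longrightarrow> k \<in> H \<Longrightarrow> v \<in> rep_space \<sigma> \<Longrightarrow>
      act \<sigma> (h \<otimes>\<^bsub>G\<^esub> k) v = act \<sigma> h (act \<sigma> k v)"
    and smooth_rep_stabilizer:
      "v \<in> rep_space \<sigma> \<Longrightarrow> openin (top_of_set H) {h \<in> H. act \<sigma> h v = v}"
  using assms by (simp_all add: smooth_rep_def)

lemma smooth_rep_act_zero: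
  assumes "smooth_rep G H \<sigma>" "h \<in> H" shows "act \<sigma> h 0 = 0"
proof -
  have "act \<sigma> h (0 *\<^sub>C 0) = 0 *\<^sub>C act \<sigma> h 0"
    using assms cvec.subspace_0[OF smooth_rep_subspace[OF assms(1)]] by (intro smooth_rep_scale) auto
  then show ?thesis by simp
qed

lemma rep_space_twist [simp]: "rep_space (twist \<sigma> \<psi>) = rep_space \<sigma>"
  by (simp add: twist_def)

lemma act_twist [simp]: "act (twist \<sigma> \<psi>) h v = \<psi> h *\<^sub>C act \<sigma> h v"
  by (simp add: twist_def)

lemma twist_trivial: "twist \<sigma> (\<lambda>_. 1) = \<sigma>"
  by (simp add: twist_def)

lemma rep_space_conj_rep [simp]: "rep_space (conj_rep G g \<sigma>) = rep_space \<sigma>"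
  by (simp add: conj_rep_def)

lemma act_conj_rep [simp]: "act (conj_rep G g \<sigma>) x = act \<sigma> (inv\<^bsub>G\<^esub> g \<otimes>\<^bsub>G\<^esub> x \<otimes>\<^bsub>G\<^esub> g)"
  by (simp add: conj_rep_def)


lemma sum_fun_apply: "(\<Sum>i\<in>I. f i) x = (\<Sum>i\<in>I. f i x)"
  for f :: "'i \<Rightarrow> 'x \<Rightarrow> 'v::complex_vector"
  by (induction I rule: infinite_finite_induct) simp_all

section \<open>Schur's lemma\<close>

definition poly_apply :: "('v \<Rightarrow> 'v::complex_vector) \<Rightarrow> complex poly \<Rightarrow> 'v \<Rightarrow> 'v" where
  "poly_apply T p v = (\<Sum>i\<le>Polynomial.degree p. Polynomial.coeff p i *\<^sub>C (T ^^ i) v)"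

lemma poly_apply_bound:
  assumes "Polynomial.degree p \<le> n"
  shows "poly_apply T p v = (\<Sum>i\<le>n. Polynomial.coeff p i *\<^sub>C (T ^^ i) v)"
  unfolding poly_apply_def
  by (rule sum.mono_neutral_left) (use assms in \<open>auto simp: coeff_eq_0\<close>)

text \<open>A linear factor \<open>x - a\<close> of \<open>p\<close> is split off. If the cofactor still annihilates \<open>v\<close>, the degree has
  dropped; otherwise the cofactor maps \<open>v\<close> to an eigenvector for \<open>a\<close>.\<close>

lemma eigenvector_of_annihilating_poly:
  assumes \<open>cvec.subspace V\<close> and T: "\<And>v. v \<in> V \<Longrightarrow> T v \<in> V"
    "\<And>u v. u \<in> V \<Longrightarrow> v \<in> V \<Longrightarrow> T (u + v) = T u + T v"
    "\<And>c v. v \<in> V \<Longrightarrow> T (c *\<^sub>C v) = c *\<^sub>C T v"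
    and v: "v \<in> V" "v \<noteq> 0"
    and "p \<noteq> 0" "poly_apply T p v = 0"
  shows "\<exists>a w. w \<in> V \<and> w \<noteq> 0 \<and> T w = a *\<^sub>C w"
  using assms(7,8)
proof (induction "Polynomial.degree p" arbitrary: p)
  case 0
  then have "Polynomial.coeff p 0 \<noteq> 0" by (metis leading_coeff_0_iff)
  with 0 v show ?case by (simp add: poly_apply_def)
next
  case (Suc n)
  have Ti: "(T ^^ i) v \<in> V" for i by (induction i) (use T v in auto)
  have T0: "T 0 = 0" using T(3)[OF v(1), of 0] by simp
  have Tsum: "T (\<Sum>i\<in>I. c i *\<^sub>C (T ^^ i) v) = (\<Sum>i\<in>I. c i *\<^sub>C (T ^^ Suc i) v)"
    for c :: "nat \<Rightarrow> complex" and I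
  proof (induction I rule: infinite_finite_induct)
    case (insert i I)
    have "(\<Sum>i\<in>I. c i *\<^sub>C (T ^^ i) v) \<in> V"
      by (intro cvec.subspace_sum cvec.subspace_scale Ti \<open>cvec.subspace V\<close>)
    with insert show ?case
      by (simp add: T Ti cvec.subspace_scale[OF \<open>cvec.subspace V\<close>])
  qed (simp_all add: T0)
  have "\<not> constant (poly p)" using Suc.hyps(2) by (simp add: constant_degree)
  then obtain a where "poly p a = 0" using fundamental_theorem_of_algebra by blast
  then obtain q where p: "p = [:-a, 1:] * q" using poly_eq_0_iff_dvd by (metis dvdE)
  with Suc.prems have q0: "q \<noteq> 0" by auto
  then have "Polynomial.degree p = Suc (Polynomial.degree q)" unfolding p by (subst degree_mult_eq) auto
  with Suc.hyps have dq: "n = Polynomial.degree q" by simp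
  define w where "w = poly_apply T q v"
  have wV: "w \<in> V"
    unfolding w_def poly_apply_def
    by (intro cvec.subspace_sum cvec.subspace_scale Ti \<open>cvec.subspace V\<close>)
  show ?case
  proof (cases "w = 0")
    case True
    then show ?thesis using Suc.hyps(1)[OF dq q0] by (simp add: w_def)
  next
    case False
    have "poly_apply T p v = (\<Sum>i\<le>Suc n. Polynomial.coeff p i *\<^sub>C (T ^^ i) v)"
      using Suc.hyps(2) by (intro poly_apply_bound) simp
    also have "\<dots> = (\<Sum>i\<le>Suc n. Polynomial.coeff (pCons 0 q) i *\<^sub>C (T ^^ i) v - (a * Polynomial.coeff q i) *\<^sub>C (T ^^ i) v)"
      by (rule sum.cong) (simp_all add: p cvec.scale_left_diff_distrib[symmetric])
    also have "\<dots> = (\<Sum>i\<le>Suc n. Polynomial.coeff (pCons 0 q) i *\<^sub>C (T ^^ i) v)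
        - (\<Sum>i\<le>Suc n. (a * Polynomial.coeff q i) *\<^sub>C (T ^^ i) v)"
      by (rule sum_subtractf)
    also have "(\<Sum>i\<le>Suc n. Polynomial.coeff (pCons 0 q) i *\<^sub>C (T ^^ i) v) = T w"
      unfolding w_def poly_apply_def Tsum dq[symmetric]
      by (subst sum.atMost_Suc_shift) (simp add: coeff_pCons)
    also have "(\<Sum>i\<le>Suc n. (a * Polynomial.coeff q i) *\<^sub>C (T ^^ i) v) = a *\<^sub>C w"
      unfolding w_def using poly_apply_bound[of q "Suc n" T v] dq
      by (simp add: cvec.scale_sum_right cvec.scale_scale coeff_eq_0)
    finally have "T w = a *\<^sub>C w" using Suc.prems(2) by simp
    then show ?thesis using False wV by blast
  qed
qed

text \<open>For an injective family this is a count of dimensions; otherwise two equal members give the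
  relation.\<close>

lemma linear_relation:
  fixes f :: "nat \<Rightarrow> 'v::complex_vector"
  assumes "finite B" and span: "\<And>i. f i \<in> cvec.span B"
  shows "\<exists>n c. (\<exists>i\<le>n. c i \<noteq> 0) \<and> (\<Sum>i\<le>n. c i *\<^sub>C f i) = 0"
proof (cases "inj f")
  case True
  define n where "n = card B"
  have inj: "inj_on f {..n}" using True by (rule inj_on_subset) simp
  have "cvec.dependent (f ` {..n})"
  proof (rule ccontr)
    assume "cvec.independent (f ` {..n})"
    then have "card (f ` {..n}) \<le> card B"
      using cvec.independent_span_bound[OF \<open>finite B\<close>] span by blast
    then show False using inj by (simp add: card_image n_def)
  qed
  then obtain u where "\<exists>v\<in>f ` {..n}. u v \<noteq> 0" "(\<Sum>v\<in>f ` {..n}. u v *\<^sub>C v) = 0"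
    by (auto simp: cvec.dependent_finite)
  then have "\<exists>i\<le>n. u (f i) \<noteq> 0" "(\<Sum>i\<le>n. u (f i) *\<^sub>C f i) = 0"
    using inj by (auto simp: sum.reindex)
  then show ?thesis by (intro exI[of _ n] exI[of _ "u \<circ> f"]) auto
next
  case False
  then obtain i j where ij: "i < j" "f i = f j" by (metis injI linorder_neq_iff)
  let ?c = "\<lambda>k. if k = i then 1 else if k = j then -1 else 0 :: complex"
  have "(\<Sum>k\<le>j. ?c k *\<^sub>C f k) = (\<Sum>k\<in>{i,j}. ?c k *\<^sub>C f k)"
    by (rule sum.mono_neutral_right) (use ij in auto)
  also have "\<dots> = 0" using ij by simp
  finally show ?thesis using ij by (intro exI[of _ j] exI[of _ ?c]) auto
qed

lemma eigenvector_exists: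
  assumes V: "cvec.subspace V" and T: "\<And>v. v \<in> V \<Longrightarrow> T v \<in> V"
    "\<And>u v. u \<in> V \<Longrightarrow> v \<in> V \<Longrightarrow> T (u + v) = T u + T v"
    "\<And>c v. v \<in> V \<Longrightarrow> T (c *\<^sub>C v) = c *\<^sub>C T v"
    and v: "v \<in> V" "v \<noteq> 0"
    and fin: "finite B" "V \<subseteq> cvec.span B"
  shows "\<exists>a w. w \<in> V \<and> w \<noteq> 0 \<and> T w = a *\<^sub>C w"
proof -
  have Ti: "(T ^^ i) v \<in> V" for i by (induction i) (use T v in auto)
  then obtain n c where c: "\<exists>i\<le>n. c i \<noteq> 0" "(\<Sum>i\<le>n. c i *\<^sub>C (T ^^ i) v) = 0"
    using linear_relation[OF fin(1), of "\<lambda>i. (T ^^ i) v"] fin(2) by blast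
  define p where "p = (\<Sum>i\<le>n. Polynomial.monom (c i) i)"
  have coeff: "Polynomial.coeff p i = (if i \<le> n then c i else 0)" for i
    by (simp add: p_def coeff_sum)
  have "Polynomial.degree p \<le> n" by (rule degree_le) (simp add: coeff)
  then have "poly_apply T p v = 0" using c(2) by (simp add: poly_apply_bound coeff)
  moreover have "p \<noteq> 0" using c(1) coeff by (metis coeff_0)
  ultimately show ?thesis using eigenvector_of_annihilating_poly[OF V T v] by blast
qed

text \<open>In finite dimension \<open>\<phi>\<close> has an eigenvalue, and its eigenspace is invariant under \<open>H\<close>.\<close>

lemma schur:
  assumes irr: "irrep G H \<sigma>" and fin: "finite B" "rep_space \<sigma> \<subseteq> cvec.span B"
    and \<phi>: "\<phi> \<in> rep_hom H \<sigma> \<sigma>"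
  shows "\<exists>c. \<forall>v\<in>rep_space \<sigma>. \<phi> v = c *\<^sub>C v"
proof -
  have sm: "smooth_rep G H \<sigma>" and ne: "rep_space \<sigma> \<noteq> {0}" using irr by (simp_all add: irrep_def)
  note V = smooth_rep_subspace[OF sm]
  obtain v where "v \<in> rep_space \<sigma>" "v \<noteq> 0" using ne cvec.subspace_0[OF V] by blast
  then obtain a w where w: "w \<in> rep_space \<sigma>" "w \<noteq> 0" "\<phi> w = a *\<^sub>C w"
    using eigenvector_exists[OF V rep_hom_in[OF \<phi>] rep_hom_add[OF \<phi>] rep_hom_scale[OF \<phi>] _ _ fin]
    by metis
  define W where "W = {v \<in> rep_space \<sigma>. \<phi> v = a *\<^sub>C v}"
  have "cvec.subspace W"
    using V unfolding cvec.subspace_def W_def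
    by (auto simp: rep_hom_zero[OF \<phi>] rep_hom_add[OF \<phi>] rep_hom_scale[OF \<phi>]
        cvec.scale_right_distrib mult.commute)
  moreover have "\<forall>h\<in>H. \<forall>w\<in>W. act \<sigma> h w \<in> W"
    by (auto simp: W_def rep_hom_act[OF \<phi>] smooth_rep_in[OF sm] smooth_rep_scale[OF sm])
  moreover have "W \<subseteq> rep_space \<sigma>" by (auto simp: W_def)
  ultimately have "W = {0} \<or> W = rep_space \<sigma>"
    using irr by (simp add: irrep_def)
  moreover have "w \<in> W" using w by (simp add: W_def)
  ultimately show ?thesis using w(2) by (auto simp: W_def)
qed

section \<open>Compact induction\<close>

text \<open>Cosets of open subgroups are open and translates of compact sets are compact as soon as each
  translation is continuous; all finiteness arguments below rest on these two facts.\<close>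

locale translation_group = group G for G :: "('g::topological_space) monoid" (structure) +
  assumes continuous_left: "a \<in> carrier G \<Longrightarrow> continuous_on (carrier G) (\<lambda>x. a \<otimes> x)"
    and continuous_right: "a \<in> carrier G \<Longrightarrow> continuous_on (carrier G) (\<lambda>x. x \<otimes> a)"

lemma open_subgroup_subgroup: "open_subgroup G H \<Longrightarrow> subgroup H G"
  by (simp add: open_subgroup_def)

context translation_group
begin

lemma open_coset:
  assumes "open_subgroup G H" "c \<in> carrier G"
  shows "openin (top_of_set (carrier G)) (H #> c)"
proof -
  have H: "subgroup H G" "openin (top_of_set (carrier G)) H"
    using assms(1) by (auto simp: open_subgroup_def)
  have "H #> c = carrier G \<inter> (\<lambda>x. x \<otimes> inv c) -` H"
  proof (intro equalityI subsetI)
    fix x assume "x \<in> H #> c"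
    then obtain h where "h \<in> H" "x = h \<otimes> c" by (auto simp: r_coset_def)
    with assms(2) subgroup.mem_carrier[OF H(1)] show "x \<in> carrier G \<inter> (\<lambda>x. x \<otimes> inv c) -` H"
      by (auto simp: m_assoc)
  next
    fix x assume "x \<in> carrier G \<inter> (\<lambda>x. x \<otimes> inv c) -` H"
    then have x: "x \<in> carrier G" "x \<otimes> inv c \<in> H" by auto
    then have "x = (x \<otimes> inv c) \<otimes> c" using assms(2) by (simp add: m_assoc)
    with x(2) show "x \<in> H #> c" unfolding r_coset_def by blast
  qed
  moreover have "openin (top_of_set (carrier G)) (carrier G \<inter> (\<lambda>x. x \<otimes> inv c) -` H)"
    by (rule continuous_openin_preimage[OF continuous_right[of "inv c"] _ H(2)]) (use assms(2) in auto)
  ultimately show ?thesis by simp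
qed

lemma open_subgroup_superset:
  assumes "open_subgroup G U" "subgroup K G" "U \<subseteq> K"
  shows "open_subgroup G K"
proof -
  have K: "K \<subseteq> carrier G" by (rule subgroup.subset[OF assms(2)])
  have "K = (\<Union>k\<in>K. U #> k)"
  proof (intro equalityI subsetI)
    fix k assume "k \<in> K"
    then show "k \<in> (\<Union>k\<in>K. U #> k)"
      using K rcos_self[OF _ open_subgroup_subgroup[OF assms(1)]] by auto
  next
    fix x assume "x \<in> (\<Union>k\<in>K. U #> k)"
    then show "x \<in> K" using assms(3) subgroup.m_closed[OF assms(2)] by (auto simp: r_coset_def)
  qed
  moreover have "openin (top_of_set (carrier G)) (\<Union>k\<in>K. U #> k)"
    using K by (intro openin_Union) (auto intro: open_coset[OF assms(1)])
  ultimately show ?thesis using assms(2) by (simp add: open_subgroup_def)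
qed

lemma open_subgroup_Int:
  assumes "open_subgroup G U" "open_subgroup G V" shows "open_subgroup G (U \<inter> V)"
  using assms subgroups_Inter_pair by (auto simp: open_subgroup_def)

text \<open>The cosets form an open cover by disjoint sets.\<close>

lemma finite_cosets_of_compact:
  assumes "open_subgroup G H" "compact C" "C \<subseteq> carrier G"
  shows "finite ((\<lambda>c. H #> c) ` C)"
proof -
  note H = open_subgroup_subgroup[OF assms(1)]
  have "\<forall>c\<in>carrier G. \<exists>T. open T \<and> H #> c = carrier G \<inter> T"
    using open_coset[OF assms(1)] by (auto simp: openin_open)
  then obtain T where T: "\<And>c. c \<in> carrier G \<Longrightarrow> open (T c)"
    "\<And>c. c \<in> carrier G \<Longrightarrow> H #> c = carrier G \<inter> T c" by metis
  have "C \<subseteq> (\<Union>c\<in>C. T c)"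
    using rcos_self[OF _ H] T(2) assms(3) by blast
  then obtain F where F: "F \<subseteq> C" "finite F" "C \<subseteq> (\<Union>c\<in>F. T c)"
    using compactE_image[OF assms(2), of C T] T(1) assms(3) by (metis subsetD)
  have "(\<lambda>c. H #> c) ` C \<subseteq> (\<lambda>c. H #> c) ` F"
  proof
    fix D assume "D \<in> (\<lambda>c. H #> c) ` C"
    then obtain c where c: "c \<in> C" "D = H #> c" by auto
    then obtain d where d: "d \<in> F" "c \<in> T d" using F by auto
    then have "c \<in> H #> d" using T(2) F assms(3) c(1) by blast
    then have "H #> d = H #> c" using repr_independence[OF _ _ H] d F assms(3) by blast
    then show "D \<in> (\<lambda>c. H #> c) ` F" using c d by auto
  qed
  then show ?thesis using F(2) finite_surj by blast
qed

lemma compact_left_translate: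
  assumes "compact C" "C \<subseteq> carrier G" "a \<in> carrier G"
  shows "compact ((\<lambda>x. a \<otimes> x) ` C)"
  using assms continuous_on_subset[OF continuous_left] by (intro compact_continuous_image) auto

lemma open_stabilizer:
  assumes H: "open_subgroup G H" and \<sigma>: "smooth_rep G H \<sigma>" and v: "v \<in> rep_space \<sigma>"
  shows "open_subgroup G {h \<in> H. act \<sigma> h v = v}"
  unfolding open_subgroup_def
proof
  note sH = open_subgroup_subgroup[OF H]
  show "subgroup {h \<in> H. act \<sigma> h v = v} G"
  proof (rule subgroupI)
    show "{h \<in> H. act \<sigma> h v = v} \<subseteq> carrier G" using subgroup.subset[OF sH] by auto
    show "{h \<in> H. act \<sigma> h v = v} \<noteq> {}"
      using smooth_rep_one[OF \<sigma> v] subgroup.one_closed[OF sH] by auto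
  next
    fix a assume "a \<in> {h \<in> H. act \<sigma> h v = v}"
    then have a: "a \<in> H" "act \<sigma> a v = v" by auto
    have ia: "inv a \<in> H" by (rule subgroup.m_inv_closed[OF sH a(1)])
    have "act \<sigma> (inv a) (act \<sigma> a v) = act \<sigma> (inv a \<otimes> a) v"
      using smooth_rep_mult[OF \<sigma> ia a(1) v] by simp
    also have "\<dots> = v"
      using smooth_rep_one[OF \<sigma> v] subgroup.mem_carrier[OF sH a(1)] by simp
    finally show "inv a \<in> {h \<in> H. act \<sigma> h v = v}" using a ia by simp
  next
    fix a b assume "a \<in> {h \<in> H. act \<sigma> h v = v}" "b \<in> {h \<in> H. act \<sigma> h v = v}"
    then show "a \<otimes> b \<in> {h \<in> H. act \<sigma> h v = v}"
      using smooth_rep_mult[OF \<sigma> _ _ v] subgroup.m_closed[OF sH] by auto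
  qed
  show "openin (top_of_set (carrier G)) {h \<in> H. act \<sigma> h v = v}"
    using smooth_rep_stabilizer[OF \<sigma> v] H openin_trans unfolding open_subgroup_def by blast
qed

text \<open>The stabiliser of a vector is open, so it has only finitely many cosets in the compact group
  \<open>J\<close> and the orbit of the vector is finite. The span of the orbit is invariant, hence everything.\<close>

lemma smooth_irrep_finite_dimensional:
  assumes J: "J \<in> Omega G" and irr: "irrep G J \<sigma>"
  obtains B where "finite B" "rep_space \<sigma> \<subseteq> cvec.span B"
proof -
  have \<sigma>: "smooth_rep G J \<sigma>" and ne: "rep_space \<sigma> \<noteq> {0}" using irr by (auto simp: irrep_def)
  have oJ: "open_subgroup G J" and cJ: "compact J" using J by (auto simp: Omega_def)
  note sJ = open_subgroup_subgroup[OF oJ]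
  note V = smooth_rep_subspace[OF \<sigma>]
  obtain v where v: "v \<in> rep_space \<sigma>" "v \<noteq> 0" using ne cvec.subspace_0[OF V] by blast
  define U where "U = {h \<in> J. act \<sigma> h v = v}"
  have oU: "open_subgroup G U" unfolding U_def by (rule open_stabilizer[OF oJ \<sigma> v(1)])
  \<comment> \<open>A right coset \<open>U #> h\<close> determines \<open>h\<inverse> v\<close>, not \<open>h v\<close>; hence the inverse.\<close>
  define B where "B = (\<lambda>h. act \<sigma> (inv h) v) ` J"
  have same: "act \<sigma> (inv h) v = act \<sigma> (inv k) v" if "h \<in> J" "k \<in> J" "U #> h = U #> k" for h k
  proof -
    have "h \<in> U #> k"
      using that rcos_self[OF _ open_subgroup_subgroup[OF oU]] subgroup.mem_carrier[OF sJ] by blast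
    then obtain u where u: "u \<in> J" "act \<sigma> u v = v" "h = u \<otimes> k"
      by (auto simp: r_coset_def U_def)
    then have iu: "act \<sigma> (inv u) v = v"
      using open_subgroup_subgroup[OF oU] subgroup.m_inv_closed[of U G u] by (auto simp: U_def)
    have "act \<sigma> (inv h) v = act \<sigma> (inv k \<otimes> inv u) v"
      using u that subgroup.mem_carrier[OF sJ] by (simp add: inv_mult_group)
    also have "\<dots> = act \<sigma> (inv k) v"
      using smooth_rep_mult[OF \<sigma> _ _ v(1), of "inv k" "inv u"] u that iu
        subgroup.m_inv_closed[OF sJ] by simp
    finally show ?thesis .
  qed
  have "finite B"
  proof -
    have "finite ((\<lambda>c. U #> c) ` J)"
      using finite_cosets_of_compact[OF oU cJ] subgroup.subset[OF sJ] by simp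
    moreover have "B \<subseteq> (\<lambda>D. act \<sigma> (inv (SOME h. h \<in> J \<and> U #> h = D)) v) ` ((\<lambda>c. U #> c) ` J)"
    proof
      fix b assume "b \<in> B"
      then obtain h where h: "h \<in> J" "b = act \<sigma> (inv h) v" by (auto simp: B_def)
      let ?k = "SOME k. k \<in> J \<and> U #> k = U #> h"
      have "?k \<in> J \<and> U #> ?k = U #> h" by (rule someI[of _ h]) (use h in simp)
      then have "b = act \<sigma> (inv ?k) v" using same[OF h(1), of ?k] h(2) by simp
      then show "b \<in> (\<lambda>D. act \<sigma> (inv (SOME h. h \<in> J \<and> U #> h = D)) v) ` ((\<lambda>c. U #> c) ` J)"
        using h(1) by (intro image_eqI[of _ _ "U #> h"]) auto
    qed
    ultimately show ?thesis by (rule finite_surj)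
  qed
  have BV: "B \<subseteq> rep_space \<sigma>"
    using smooth_rep_in[OF \<sigma>] v(1) subgroup.m_inv_closed[OF sJ] by (auto simp: B_def)
  then have spV: "cvec.span B \<subseteq> rep_space \<sigma>" by (rule cvec.span_minimal[OF _ V])
  have "w \<in> cvec.span B \<and> act \<sigma> h w \<in> cvec.span B" if h: "h \<in> J" and w: "w \<in> cvec.span B" for h w
    using w
  proof (induction w rule: cvec.span_induct_alt)
    case base then show ?case by (simp add: smooth_rep_act_zero[OF \<sigma> h] cvec.span_zero)
  next
    case (step c x y)
    obtain k where k: "k \<in> J" "x = act \<sigma> (inv k) v" using step(1) by (auto simp: B_def)
    have "act \<sigma> h x = act \<sigma> (h \<otimes> inv k) v"
      using k smooth_rep_mult[OF \<sigma> h _ v(1), of "inv k"] subgroup.m_inv_closed[OF sJ] by simp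
    also have "h \<otimes> inv k = inv (k \<otimes> inv h)"
      using h k subgroup.mem_carrier[OF sJ] by (simp add: inv_mult_group)
    finally have "act \<sigma> h x \<in> B"
      using h k subgroup.m_inv_closed[OF sJ] subgroup.m_closed[OF sJ] by (auto simp: B_def)
    moreover have "x \<in> rep_space \<sigma>" "y \<in> rep_space \<sigma>"
      using BV spV step by (auto simp: subset_iff)
    ultimately show ?case
      using step h by (simp add: smooth_rep_add[OF \<sigma> h] smooth_rep_scale[OF \<sigma> h]
          cvec.subspace_scale[OF V] cvec.span_add cvec.span_scale cvec.span_base)
  qed
  moreover have "v \<in> cvec.span B"
  proof -
    have "v = act \<sigma> (inv \<one>) v" using smooth_rep_one[OF \<sigma> v(1)] by simp
    then have "v \<in> B" unfolding B_def using subgroup.one_closed[OF sJ] by blast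
    then show ?thesis by (rule cvec.span_base)
  qed
  ultimately have "cvec.span B = rep_space \<sigma>"
    using irr spV v(2) unfolding irrep_def by (metis cvec.subspace_span singletonD)
  with \<open>finite B\<close> that show thesis by blast
qed

text \<open>In the twisted action the stabiliser of a vector is a subgroup that contains the open subgroup of
  those elements of \<open>J\<close> that fix the vector in the original action.\<close>

lemma smooth_rep_twist:
  assumes H: "subgroup H G" and \<sigma>: "smooth_rep G H \<sigma>"
    and \<psi>: "\<psi> \<in> chars G H J" and J: "open_subgroup G J" "J \<subseteq> H"
  shows "smooth_rep G H (twist \<sigma> \<psi>)"
proof -
  have oH: "open_subgroup G H" by (rule open_subgroup_superset[OF J(1) H J(2)])
  have mult: "\<psi> (h \<otimes> k) = \<psi> h * \<psi> k" if "h \<in> H" "k \<in> H" for h k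
    using that \<psi> by (auto simp: chars_def hom_def units_monoid_def)
  have nz: "\<psi> h \<noteq> 0" if "h \<in> H" for h
    using that \<psi> by (auto simp: chars_def hom_def units_monoid_def)
  have one: "\<psi> h = 1" if "h \<in> J" for h using that \<psi> by (auto simp: chars_def)
  note sm = smooth_repD[OF \<sigma>]
  have m: "act (twist \<sigma> \<psi>) (h \<otimes> k) v = act (twist \<sigma> \<psi>) h (act (twist \<sigma> \<psi>) k v)"
    if "h \<in> H" "k \<in> H" "v \<in> rep_space \<sigma>" for h k v
    using that by (simp add: mult sm)
  have o: "act (twist \<sigma> \<psi>) \<one> v = v" if "v \<in> rep_space \<sigma>" for v
    using that by (simp add: sm one subgroup.one_closed[OF open_subgroup_subgroup[OF J(1)]])
  have "openin (top_of_set H) {h \<in> H. act (twist \<sigma> \<psi>) h v = v}" if v: "v \<in> rep_space \<sigma>" for v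
  proof -
    let ?S = "{h \<in> H. act (twist \<sigma> \<psi>) h v = v}"
    have "subgroup ?S G"
    proof (rule subgroupI)
      show "?S \<subseteq> carrier G" using subgroup.subset[OF H] by auto
      show "?S \<noteq> {}" using o[OF v] subgroup.one_closed[OF H] by blast
    next
      fix a assume a: "a \<in> ?S"
      then have ia: "inv a \<in> H" using subgroup.m_inv_closed[OF H] by auto
      have "act (twist \<sigma> \<psi>) (inv a) (act (twist \<sigma> \<psi>) a v) = act (twist \<sigma> \<psi>) (inv a \<otimes> a) v"
        using m[OF ia _ v, of a] a by simp
      also have "inv a \<otimes> a = \<one>" using a subgroup.mem_carrier[OF H] by auto
      finally have "act (twist \<sigma> \<psi>) (inv a) v = v" using o[OF v] a by simp
      then show "inv a \<in> ?S" using ia by simp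
    next
      fix a b assume a: "a \<in> ?S" "b \<in> ?S"
      then show "a \<otimes> b \<in> ?S" using m[of a b v] v subgroup.m_closed[OF H] by simp
    qed
    moreover have "open_subgroup G ({h \<in> H. act \<sigma> h v = v} \<inter> J)"
      by (intro open_subgroup_Int open_stabilizer oH \<sigma> v J)
    moreover have "{h \<in> H. act \<sigma> h v = v} \<inter> J \<subseteq> ?S" using one by auto
    ultimately have "open_subgroup G ?S" using open_subgroup_superset by blast
    then have "openin (top_of_set (carrier G)) ?S" by (simp add: open_subgroup_def)
    then show ?thesis by (rule openin_subset_trans) (use subgroup.subset[OF H] in auto)
  qed
  then show ?thesis
    unfolding smooth_rep_def using m o
    by (auto simp del: act_twist simp: sm(1))
      (simp_all add: sm cvec.subspace_scale cvec.scale_right_distrib mult.commute)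
qed

lemma ind_spaceD:
  assumes "f \<in> ind_space G H \<sigma>"
  shows ind_space_in: "x \<in> carrier G \<Longrightarrow> f x \<in> rep_space \<sigma>"
    and ind_space_outside: "x \<notin> carrier G \<Longrightarrow> f x = 0"
    and ind_space_left: "h \<in> H \<Longrightarrow> x \<in> carrier G \<Longrightarrow> f (h \<otimes> x) = act \<sigma> h (f x)"
    and ind_space_smooth:
      "\<exists>K. open_subgroup G K \<and> (\<forall>k\<in>K. \<forall>x \<in> carrier G. f (x \<otimes> k) = f x)"
    and ind_space_support:
      "\<exists>C \<subseteq> carrier G. compact C \<and> {x \<in> carrier G. f x \<noteq> 0} \<subseteq> H <#> C"
  using assms by (simp_all add: ind_space_def)

lemma ind_spaceI:
  assumes "\<And>x. x \<in> carrier G \<Longrightarrow> f x \<in> rep_space \<sigma>"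
    and "\<And>x. x \<notin> carrier G \<Longrightarrow> f x = 0"
    and "\<And>h x. h \<in> H \<Longrightarrow> x \<in> carrier G \<Longrightarrow> f (h \<otimes> x) = act \<sigma> h (f x)"
    and "open_subgroup G K" "\<And>k x. k \<in> K \<Longrightarrow> x \<in> carrier G \<Longrightarrow> f (x \<otimes> k) = f x"
    and "compact C" "C \<subseteq> carrier G" "\<And>x. x \<in> carrier G \<Longrightarrow> f x \<noteq> 0 \<Longrightarrow> x \<in> H <#> C"
  shows "f \<in> ind_space G H \<sigma>"
proof -
  have "\<exists>K. open_subgroup G K \<and> (\<forall>k\<in>K. \<forall>x \<in> carrier G. f (x \<otimes> k) = f x)"
    using assms(4,5) by blast
  moreover have "\<exists>C \<subseteq> carrier G. compact C \<and> {x \<in> carrier G. f x \<noteq> 0} \<subseteq> H <#> C"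
    using assms(6-8) by (intro exI[of _ C]) auto
  ultimately show ?thesis using assms(1-3) by (simp add: ind_space_def)
qed

lemma rep_space_c_ind [simp]: "rep_space (c_ind G H \<sigma>) = ind_space G H \<sigma>"
  by (simp add: c_ind_def)

lemma act_c_ind [simp]:
  "act (c_ind G H \<sigma>) g f x = (if x \<in> carrier G then f (x \<otimes> g) else 0)"
  by (simp add: c_ind_def)

lemma set_mult_Un: "H <#> (C \<union> D) = (H <#> C) \<union> (H <#> D)"
  by (auto simp: set_mult_def)

lemma subspace_ind_space:
  assumes H: "subgroup H G" and \<sigma>: "smooth_rep G H \<sigma>"
  shows "cvec.subspace (ind_space G H \<sigma>)"
  unfolding cvec.subspace_def
proof (intro conjI ballI allI)
  note V = smooth_rep_subspace[OF \<sigma>]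
  show "0 \<in> ind_space G H \<sigma>"
    by (rule ind_spaceI[where K = "carrier G" and C = "{}"])
      (use smooth_rep_act_zero[OF \<sigma>] cvec.subspace_0[OF V] in
        \<open>auto simp: open_subgroup_def subgroup_self\<close>)
next
  note V = smooth_rep_subspace[OF \<sigma>]
  fix f g assume f: "f \<in> ind_space G H \<sigma>" and g: "g \<in> ind_space G H \<sigma>"
  obtain K where K: "open_subgroup G K" "\<forall>k\<in>K. \<forall>x \<in> carrier G. f (x \<otimes> k) = f x"
    using ind_space_smooth[OF f] by blast
  obtain L where L: "open_subgroup G L" "\<forall>k\<in>L. \<forall>x \<in> carrier G. g (x \<otimes> k) = g x"
    using ind_space_smooth[OF g] by blast
  obtain C where C: "C \<subseteq> carrier G" "compact C" "{x \<in> carrier G. f x \<noteq> 0} \<subseteq> H <#> C"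
    using ind_space_support[OF f] by blast
  obtain D where D: "D \<subseteq> carrier G" "compact D" "{x \<in> carrier G. g x \<noteq> 0} \<subseteq> H <#> D"
    using ind_space_support[OF g] by blast
  show "f + g \<in> ind_space G H \<sigma>"
  proof (rule ind_spaceI[OF _ _ _ open_subgroup_Int[OF K(1) L(1)] _ compact_Un[OF C(2) D(2)]])
    show "x \<in> H <#> (C \<union> D)" if "x \<in> carrier G" "(f + g) x \<noteq> 0" for x
    proof (cases "f x = 0")
      case True
      then show ?thesis using that D(3) by (auto simp: set_mult_Un)
    next
      case False
      then show ?thesis using that C(3) by (auto simp: set_mult_Un)
    qed
  qed (use C D K L ind_spaceD(1-3)[OF f] ind_spaceD(1-3)[OF g] cvec.subspace_add[OF V]
      smooth_rep_add[OF \<sigma>] in auto)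
next
  note V = smooth_rep_subspace[OF \<sigma>]
  fix c f assume f: "f \<in> ind_space G H \<sigma>"
  obtain K where K: "open_subgroup G K" "\<forall>k\<in>K. \<forall>x \<in> carrier G. f (x \<otimes> k) = f x"
    using ind_space_smooth[OF f] by blast
  obtain C where C: "C \<subseteq> carrier G" "compact C" "{x \<in> carrier G. f x \<noteq> 0} \<subseteq> H <#> C"
    using ind_space_support[OF f] by blast
  show "c *\<^sub>C f \<in> ind_space G H \<sigma>"
    by (rule ind_spaceI[OF _ _ _ K(1) _ C(2,1)])
      (use C K ind_spaceD(1-3)[OF f] cvec.subspace_scale[OF V] smooth_rep_scale[OF \<sigma>] in
        \<open>auto simp: scaleC_fun_def\<close>)
qed

text \<open>The function supported on \<open>H\<close> with value \<open>w\<close> at the identity: this embeds \<open>\<sigma>\<close> into the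
  representation that it induces.\<close>

definition elementary_fun :: "'g set \<Rightarrow> ('g, 'v::complex_vector) rep \<Rightarrow> 'v \<Rightarrow> 'g \<Rightarrow> 'v" where
  "elementary_fun H \<sigma> w x = (if x \<in> H then act \<sigma> x w else 0)"

lemma subgroup_left_mult_iff:
  assumes "subgroup H G" "h \<in> H" "x \<in> carrier G"
  shows "h \<otimes> x \<in> H \<longleftrightarrow> x \<in> H"
proof
  assume "h \<otimes> x \<in> H"
  then have "inv h \<otimes> (h \<otimes> x) \<in> H"
    using assms subgroup.m_closed subgroup.m_inv_closed by metis
  then show "x \<in> H"
    using assms subgroup.mem_carrier[OF assms(1)] by (simp add: m_assoc[symmetric])
qed (use assms subgroup.m_closed in metis)

lemma subgroup_right_mult_iff:
  assumes "subgroup H G" "h \<in> H" "x \<in> carrier G"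
  shows "x \<otimes> h \<in> H \<longleftrightarrow> x \<in> H"
proof
  assume "x \<otimes> h \<in> H"
  then have "(x \<otimes> h) \<otimes> inv h \<in> H"
    using assms subgroup.m_closed subgroup.m_inv_closed by metis
  then show "x \<in> H"
    using assms subgroup.mem_carrier[OF assms(1)] by (simp add: m_assoc)
qed (use assms subgroup.m_closed in metis)

lemma elementary_fun_in_ind_space:
  assumes H: "open_subgroup G H" and \<sigma>: "smooth_rep G H \<sigma>" and w: "w \<in> rep_space \<sigma>"
  shows "elementary_fun H \<sigma> w \<in> ind_space G H \<sigma>"
proof -
  note sH = open_subgroup_subgroup[OF H]
  show ?thesis
  proof (rule ind_spaceI[OF _ _ _ open_stabilizer[OF H \<sigma> w], where C = "{\<one>}"])
    show "elementary_fun H \<sigma> w (x \<otimes> k) = elementary_fun H \<sigma> w x"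
      if "k \<in> {h \<in> H. act \<sigma> h w = w}" "x \<in> carrier G" for k x
      using that
      by (auto simp: elementary_fun_def subgroup_right_mult_iff[OF sH] smooth_rep_mult[OF \<sigma> _ _ w])
    show "x \<in> H <#> {\<one>}" if "x \<in> carrier G" "elementary_fun H \<sigma> w x \<noteq> 0" for x
      using that by (force simp: elementary_fun_def set_mult_def split: if_splits)
    show "elementary_fun H \<sigma> w (h \<otimes> x) = act \<sigma> h (elementary_fun H \<sigma> w x)"
      if "h \<in> H" "x \<in> carrier G" for h x
      using that by (auto simp: elementary_fun_def subgroup_left_mult_iff[OF sH]
          smooth_rep_mult[OF \<sigma> _ _ w] smooth_rep_act_zero[OF \<sigma>])
    show "elementary_fun H \<sigma> w x \<in> rep_space \<sigma>" for x
      using smooth_rep_in[OF \<sigma> _ w] cvec.subspace_0[OF smooth_rep_subspace[OF \<sigma>]]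
      by (auto simp: elementary_fun_def)
    show "elementary_fun H \<sigma> w x = 0" if "x \<notin> carrier G" for x
      using that subgroup.mem_carrier[OF sH] by (auto simp: elementary_fun_def)
  qed auto
qed

lemma cancel_left_inv:
  assumes "g \<in> carrier G" "y \<in> carrier G" shows "g \<otimes> (inv g \<otimes> y) = y"
  using assms by (simp add: m_assoc[symmetric])

lemma open_subgroup_conj:
  assumes K: "open_subgroup G K" and g: "g \<in> carrier G"
  shows "open_subgroup G {k \<in> carrier G. inv g \<otimes> k \<otimes> g \<in> K}"
  unfolding open_subgroup_def
proof
  note sK = open_subgroup_subgroup[OF K]
  let ?c = "\<lambda>k. inv g \<otimes> k \<otimes> g"
  have mult: "?c (a \<otimes> b) = ?c a \<otimes> ?c b" if "a \<in> carrier G" "b \<in> carrier G" for a b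
    using that g by (simp add: m_assoc cancel_left_inv)
  have cinv: "?c (inv a) = inv (?c a)" if "a \<in> carrier G" for a
    using that g by (simp add: m_assoc inv_mult_group)
  show "subgroup {k \<in> carrier G. ?c k \<in> K} G"
  proof (rule subgroupI)
    have "\<one> \<in> {k \<in> carrier G. ?c k \<in> K}" using g subgroup.one_closed[OF sK] by simp
    then show "{k \<in> carrier G. ?c k \<in> K} \<noteq> {}" by blast
  qed (use g subgroup.m_closed[OF sK] subgroup.m_inv_closed[OF sK] in \<open>auto simp: mult cinv\<close>)
  have "continuous_on (carrier G) ?c"
    using continuous_on_compose2[OF continuous_right[OF g] continuous_left[of "inv g"]] g by auto
  then have "openin (top_of_set (carrier G)) (carrier G \<inter> ?c -` K)"
    by (rule continuous_openin_preimage[where T = "carrier G"]) (use K g in \<open>auto simp: open_subgroup_def\<close>)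
  then show "openin (top_of_set (carrier G)) {k \<in> carrier G. ?c k \<in> K}"
    by (simp add: vimage_def Int_def)
qed

lemma act_c_ind_in:
  assumes H: "subgroup H G" and f: "f \<in> ind_space G H \<sigma>" and g: "g \<in> carrier G"
  shows "act (c_ind G H \<sigma>) g f \<in> ind_space G H \<sigma>"
proof -
  note Hc = subgroup.mem_carrier[OF H]
  let ?f = "act (c_ind G H \<sigma>) g f"
  obtain K where K: "open_subgroup G K" "\<forall>k\<in>K. \<forall>x \<in> carrier G. f (x \<otimes> k) = f x"
    using ind_space_smooth[OF f] by blast
  obtain C where C: "C \<subseteq> carrier G" "compact C" "{x \<in> carrier G. f x \<noteq> 0} \<subseteq> H <#> C"
    using ind_space_support[OF f] by blast
  let ?K = "{k \<in> carrier G. inv g \<otimes> k \<otimes> g \<in> K}" and ?C = "(\<lambda>c. c \<otimes> inv g) ` C"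
  have sm: "?f (x \<otimes> k) = ?f x" if k: "k \<in> ?K" and x: "x \<in> carrier G" for k x
  proof -
    have "x \<otimes> k \<otimes> g = (x \<otimes> g) \<otimes> (inv g \<otimes> k \<otimes> g)"
      using x k g by (simp add: m_assoc cancel_left_inv)
    then show ?thesis using K(2) k x g by simp
  qed
  have oK: "open_subgroup G ?K" by (rule open_subgroup_conj[OF K(1) g])
  have cC: "compact ?C"
    using C g continuous_on_subset[OF continuous_right] by (intro compact_continuous_image) auto
  have supp: "{x \<in> carrier G. ?f x \<noteq> 0} \<subseteq> H <#> ?C"
  proof
    fix x assume "x \<in> {x \<in> carrier G. ?f x \<noteq> 0}"
    then have x: "x \<in> carrier G" "f (x \<otimes> g) \<noteq> 0" by auto
    then have "x \<otimes> g \<in> H <#> C" using C(3) g by blast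
    then obtain h c where hc: "h \<in> H" "c \<in> C" "x \<otimes> g = h \<otimes> c"
      by (auto simp: set_mult_def)
    have "x = (x \<otimes> g) \<otimes> inv g" using x g by (simp add: m_assoc)
    also have "\<dots> = h \<otimes> (c \<otimes> inv g)" using hc C(1) Hc g by (auto simp: m_assoc)
    finally show "x \<in> H <#> ?C" using hc unfolding set_mult_def by blast
  qed
  show ?thesis
    by (rule ind_spaceI[OF _ _ _ oK _ cC])
      (use sm supp C g Hc ind_space_in[OF f] ind_space_left[OF f] in \<open>auto simp: m_assoc\<close>)
qed

text \<open>The support of \<open>f\<close> meets finitely many cosets of \<open>H\<close>. On the coset of \<open>c\<close>, the function \<open>f\<close> is a
  translate of the elementary function with value \<open>f c\<close>.\<close>

lemma ind_space_generated:
  assumes H: "open_subgroup G H" and f: "f \<in> ind_space G H \<sigma>"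
  obtains F where "finite F" "F \<subseteq> carrier G"
    "f = (\<Sum>c\<in>F. act (c_ind G H \<sigma>) (inv c) (elementary_fun H \<sigma> (f c)))"
proof -
  note sH = open_subgroup_subgroup[OF H]
  note Hc = subgroup.mem_carrier[OF sH]
  obtain C where C: "C \<subseteq> carrier G" "compact C" "{x \<in> carrier G. f x \<noteq> 0} \<subseteq> H <#> C"
    using ind_space_support[OF f] by blast
  define D where "D = (\<lambda>c. H #> c) ` C"
  \<comment> \<open>One representative for each coset, so that at most one summand is nonzero at any point.\<close>
  define r where "r E = (SOME c. c \<in> C \<and> H #> c = E)" for E
  have r: "r E \<in> C \<and> H #> r E = E" if "E \<in> D" for E
    unfolding r_def by (rule someI_ex) (use that in \<open>auto simp: D_def\<close>)
  define F where "F = r ` D"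
  have fin: "finite F"
    unfolding F_def D_def using finite_cosets_of_compact[OF H C(2,1)] by blast
  have FG: "F \<subseteq> carrier G" using r C(1) by (auto simp: F_def)
  have coset: "x \<otimes> inv c \<in> H \<longleftrightarrow> H #> x = H #> c" if "x \<in> carrier G" "c \<in> carrier G" for x c
  proof
    assume h: "x \<otimes> inv c \<in> H"
    have "x = (x \<otimes> inv c) \<otimes> c" using that by (simp add: m_assoc)
    then have "x \<in> H #> c" using h unfolding r_coset_def by blast
    then show "H #> x = H #> c" using repr_independence[OF _ _ sH] that by blast
  next
    assume "H #> x = H #> c"
    then have "x \<in> H #> c" using rcos_self[OF that(1) sH] by simp
    then show "x \<otimes> inv c \<in> H" using that Hc by (auto simp: r_coset_def m_assoc)
  qed
  have pt: "f x = (\<Sum>c\<in>F. act (c_ind G H \<sigma>) (inv c) (elementary_fun H \<sigma> (f c)) x)" for x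
  proof (cases "x \<in> carrier G")
    case False
    then show ?thesis by (simp add: ind_space_outside[OF f])
  next
    case x: True
    have translate: "act (c_ind G H \<sigma>) (inv c) (elementary_fun H \<sigma> (f c)) x =
        (if H #> x = H #> c then f x else 0)" if "c \<in> F" for c
    proof (cases "H #> x = H #> c")
      case True
      then have "x \<otimes> inv c \<in> H" using coset x that FG by auto
      then have "act \<sigma> (x \<otimes> inv c) (f c) = f (x \<otimes> inv c \<otimes> c)"
        using ind_space_left[OF f] that FG by auto
      also have "x \<otimes> inv c \<otimes> c = x" using x that FG by (simp add: m_assoc subset_iff)
      finally show ?thesis using True x \<open>x \<otimes> inv c \<in> H\<close> by (simp add: elementary_fun_def)
    next
      case False
      then have "x \<otimes> inv c \<notin> H" using coset x that FG by auto
      then show ?thesis using False x by (simp add: elementary_fun_def)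
    qed
    show ?thesis
    proof (cases "H #> x \<in> D")
      case True
      have "(\<Sum>c\<in>F. act (c_ind G H \<sigma>) (inv c) (elementary_fun H \<sigma> (f c)) x) =
          (\<Sum>c\<in>F. if c = r (H #> x) then f x else 0)"
      proof (rule sum.cong)
        fix c assume c: "c \<in> F"
        then obtain E where "E \<in> D" "c = r E" by (auto simp: F_def)
        then have "H #> x = H #> c \<longleftrightarrow> c = r (H #> x)" using r[of E] r[OF True] by metis
        then show "act (c_ind G H \<sigma>) (inv c) (elementary_fun H \<sigma> (f c)) x =
            (if c = r (H #> x) then f x else 0)" using translate[OF c] by simp
      qed simp
      also have "\<dots> = f x" using fin True by (simp add: F_def)
      finally show ?thesis by simp
    next
      case False
      have "f x = 0"
      proof (rule ccontr)
        assume "f x \<noteq> 0"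
        then obtain h c where "h \<in> H" "c \<in> C" "x = h \<otimes> c"
          using C(3) x by (auto simp: set_mult_def)
        then have "x \<in> H #> c" by (auto simp: r_coset_def)
        then have "H #> x = H #> c" using repr_independence[OF _ _ sH] \<open>c \<in> C\<close> C(1) by blast
        with False \<open>c \<in> C\<close> show False by (auto simp: D_def)
      qed
      moreover have "H #> x \<noteq> H #> c" if "c \<in> F" for c
        using that False r by (auto simp: F_def)
      ultimately show ?thesis using translate by (simp add: sum.neutral)
    qed
  qed
  have "f = (\<Sum>c\<in>F. act (c_ind G H \<sigma>) (inv c) (elementary_fun H \<sigma> (f c)))"
    by (rule ext) (simp only: sum_fun_apply pt[symmetric])
  with fin FG that show thesis by blast
qed

text \<open>This is half of Mackey's formula. Since the translates of elementary functions generate the induced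
  representation, \<open>\<Phi>\<close> is nonzero on one of these functions, say at a point \<open>x\<close>. Sending \<open>v\<close> to the
  value at \<open>x\<close> of the image of the elementary function of \<open>v\<close> is the desired map, with
  \<open>g = x\<inverse>\<close>. The twist by \<open>\<psi>\<close> accommodates isomorphisms \<open>\<pi> \<otimes> \<psi> \<simeq> \<pi>\<close>.\<close>

lemma intertwining_of_induced_map:
  assumes H: "open_subgroup G H" and \<sigma>: "smooth_rep G H \<sigma>"
    and H': "subgroup H' G"
    and \<psi>: "\<And>g. g \<in> carrier G \<Longrightarrow> \<psi> g \<noteq> 0"
    and \<Phi>: "\<Phi> \<in> rep_hom (carrier G) (twist (c_ind G H \<sigma>) \<psi>) (c_ind G H' \<tau>)"
    and nz: "\<Phi> f \<noteq> 0"
  obtains g \<phi> v where "g \<in> carrier G"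
    "\<phi> \<in> rep_hom (H \<inter> conj_subgroup G g H') (twist \<sigma> \<psi>) (conj_rep G g \<tau>)" "\<phi> v \<noteq> 0"
proof -
  note sH = open_subgroup_subgroup[OF H]
  let ?e = "elementary_fun H \<sigma>"
  note e_in = elementary_fun_in_ind_space[OF H \<sigma>]
  note V = smooth_rep_subspace[OF \<sigma>]
  have f: "f \<in> ind_space G H \<sigma>" using nz rep_hom_outside[OF \<Phi>] by (metis rep_space_c_ind rep_space_twist)
  have move: "\<psi> g *\<^sub>C \<Phi> (act (c_ind G H \<sigma>) g u) = act (c_ind G H' \<tau>) g (\<Phi> u)"
    if "g \<in> carrier G" "u \<in> ind_space G H \<sigma>" for g u
  proof -
    have tw: "act (twist (c_ind G H \<sigma>) \<psi>) g u = \<psi> g *\<^sub>C act (c_ind G H \<sigma>) g u" by simp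
    have "act (c_ind G H \<sigma>) g u \<in> ind_space G H \<sigma>" using that by (intro act_c_ind_in[OF sH])
    then show ?thesis
      using that rep_hom_act[OF \<Phi>, of g u] rep_hom_scale[OF \<Phi>, of "act (c_ind G H \<sigma>) g u" "\<psi> g"]
      by (simp only: tw rep_space_twist rep_space_c_ind)
  qed
  have "\<exists>w \<in> rep_space \<sigma>. \<Phi> (?e w) \<noteq> 0"
  proof (rule ccontr)
    assume "\<not> (\<exists>w \<in> rep_space \<sigma>. \<Phi> (?e w) \<noteq> 0)"
    then have zero: "\<Phi> (?e w) = 0" if "w \<in> rep_space \<sigma>" for w using that by blast
    obtain F where F: "finite F" "F \<subseteq> carrier G"
      "f = (\<Sum>c\<in>F. act (c_ind G H \<sigma>) (inv c) (?e (f c)))"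
      using ind_space_generated[OF H f] by blast
    have fc: "f c \<in> rep_space \<sigma>" if "c \<in> F" for c using ind_space_in[OF f] that F(2) by blast
    have "\<Phi> f = (\<Sum>c\<in>F. \<Phi> (act (c_ind G H \<sigma>) (inv c) (?e (f c))))"
      by (subst F(3), rule rep_hom_sum[OF \<Phi>])
        (use subspace_ind_space[OF sH \<sigma>] F(2) e_in fc in \<open>auto intro!: act_c_ind_in[OF sH]\<close>)
    also have "\<dots> = 0"
    proof (rule sum.neutral, rule ballI)
      fix c assume c: "c \<in> F"
      then have ic: "inv c \<in> carrier G" using F(2) by auto
      have "\<psi> (inv c) *\<^sub>C \<Phi> (act (c_ind G H \<sigma>) (inv c) (?e (f c))) = act (c_ind G H' \<tau>) (inv c) 0"
        using move[OF ic e_in[OF fc[OF c]]] zero[OF fc[OF c]] by simp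
      also have "\<dots> = 0" by (auto simp: fun_eq_iff)
      finally show "\<Phi> (act (c_ind G H \<sigma>) (inv c) (?e (f c))) = 0" using \<psi>[OF ic] by simp
    qed
    finally show False using nz by simp
  qed
  then obtain w where w: "w \<in> rep_space \<sigma>" "\<Phi> (?e w) \<noteq> 0" by blast
  have \<Phi>_in: "\<Phi> (?e v) \<in> ind_space G H' \<tau>" if "v \<in> rep_space \<sigma>" for v
    using rep_hom_in[OF \<Phi>, of "?e v"] e_in[OF that] by simp
  obtain x where x: "\<Phi> (?e w) x \<noteq> 0" using w(2) by (auto simp: fun_eq_iff)
  then have xG: "x \<in> carrier G" using ind_space_outside[OF \<Phi>_in[OF w(1)]] by blast
  define g where "g = inv x"
  have g: "g \<in> carrier G" "inv g = x" using xG by (auto simp: g_def)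
  define \<phi> where "\<phi> v = (if v \<in> rep_space \<sigma> then \<Phi> (?e v) x else 0)" for v
  have e_add: "?e (u + v) = ?e u + ?e v" if "u \<in> rep_space \<sigma>" "v \<in> rep_space \<sigma>" for u v
    using that by (auto simp: fun_eq_iff elementary_fun_def smooth_rep_add[OF \<sigma>])
  have e_scale: "?e (c *\<^sub>C v) = c *\<^sub>C ?e v" if "v \<in> rep_space \<sigma>" for c v
    using that by (auto simp: fun_eq_iff elementary_fun_def smooth_rep_scale[OF \<sigma>] scaleC_fun_def)
  have e_act: "?e (act \<sigma> j v) = act (c_ind G H \<sigma>) j (?e v)" if "v \<in> rep_space \<sigma>" "j \<in> H" for j v
    using that subgroup.mem_carrier[OF sH]
    by (auto simp: fun_eq_iff elementary_fun_def smooth_rep_mult[OF \<sigma>] subgroup_right_mult_iff[OF sH])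
  have "\<phi> \<in> rep_hom (H \<inter> conj_subgroup G g H') (twist \<sigma> \<psi>) (conj_rep G g \<tau>)"
  proof (rule rep_homI)
    fix v assume v: "v \<in> rep_space (twist \<sigma> \<psi>)"
    then show "\<phi> v \<in> rep_space (conj_rep G g \<tau>)"
      using ind_space_in[OF \<Phi>_in xG] by (simp add: \<phi>_def)
    show "\<phi> (c *\<^sub>C v) = c *\<^sub>C \<phi> v" for c
      using v cvec.subspace_scale[OF V] rep_hom_scale[OF \<Phi>] e_in
      by (simp add: \<phi>_def e_scale scaleC_fun_def)
    show "\<phi> (u + v) = \<phi> u + \<phi> v" if "u \<in> rep_space (twist \<sigma> \<psi>)" for u
      using v that cvec.subspace_add[OF V] rep_hom_add[OF \<Phi>] e_in
      by (simp add: \<phi>_def e_add)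
    fix j assume "j \<in> H \<inter> conj_subgroup G g H'"
    then obtain h where h: "j \<in> H" "h \<in> H'" "j = g \<otimes> h \<otimes> inv g"
      by (auto simp: conj_subgroup_def)
    have hG: "h \<in> carrier G" using subgroup.mem_carrier[OF H'] h by blast
    have jh: "inv g \<otimes> j \<otimes> g = h" "x \<otimes> j = h \<otimes> x"
      using g hG xG unfolding h(3) g(2) by (simp_all add: m_assoc g_def cancel_left_inv)
    have jG: "j \<in> carrier G" using h(1) subgroup.mem_carrier[OF sH] by blast
    have "\<phi> (act (twist \<sigma> \<psi>) j v) = (\<psi> j *\<^sub>C \<Phi> (act (c_ind G H \<sigma>) j (?e v))) x"
      using v h(1) smooth_rep_in[OF \<sigma>] cvec.subspace_scale[OF V] rep_hom_scale[OF \<Phi>] e_in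
      by (simp add: \<phi>_def e_scale e_act[symmetric] scaleC_fun_def)
    also have "\<dots> = act (c_ind G H' \<tau>) j (\<Phi> (?e v)) x"
      using move[OF jG] e_in v by simp
    also have "\<dots> = act \<tau> h (\<Phi> (?e v) x)"
      using xG jh v ind_space_left[OF \<Phi>_in h(2) xG] by simp
    also have "\<dots> = act (conj_rep G g \<tau>) j (\<phi> v)" using v jh by (simp add: \<phi>_def)
    finally show "\<phi> (act (twist \<sigma> \<psi>) j v) = act (conj_rep G g \<tau>) j (\<phi> v)" .
  qed (simp add: \<phi>_def)
  moreover have "\<phi> w \<noteq> 0" using x w by (simp add: \<phi>_def)
  ultimately show thesis using that g(1) by blast
qed

end

section \<open>Characters of abelian groups\<close>

lemma units_monoid_simps [simp]:
  "carrier units_monoid = - {0}" "x \<otimes>\<^bsub>units_monoid\<^esub> y = x * y" "\<one>\<^bsub>units_monoid\<^esub> = 1"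
  by (simp_all add: units_monoid_def)

text \<open>The graph of a character of a subgroup of \<open>A\<close>. In this form, extending a character is enlarging a
  set, and the union of a chain of extensions is just the union.\<close>

definition partial_character :: "('g, 'm) monoid_scheme \<Rightarrow> ('g \<times> complex) set \<Rightarrow> bool" where
  "partial_character A R \<longleftrightarrow>
     R \<subseteq> carrier A \<times> - {0} \<and> (\<one>\<^bsub>A\<^esub>, 1) \<in> R \<and>
     (\<forall>a w b z. (a, w) \<in> R \<and> (b, z) \<in> R \<longrightarrow> (a \<otimes>\<^bsub>A\<^esub> b, w * z) \<in> R) \<and>
     (\<forall>a w. (a, w) \<in> R \<longrightarrow> (inv\<^bsub>A\<^esub> a, inverse w) \<in> R) \<and>
     (\<forall>z. (\<one>\<^bsub>A\<^esub>, z) \<in> R \<longrightarrow> z = 1)"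

lemma partial_characterD:
  assumes "partial_character A R"
  shows partial_character_carrier: "(a, w) \<in> R \<Longrightarrow> a \<in> carrier A"
    and partial_character_nonzero: "(a, w) \<in> R \<Longrightarrow> w \<noteq> 0"
    and partial_character_one: "(\<one>\<^bsub>A\<^esub>, 1) \<in> R"
    and partial_character_mult:
      "(a, w) \<in> R \<Longrightarrow> (b, z) \<in> R \<Longrightarrow> (a \<otimes>\<^bsub>A\<^esub> b, w * z) \<in> R"
    and partial_character_inv: "(a, w) \<in> R \<Longrightarrow> (inv\<^bsub>A\<^esub> a, inverse w) \<in> R"
    and partial_character_at_one: "(\<one>\<^bsub>A\<^esub>, z) \<in> R \<Longrightarrow> z = 1"
  using assms unfolding partial_character_def by blast+

lemma (in group) partial_character_unique:
  assumes R: "partial_character G R" and "(a, w) \<in> R" "(a, z) \<in> R"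
  shows "w = z"
proof -
  have "(a \<otimes> inv a, w * inverse z) \<in> R"
    using partial_character_mult[OF R] partial_character_inv[OF R] assms by blast
  then have "w * inverse z = 1"
    using partial_character_at_one[OF R] partial_character_carrier[OF R assms(2)] by simp
  then show ?thesis using partial_character_nonzero[OF R assms(3)] by (simp add: field_simps)
qed

lemma (in group) partial_character_int_pow:
  assumes R: "partial_character G R" and a: "(a, w) \<in> R"
  shows "(a [^] (k::int), w powi k) \<in> R"
proof -
  have nat: "(a [^] n, w ^ n) \<in> R" for n :: nat
  proof (induction n)
    case (Suc n)
    then show ?case using partial_character_mult[OF R Suc a] by (simp add: mult.commute)
  qed (simp add: partial_character_one[OF R])
  show ?thesis
  proof (cases k rule: int_cases2)
    case (nonneg n)
    then show ?thesis using nat[of n] by (simp add: int_pow_int)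
  next
    case (nonpos n)
    have "(inv (a [^] n), inverse (w ^ n)) \<in> R" by (rule partial_character_inv[OF R nat])
    then show ?thesis
      using nonpos partial_character_carrier[OF R a] by (simp add: int_pow_neg_int power_int_minus)
  qed
qed

lemma complex_root_neq_1:
  fixes z :: complex
  assumes "z \<noteq> 0" "n \<ge> 2"
  obtains c where "c ^ n = z" "c \<noteq> 1"
proof -
  have "card {c. c ^ n = z} = n" using assms by (intro card_nth_roots) auto
  then have "\<not> {c. c ^ n = z} \<subseteq> {1}"
    using assms(2) card_mono[of "{1::complex}" "{c. c ^ n = z}"] by auto
  with that show thesis by blast
qed

text \<open>If no positive power of \<open>a\<close> lies in the domain, the value at \<open>a\<close> may be chosen freely. Otherwise,
  with \<open>n\<close> the least exponent such that \<open>a\<^sup>n\<close> lies in the domain, it has to be an \<open>n\<close>-th root of the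
  value at \<open>a\<^sup>n\<close>. Here \<open>n \<ge> 2\<close>, so that some admissible value differs from \<open>1\<close>; this is what makes
  characters separate points.\<close>

lemma (in comm_group) partial_character_adjoin:
  assumes R: "partial_character G R" and a: "a \<in> carrier G" "a \<notin> fst ` R"
  obtains c R' where "partial_character G R'" "R \<subseteq> R'" "(a, c) \<in> R'" "c \<noteq> 1"
proof -
  note mult = partial_character_mult[OF R] and carr = partial_character_carrier[OF R]
  have "\<exists>c. c \<noteq> 0 \<and> c \<noteq> 1 \<and> (\<forall>x z k. (x, z) \<in> R \<and> x \<otimes> a [^] (k::int) = \<one> \<longrightarrow> z * c powi k = 1)"
  proof (cases "\<exists>n::nat. n > 0 \<and> a [^] n \<in> fst ` R")
    case False
    have nat: "n = 0" if "a [^] n \<in> fst ` R" for n :: nat using that False by auto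
    have "z * 2 powi k = 1" if "(x, z) \<in> R" "x \<otimes> a [^] k = \<one>" for x z and k :: int
    proof -
      have ak: "inv x = a [^] k"
        using inv_unique'[of x "a [^] k"] that carr a(1) by (simp add: m_comm)
      then have inR: "(a [^] k, inverse z) \<in> R" using partial_character_inv[OF R that(1)] by simp
      have "(a [^] (- k), z) \<in> R"
        using that(1) ak carr[OF that(1)] a(1) by (metis int_pow_neg inv_inv)
      have "k = 0"
      proof (cases k rule: int_cases2)
        case (nonneg n)
        then have "(a [^] n, inverse z) \<in> R" using inR by (simp add: int_pow_int)
        then have "n = 0" by (intro nat) force
        then show ?thesis using nonneg by simp
      next
        case (nonpos n)
        then have "(a [^] n, z) \<in> R" using \<open>(a [^] (- k), z) \<in> R\<close> by (simp add: int_pow_int)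
        then have "n = 0" by (intro nat) force
        then show ?thesis using nonpos by simp
      qed
      then show ?thesis
        using that carr[OF that(1)] partial_character_at_one[OF R] by auto
    qed
    then show ?thesis by (intro exI[of _ 2]) auto
  next
    case True
    define n where "n = (LEAST n::nat. n > 0 \<and> a [^] n \<in> fst ` R)"
    have n: "n > 0" "a [^] n \<in> fst ` R" using LeastI_ex[OF True] by (auto simp: n_def)
    have least: "n \<le> m" if "m > 0" "a [^] m \<in> fst ` R" for m
      unfolding n_def by (rule Least_le) (use that in auto)
    have "n \<noteq> 1" using n a by force
    then have "n \<ge> 2" using n by auto
    obtain z0 where z0: "(a [^] n, z0) \<in> R" using n(2) by auto
    obtain c where c: "c ^ n = z0" "c \<noteq> 1"
      using complex_root_neq_1[OF partial_character_nonzero[OF R z0] \<open>n \<ge> 2\<close>] by blast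
    have "z * c powi k = 1" if "(x, z) \<in> R" "x \<otimes> a [^] k = \<one>" for x z and k :: int
    proof -
      have ak: "inv x = a [^] k"
        using inv_unique'[of x "a [^] k"] that carr a(1) by (simp add: m_comm)
      then have inR: "(a [^] k, inverse z) \<in> R" using partial_character_inv[OF R that(1)] by simp
      define q r where "q = k div int n" and "r = k mod int n"
      have kqr: "k = int n * q + r" by (simp add: q_def r_def)
      have r: "0 \<le> r" "r < int n" using n(1) by (auto simp: r_def)
      have zq: "(a [^] (int n * q), z0 powi q) \<in> R"
        using partial_character_int_pow[OF R z0, of q] a(1) by (simp add: int_pow_pow int_pow_int[symmetric])
      have "(a [^] (int n * (- q)), z0 powi (- q)) \<in> R"
        using partial_character_int_pow[OF R z0, of "- q"] a(1)
        by (simp add: int_pow_pow int_pow_int[symmetric])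
      then have "(a [^] k \<otimes> a [^] (int n * (- q)), inverse z * z0 powi (- q)) \<in> R"
        by (rule mult[OF inR])
      moreover have "a [^] k \<otimes> a [^] (int n * (- q)) = a [^] nat r"
        using a(1) r(1) by (simp add: int_pow_mult[symmetric] int_pow_int[symmetric] kqr)
      ultimately have "a [^] nat r \<in> fst ` R" by force
      then have "r = 0" using least[of "nat r"] r by linarith
      then have "inverse z = z0 powi q"
        using partial_character_unique[OF R] zq inR kqr by simp
      also have "\<dots> = c powi k" by (simp add: c(1)[symmetric] kqr \<open>r = 0\<close> power_int_power)
      finally show ?thesis
        using partial_character_nonzero[OF R that(1)] by (metis right_inverse)
    qed
    moreover have "c \<noteq> 0" using c(1) partial_character_nonzero[OF R z0] n(1) by auto
    ultimately show ?thesis using c(2) by blast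
  qed
  then obtain c where c: "c \<noteq> 0" "c \<noteq> 1"
    "\<And>x z k. (x, z) \<in> R \<Longrightarrow> x \<otimes> a [^] (k::int) = \<one> \<Longrightarrow> z * c powi k = 1" by blast
  define R' where "R' = {(x \<otimes> a [^] k, z * c powi k) | x z (k::int). (x, z) \<in> R}"
  have R'I: "(x \<otimes> a [^] k, z * c powi k) \<in> R'" if "(x, z) \<in> R" for x z and k :: int
    using that unfolding R'_def by blast
  have "partial_character G R'"
    unfolding partial_character_def
  proof (intro conjI allI impI)
    show "R' \<subseteq> carrier G \<times> - {0}"
      using carr partial_character_nonzero[OF R] a(1) c(1) by (auto simp: R'_def)
    show "(\<one>, 1) \<in> R'" using R'I[OF partial_character_one[OF R], of 0] by simp
    show "z = 1" if "(\<one>, z) \<in> R'" for z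
      using that c(3) unfolding R'_def by (smt (verit) mem_Collect_eq old.prod.inject)
  next
    fix x w assume "(x, w) \<in> R'"
    then obtain y z k where *: "x = y \<otimes> a [^] k" "w = z * c powi k" "(y, z) \<in> R"
      unfolding R'_def by blast
    have "inv x = inv y \<otimes> a [^] (- k)"
      using carr[OF *(3)] a(1) by (simp add: *(1) inv_mult int_pow_neg)
    moreover have "inverse w = inverse z * c powi (- k)"
      by (simp add: *(2) power_int_minus)
    ultimately show "(inv x, inverse w) \<in> R'"
      using R'I[OF partial_character_inv[OF R *(3)], of "- k"] by simp
  next
    fix x w y z assume "(x, w) \<in> R' \<and> (y, z) \<in> R'"
    then obtain x1 w1 k1 x2 w2 k2 where *: "x = x1 \<otimes> a [^] k1" "w = w1 * c powi k1" "(x1, w1) \<in> R"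
      "y = x2 \<otimes> a [^] k2" "z = w2 * c powi k2" "(x2, w2) \<in> R"
      unfolding R'_def by blast
    have "x \<otimes> y = (x1 \<otimes> x2) \<otimes> a [^] (k1 + k2)"
      using carr[OF *(3)] carr[OF *(6)] a(1) by (simp add: *(1,4) int_pow_mult m_ac)
    moreover have "w * z = (w1 * w2) * c powi (k1 + k2)"
      using c(1) by (simp add: *(2,5) power_int_add)
    ultimately show "(x \<otimes> y, w * z) \<in> R'"
      using R'I[OF mult[OF *(3) *(6)], of "k1 + k2"] by simp
  qed
  moreover have "R \<subseteq> R'"
  proof
    fix p assume p: "p \<in> R"
    then show "p \<in> R'" using R'I[of "fst p" "snd p" 0] carr[of "fst p" "snd p"] by simp
  qed
  moreover have "(a, c) \<in> R'" using R'I[OF partial_character_one[OF R], of 1] a(1) by simp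
  ultimately show thesis using c(2) that by blast
qed

text \<open>By Zorn's lemma there is a maximal extension, and one more element could be adjoined to it if
  it were not defined everywhere.\<close>

theorem (in comm_group) partial_character_extends:
  assumes R: "partial_character G R"
  obtains \<psi> where "\<psi> \<in> hom G units_monoid" "\<And>x z. (x, z) \<in> R \<Longrightarrow> \<psi> x = z"
proof -
  define \<A> where "\<A> = {M. partial_character G M \<and> R \<subseteq> M}"
  have "\<exists>M\<in>\<A>. \<forall>M'\<in>\<A>. M \<subseteq> M' \<longrightarrow> M' = M"
  proof (rule subset_Zorn_nonempty)
    show "\<A> \<noteq> {}" using R by (auto simp: \<A>_def)
    fix \<C> assume ne: "\<C> \<noteq> {}" and ch: "subset.chain \<A> \<C>"
    have pc: "partial_character G M" "R \<subseteq> M" if "M \<in> \<C>" for M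
      using that ch by (auto simp: \<A>_def subset.chain_def)
    have "partial_character G (\<Union>\<C>)"
      unfolding partial_character_def
    proof (intro conjI allI impI)
      show "\<Union>\<C> \<subseteq> carrier G \<times> - {0}" using pc(1) unfolding partial_character_def by blast
      show "(\<one>, 1) \<in> \<Union>\<C>" using pc(1) ne partial_character_one by fast
      show "z = 1" if "(\<one>, z) \<in> \<Union>\<C>" for z using that pc(1) partial_character_at_one by fast
      show "(inv x, inverse w) \<in> \<Union>\<C>" if "(x, w) \<in> \<Union>\<C>" for x w
        using that pc(1) partial_character_inv by fast
    next
      fix x w y z assume "(x, w) \<in> \<Union>\<C> \<and> (y, z) \<in> \<Union>\<C>"
      then obtain M1 M2 where M: "M1 \<in> \<C>" "(x, w) \<in> M1" "M2 \<in> \<C>" "(y, z) \<in> M2" by blast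
      have "M1 \<subseteq> M2 \<or> M2 \<subseteq> M1" using ch M by (auto simp: subset.chain_def)
      then obtain M where "M \<in> \<C>" "(x, w) \<in> M" "(y, z) \<in> M" using M by blast
      then show "(x \<otimes> y, w * z) \<in> \<Union>\<C>" using partial_character_mult[OF pc(1)] by blast
    qed
    moreover have "R \<subseteq> \<Union>\<C>" using ne pc(2) by blast
    ultimately show "\<Union>\<C> \<in> \<A>" by (simp add: \<A>_def)
  qed
  then obtain M where "M \<in> \<A>" and max': "\<forall>M'\<in>\<A>. M \<subseteq> M' \<longrightarrow> M' = M" ..
  then have M: "partial_character G M" "R \<subseteq> M" by (auto simp: \<A>_def)
  have max: "M' = M" if "partial_character G M'" "M \<subseteq> M'" for M'
  proof -
    have "M' \<in> \<A>" using that M(2) by (simp add: \<A>_def)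
    with max' that(2) show ?thesis by simp
  qed
  have total: "\<exists>z. (a, z) \<in> M" if a: "a \<in> carrier G" for a
  proof (rule ccontr)
    assume "\<nexists>z. (a, z) \<in> M"
    then have "a \<notin> fst ` M" by auto
    then obtain c R' where R': "partial_character G R'" "M \<subseteq> R'" "(a, c) \<in> R'"
      using partial_character_adjoin[OF M(1) a] by blast
    with max[OF R'(1,2)] \<open>\<nexists>z. (a, z) \<in> M\<close> show False by blast
  qed
  define \<psi> where "\<psi> a = (THE z. (a, z) \<in> M)" for a
  have \<psi>: "\<psi> a = z" if "(a, z) \<in> M" for a z
    unfolding \<psi>_def using that partial_character_unique[OF M(1)] by blast
  have "\<psi> \<in> hom G units_monoid"
  proof (rule homI)
    fix x assume "x \<in> carrier G"
    then obtain z where "(x, z) \<in> M" using total by blast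
    then show "\<psi> x \<in> carrier units_monoid"
      using \<psi> partial_character_nonzero[OF M(1)] by auto
    fix y assume "y \<in> carrier G"
    then obtain w where "(y, w) \<in> M" using total by blast
    then show "\<psi> (x \<otimes> y) = \<psi> x \<otimes>\<^bsub>units_monoid\<^esub> \<psi> y"
      using \<psi> \<open>(x, z) \<in> M\<close> partial_character_mult[OF M(1)] by auto
  qed
  with \<psi> M(2) that show thesis by blast
qed

lemma charsD:
  assumes "\<nu> \<in> chars G H N"
  shows chars_mult: "x \<in> H \<Longrightarrow> y \<in> H \<Longrightarrow> \<nu> (x \<otimes>\<^bsub>G\<^esub> y) = \<nu> x * \<nu> y"
    and chars_nonzero: "x \<in> H \<Longrightarrow> \<nu> x \<noteq> 0"
    and chars_trivial: "x \<in> N \<Longrightarrow> \<nu> x = 1"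
    and chars_extensional: "\<nu> \<in> extensional H"
  using assms by (auto simp: chars_def hom_def)

lemma charsI:
  assumes "\<And>x. x \<in> H \<Longrightarrow> \<nu> x \<noteq> 0" "\<And>x y. x \<in> H \<Longrightarrow> y \<in> H \<Longrightarrow> \<nu> (x \<otimes>\<^bsub>G\<^esub> y) = \<nu> x * \<nu> y"
    "\<nu> \<in> extensional H" "\<And>x. x \<in> N \<Longrightarrow> \<nu> x = 1"
  shows "\<nu> \<in> chars G H N"
  using assms by (auto simp: chars_def hom_def)

locale abelian_quotient = normal H G for H :: "'g set" and G :: "'g monoid" (structure) +
  assumes derived_subset: "derived G (carrier G) \<subseteq> H"

lemma (in abelian_quotient) comm_group_quotient:
  shows "comm_group (G Mod H)"
proof (rule group.group_comm_groupI[OF factorgroup_is_group])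
  fix A B assume "A \<in> carrier (G Mod H)" "B \<in> carrier (G Mod H)"
  then obtain x y where xy: "x \<in> carrier G" "y \<in> carrier G" "A = H #> x" "B = H #> y"
    by (auto simp: carrier_FactGroup)
  have "x \<otimes> y \<otimes> inv x \<otimes> inv y \<in> H"
    using derived_subset xy unfolding derived_def by (blast intro: generate.incl)
  then have "(x \<otimes> y \<otimes> inv x \<otimes> inv y) \<otimes> (y \<otimes> x) \<in> H #> (y \<otimes> x)"
    unfolding r_coset_def by blast
  also have "(x \<otimes> y \<otimes> inv x \<otimes> inv y) \<otimes> (y \<otimes> x) = x \<otimes> y"
    using xy by (simp add: m_assoc inv_solve_left')
  finally have "H #> (x \<otimes> y) = H #> (y \<otimes> x)"
    using repr_independence[OF _ _ subgroup_axioms] xy by simp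
  then show "A \<otimes>\<^bsub>G Mod H\<^esub> B = B \<otimes>\<^bsub>G Mod H\<^esub> A" using xy by (simp add: rcos_sum)
qed

lemma (in abelian_quotient) chars_of_quotient:
  assumes "\<psi> \<in> hom (G Mod H) units_monoid"
  shows "(\<lambda>x\<in>carrier G. \<psi> (H #> x)) \<in> chars G (carrier G) H"
proof (rule charsI)
  have in_quot: "H #> x \<in> carrier (G Mod H)" if "x \<in> carrier G" for x
    using that by (auto simp: carrier_FactGroup)
  show "(\<lambda>x\<in>carrier G. \<psi> (H #> x)) x \<noteq> 0" if "x \<in> carrier G" for x
    using that hom_in_carrier[OF assms in_quot] by auto
  show "(\<lambda>x\<in>carrier G. \<psi> (H #> x)) (x \<otimes> y) =
      (\<lambda>x\<in>carrier G. \<psi> (H #> x)) x * (\<lambda>x\<in>carrier G. \<psi> (H #> x)) y"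
    if "x \<in> carrier G" "y \<in> carrier G" for x y
    using that hom_mult[OF assms in_quot in_quot, of x y] by (simp add: rcos_sum)
  have "\<psi> H = 1"
  proof -
    have "\<psi> (\<one>\<^bsub>G Mod H\<^esub> \<otimes>\<^bsub>G Mod H\<^esub> \<one>\<^bsub>G Mod H\<^esub>) = \<psi> \<one>\<^bsub>G Mod H\<^esub> * \<psi> \<one>\<^bsub>G Mod H\<^esub>"
      using hom_mult[OF assms] group.is_monoid[OF factorgroup_is_group] monoid.one_closed
      by (metis units_monoid_simps(2))
    moreover have "\<one>\<^bsub>G Mod H\<^esub> \<otimes>\<^bsub>G Mod H\<^esub> \<one>\<^bsub>G Mod H\<^esub> = \<one>\<^bsub>G Mod H\<^esub>"
      using group.is_monoid[OF factorgroup_is_group] by (simp del: one_FactGroup mult_FactGroup)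
    moreover have "\<psi> H \<noteq> 0"
      using hom_in_carrier[OF assms in_quot[of \<one>]] by (simp add: coset_mult_one subset)
    ultimately show ?thesis by simp
  qed
  then show "(\<lambda>x\<in>carrier G. \<psi> (H #> x)) x = 1" if "x \<in> H" for x
    using that by (simp add: rcos_const)
qed simp

text \<open>The images of the elements of \<open>K\<close> in the quotient carry a partial character, because \<open>\<nu>\<close> is trivial
  on \<open>K \<inter> H\<close>.\<close>

lemma (in abelian_quotient) character_extends:
  assumes K: "subgroup K G" and \<nu>: "\<nu> \<in> chars G K (K \<inter> H)"
  obtains \<mu> where "\<mu> \<in> chars G (carrier G) H" "restrict \<mu> K = \<nu>"
proof -
  interpret Q: comm_group "G Mod H" by (rule comm_group_quotient)
  note Kc = subgroup.mem_carrier[OF K]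
  define R where "R = {(H #> k, \<nu> k) | k. k \<in> K}"
  have \<nu>1: "\<nu> \<one> = 1" using chars_trivial[OF \<nu>] subgroup.one_closed[OF K] by simp
  have "partial_character (G Mod H) R"
    unfolding partial_character_def
  proof (intro conjI allI impI)
    show "R \<subseteq> carrier (G Mod H) \<times> - {0}"
      using chars_nonzero[OF \<nu>] Kc by (auto simp: R_def carrier_FactGroup)
    show "(\<one>\<^bsub>G Mod H\<^esub>, 1) \<in> R"
      unfolding R_def using \<nu>1 subgroup.one_closed[OF K] coset_mult_one[OF subset]
      by (force)
  next
    fix z assume "(\<one>\<^bsub>G Mod H\<^esub>, z) \<in> R"
    then obtain k where k: "k \<in> K" "H = H #> k" "z = \<nu> k" by (auto simp: R_def)
    then have "k \<in> H" using rcos_self[OF Kc[OF k(1)] subgroup_axioms] by simp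
    then show "z = 1" using k chars_trivial[OF \<nu>] by simp
  next
    fix a w assume "(a, w) \<in> R"
    then obtain k where k: "k \<in> K" "a = H #> k" "w = \<nu> k" by (auto simp: R_def)
    have ik: "inv k \<in> K" by (rule subgroup.m_inv_closed[OF K k(1)])
    have "\<nu> (inv k) * \<nu> k = 1"
      using chars_mult[OF \<nu> ik k(1)] Kc[OF k(1)] \<nu>1 by simp
    then have "inverse w = \<nu> (inv k)" using k chars_nonzero[OF \<nu> k(1)] by (simp add: field_simps)
    moreover have "inv\<^bsub>G Mod H\<^esub> a = H #> inv k"
      using Kc[OF k(1)] by (simp add: k(2) inv_FactGroup carrier_FactGroup rcos_inv)
    ultimately show "(inv\<^bsub>G Mod H\<^esub> a, inverse w) \<in> R" using ik unfolding R_def by blast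
  next
    fix a w b z assume "(a, w) \<in> R \<and> (b, z) \<in> R"
    then obtain k l where k: "k \<in> K" "a = H #> k" "w = \<nu> k" "l \<in> K" "b = H #> l" "z = \<nu> l"
      by (auto simp: R_def)
    then have "a \<otimes>\<^bsub>G Mod H\<^esub> b = H #> (k \<otimes> l)" "w * z = \<nu> (k \<otimes> l)"
      using Kc by (simp_all add: rcos_sum chars_mult[OF \<nu>])
    then show "(a \<otimes>\<^bsub>G Mod H\<^esub> b, w * z) \<in> R"
      using subgroup.m_closed[OF K k(1,4)] unfolding R_def by blast
  qed
  then obtain \<psi> where \<psi>: "\<psi> \<in> hom (G Mod H) units_monoid" "\<And>x z. (x, z) \<in> R \<Longrightarrow> \<psi> x = z"
    using Q.partial_character_extends by blast
  have "restrict (\<lambda>x\<in>carrier G. \<psi> (H #> x)) K = \<nu>"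
  proof (rule extensionalityI[OF _ chars_extensional[OF \<nu>]])
    show "restrict (\<lambda>x\<in>carrier G. \<psi> (H #> x)) K k = \<nu> k" if "k \<in> K" for k
      using that Kc \<psi>(2)[of "H #> k" "\<nu> k"] by (auto simp: R_def)
  qed (rule restrict_extensional)
  with chars_of_quotient[OF \<psi>(1)] that show thesis by blast
qed

text \<open>The trivial partial character is extended first to the coset of \<open>h\<close>, with a value other than \<open>1\<close>.\<close>

lemma (in abelian_quotient) characters_separate:
  assumes h: "h \<in> carrier G" "h \<notin> H"
  obtains \<mu> where "\<mu> \<in> chars G (carrier G) H" "\<mu> h \<noteq> 1"
proof -
  interpret Q: comm_group "G Mod H" by (rule comm_group_quotient)
  have "partial_character (G Mod H) {(\<one>\<^bsub>G Mod H\<^esub>, 1)}"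
    unfolding partial_character_def
    using Q.one_closed Q.l_one[OF Q.one_closed] Q.inv_one by (auto simp del: one_FactGroup mult_FactGroup)
  moreover have "H #> h \<in> carrier (G Mod H)" using h by (auto simp: carrier_FactGroup)
  moreover have "H #> h \<notin> fst ` {(\<one>\<^bsub>G Mod H\<^esub>, 1)}"
    using rcos_self[OF h(1) subgroup_axioms] h(2) by auto
  ultimately obtain c R where R: "partial_character (G Mod H) R" "(H #> h, c) \<in> R" "c \<noteq> 1"
    using Q.partial_character_adjoin by metis
  then obtain \<psi> where \<psi>: "\<psi> \<in> hom (G Mod H) units_monoid" "\<And>x z. (x, z) \<in> R \<Longrightarrow> \<psi> x = z"
    using Q.partial_character_extends by blast
  have "(\<lambda>x\<in>carrier G. \<psi> (H #> x)) h \<noteq> 1" using \<psi>(2)[OF R(2)] R(3) h(1) by simp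
  with chars_of_quotient[OF \<psi>(1)] that show thesis by blast
qed

definition coset_rep :: "'g set \<Rightarrow> 'g" where
  "coset_rep D = (SOME x. x \<in> D)"

lemma (in abelian_quotient) coset_rep:
  assumes D: "D \<in> rcosets H"
  shows coset_rep_in: "coset_rep D \<in> D" and coset_rep_carrier: "coset_rep D \<in> carrier G"
proof -
  have "D \<noteq> {}" using D rcos_self[OF _ subgroup_axioms] by (auto simp: RCOSETS_def)
  then show "coset_rep D \<in> D" by (simp add: coset_rep_def some_in_eq)
  then show "coset_rep D \<in> carrier G" using rcosets_carrier[OF is_group D] by blast
qed

text \<open>Right translation by \<open>k\<close> permutes the cosets of the normal subgroup, and \<open>F\<close> is constant on them.\<close>

lemma (in abelian_quotient) coset_sum_translate:
  fixes F :: "'g \<Rightarrow> 'v::comm_monoid_add"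
  assumes F: "\<And>h x. h \<in> H \<Longrightarrow> x \<in> carrier G \<Longrightarrow> F (h \<otimes> x) = F x" and k: "k \<in> carrier G"
    and r: "\<And>D. D \<in> rcosets H \<Longrightarrow> r D \<in> D"
  shows "(\<Sum>D\<in>rcosets H. F (r D \<otimes> k)) = (\<Sum>D\<in>rcosets H. F (r D))"
proof -
  have const: "F x = F y" if xy: "x \<in> D" "y \<in> D" and D: "D \<in> rcosets H" for x y D
  proof -
    obtain a where a: "a \<in> carrier G" "D = H #> a" using D unfolding RCOSETS_def by blast
    have "F z = F a" if z: "z \<in> D" for z
    proof -
      obtain h where "h \<in> H" "z = h \<otimes> a" using z a(2) unfolding r_coset_def by blast
      then show ?thesis using F a(1) by simp
    qed
    then show ?thesis using xy by simp
  qed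
  have D: "D #> x \<in> rcosets H" if "D \<in> rcosets H" "x \<in> carrier G" for D x
    using that subset by (auto simp: RCOSETS_def coset_mult_assoc)
  have sub: "D \<subseteq> carrier G" if "D \<in> rcosets H" for D
    using rcosets_carrier[OF is_group that] by blast
  have "(\<Sum>D\<in>rcosets H. F (r D \<otimes> k)) = (\<Sum>D\<in>rcosets H. F (r (D #> k)))"
  proof (rule sum.cong)
    fix E assume E: "E \<in> rcosets H"
    have "r E \<otimes> k \<in> E #> k" using r[OF E] by (auto simp: r_coset_def)
    then show "F (r E \<otimes> k) = F (r (E #> k))" using const D[OF E k] r by blast
  qed simp
  also have "\<dots> = (\<Sum>D\<in>rcosets H. F (r D))"
    by (rule sum.reindex_bij_witness[where i = "\<lambda>D. D #> inv k" and j = "\<lambda>D. D #> k"])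
      (use D k sub in \<open>auto simp: coset_mult_assoc coset_mult_one\<close>)
  finally show ?thesis .
qed

text \<open>A character is determined by its values on representatives of the finitely many cosets, and these
  values are roots of unity of order dividing the order of the quotient.\<close>

lemma (in abelian_quotient) finite_chars:
  assumes fin: "finite (rcosets H)"
  shows "finite (chars G (carrier G) H)"
proof -
  interpret Q: group "G Mod H" by (rule factorgroup_is_group)
  define n where "n = card (rcosets H)"
  have "rcosets H \<noteq> {}" using rcosetsI[OF subset one_closed] by blast
  then have n: "n > 0" using fin by (simp add: n_def card_gt_0_iff)
  have root: "\<nu> x ^ n = 1" if \<nu>: "\<nu> \<in> chars G (carrier G) H" and x: "x \<in> carrier G" for \<nu> x
  proof -
    have "(H #> x) [^]\<^bsub>G Mod H\<^esub> order (G Mod H) = \<one>\<^bsub>G Mod H\<^esub>"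
      using x by (intro Q.pow_order_eq_1) (auto simp: carrier_FactGroup)
    moreover have "order (G Mod H) = n" by (simp add: order_def n_def FactGroup_def)
    ultimately have "H #> (x [^] n) = H" using x FactGroup_pow by simp
    then have "x [^] n \<in> H" using rcos_self[OF _ subgroup_axioms, of "x [^] n"] x by simp
    then have "\<nu> (x [^] n) = 1" by (rule chars_trivial[OF \<nu>])
    moreover have "\<nu> (x [^] m) = \<nu> x ^ m" for m :: nat
      by (induction m) (use x chars_trivial[OF \<nu>, of \<one>] chars_mult[OF \<nu>] in \<open>auto simp: mult.commute\<close>)
    ultimately show ?thesis by simp
  qed
  have "inj_on (\<lambda>\<nu>. \<lambda>D\<in>rcosets H. \<nu> (coset_rep D)) (chars G (carrier G) H)"
  proof (rule inj_onI)
    fix \<nu> \<mu> assume \<nu>: "\<nu> \<in> chars G (carrier G) H" and \<mu>: "\<mu> \<in> chars G (carrier G) H"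
      and eq: "(\<lambda>D\<in>rcosets H. \<nu> (coset_rep D)) = (\<lambda>D\<in>rcosets H. \<mu> (coset_rep D))"
    show "\<nu> = \<mu>"
    proof (rule extensionalityI[OF chars_extensional[OF \<nu>] chars_extensional[OF \<mu>]])
      fix x assume x: "x \<in> carrier G"
      have D: "H #> x \<in> rcosets H" by (rule rcosetsI[OF subset x])
      have "\<nu> (coset_rep (H #> x)) = \<mu> (coset_rep (H #> x))" using fun_cong[OF eq, of "H #> x"] D by simp
      moreover obtain h where "h \<in> H" "coset_rep (H #> x) = h \<otimes> x" using coset_rep_in[OF D] by (auto simp: r_coset_def)
      ultimately show "\<nu> x = \<mu> x"
        using x chars_mult[OF \<nu>, of h x] chars_mult[OF \<mu>, of h x] chars_trivial[OF \<nu>, of h]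
          chars_trivial[OF \<mu>, of h] by simp
    qed
  qed
  moreover have "(\<lambda>\<nu>. \<lambda>D\<in>rcosets H. \<nu> (coset_rep D)) ` chars G (carrier G) H \<subseteq>
      (\<Pi>\<^sub>E D\<in>rcosets H. {z. z ^ n = 1})"
    using root coset_rep_carrier by auto
  moreover have "finite (\<Pi>\<^sub>E D\<in>rcosets H. {z::complex. z ^ n = 1})"
    by (intro finite_PiE fin finite_nth_roots n)
  ultimately show ?thesis using inj_on_finite by blast
qed

lemma (in abelian_quotient) chars_times:
  assumes "\<nu> \<in> chars G (carrier G) H" "\<mu> \<in> chars G (carrier G) H"
  shows "(\<lambda>x\<in>carrier G. \<nu> x * \<mu> x) \<in> chars G (carrier G) H"
  by (rule charsI) (use chars_nonzero[OF assms(1)] chars_nonzero[OF assms(2)] chars_mult[OF assms(1)]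
      chars_mult[OF assms(2)] chars_trivial[OF assms(1)] chars_trivial[OF assms(2)] in auto)

lemma (in abelian_quotient) chars_inverse:
  assumes "\<nu> \<in> chars G (carrier G) H"
  shows "(\<lambda>x\<in>carrier G. inverse (\<nu> x)) \<in> chars G (carrier G) H"
  by (rule charsI) (use chars_nonzero[OF assms(1)] chars_mult[OF assms(1)]
      chars_trivial[OF assms(1)] in auto)

text \<open>If some character has a value \<open>c \<noteq> 1\<close> at \<open>h\<close>, multiplication by this character permutes the summands
  and multiplies the sum by \<open>c\<close>, so the sum is \<open>0\<close>. Dually, the sum of a nontrivial character over the
  cosets is \<open>0\<close>. Evaluating the double sum over characters and cosets in both orders then shows that
  there are as many characters as cosets.\<close>

theorem (in abelian_quotient) sum_of_characters:
  assumes fin: "finite (rcosets H)" and h: "h \<in> carrier G"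
  shows "(\<Sum>\<nu>\<in>chars G (carrier G) H. \<nu> h) = (if h \<in> H then of_nat (card (rcosets H)) else 0)"
proof -
  let ?X = "chars G (carrier G) H"
  have finX: "finite ?X" by (rule finite_chars[OF fin])
  have out: "(\<Sum>\<nu>\<in>?X. \<nu> x) = 0" if x: "x \<in> carrier G" "x \<notin> H" for x
  proof -
    obtain \<mu> where \<mu>: "\<mu> \<in> ?X" "\<mu> x \<noteq> 1" using characters_separate[OF x] by blast
    have "(\<Sum>\<nu>\<in>?X. \<nu> x) = (\<Sum>\<nu>\<in>?X. \<mu> x * \<nu> x)"
    proof (rule sum.reindex_bij_witness[where
          i = "\<lambda>\<nu>. \<lambda>x\<in>carrier G. \<mu> x * \<nu> x" and j = "\<lambda>\<nu>. \<lambda>x\<in>carrier G. inverse (\<mu> x) * \<nu> x"])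
      fix \<nu> assume \<nu>: "\<nu> \<in> ?X"
      show "(\<lambda>x\<in>carrier G. \<mu> x * \<nu> x) \<in> ?X" by (rule chars_times[OF \<mu>(1) \<nu>])
      show "(\<lambda>x\<in>carrier G. inverse (\<mu> x) * \<nu> x) \<in> ?X"
        using chars_times[OF chars_inverse[OF \<mu>(1)] \<nu>] by (simp cong: restrict_cong)
      show "(\<lambda>x\<in>carrier G. inverse (\<mu> x) * (\<lambda>x\<in>carrier G. \<mu> x * \<nu> x) x) = \<nu>"
        by (rule extensionalityI[OF _ chars_extensional[OF \<nu>]])
          (use chars_nonzero[OF \<mu>(1)] in \<open>auto simp: field_simps\<close>)
      show "(\<lambda>x\<in>carrier G. \<mu> x * (\<lambda>x\<in>carrier G. inverse (\<mu> x) * \<nu> x) x) = \<nu>"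
        by (rule extensionalityI[OF _ chars_extensional[OF \<nu>]])
          (use chars_nonzero[OF \<mu>(1)] in \<open>auto simp: field_simps\<close>)
      show "\<mu> x * (\<lambda>x\<in>carrier G. inverse (\<mu> x) * \<nu> x) x = \<nu> x"
        using x chars_nonzero[OF \<mu>(1)] by (simp add: field_simps)
    qed
    also have "\<dots> = \<mu> x * (\<Sum>\<nu>\<in>?X. \<nu> x)" by (simp add: sum_distrib_left)
    finally show ?thesis using \<mu>(2) by simp
  qed
  have "inside": "(\<Sum>\<nu>\<in>?X. \<nu> x) = of_nat (card ?X)" if "x \<in> H" for x
    using that by (simp add: chars_trivial)
  define \<epsilon> where "\<epsilon> = (\<lambda>x\<in>carrier G. 1 :: complex)"
  have \<epsilon>: "\<epsilon> \<in> ?X" by (rule charsI) (use mem_carrier in \<open>auto simp: \<epsilon>_def\<close>)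
  have orth: "(\<Sum>D\<in>rcosets H. \<nu> (coset_rep D)) = 0" if \<nu>: "\<nu> \<in> ?X" "\<nu> \<noteq> \<epsilon>" for \<nu>
  proof -
    obtain k where k: "k \<in> carrier G" "\<nu> k \<noteq> 1"
      using \<nu> extensionalityI[OF chars_extensional[OF \<nu>(1)] chars_extensional[OF \<epsilon>]]
      by (auto simp: \<epsilon>_def)
    have "(\<Sum>D\<in>rcosets H. \<nu> (coset_rep D)) = (\<Sum>D\<in>rcosets H. \<nu> (coset_rep D \<otimes> k))"
      by (rule coset_sum_translate[symmetric])
        (use k coset_rep_in chars_mult[OF \<nu>(1)] chars_trivial[OF \<nu>(1)] mem_carrier in auto)
    also have "\<dots> = (\<Sum>D\<in>rcosets H. \<nu> (coset_rep D)) * \<nu> k"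
      using k coset_rep_carrier by (simp add: sum_distrib_right chars_mult[OF \<nu>(1)])
    finally show ?thesis using k(2) by simp
  qed
  have "of_nat (card ?X) = (\<Sum>D\<in>rcosets H. if D = H then of_nat (card ?X) else (0::complex))"
    using fin subgroup_in_rcosets[OF is_group] by simp
  also have "\<dots> = (\<Sum>D\<in>rcosets H. \<Sum>\<nu>\<in>?X. \<nu> (coset_rep D))"
  proof (rule sum.cong)
    fix D assume D: "D \<in> rcosets H"
    show "(if D = H then of_nat (card ?X) else (0::complex)) = (\<Sum>\<nu>\<in>?X. \<nu> (coset_rep D))"
    proof (cases "D = H")
      case True
      then show ?thesis using "inside"[of "coset_rep D"] coset_rep_in[OF D] by simp
    next
      case False
      have "coset_rep D \<notin> H"
      proof
        assume "coset_rep D \<in> H"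
        then have "D \<inter> H \<noteq> {}" using coset_rep_in[OF D] by blast
        then show False
          using False rcos_disjoint[OF is_subgroup] D subgroup_in_rcosets[OF is_group]
          by (auto simp: pairwise_def disjnt_def)
      qed
      then show ?thesis using out[OF coset_rep_carrier[OF D]] False by simp
    qed
  qed simp
  also have "\<dots> = (\<Sum>\<nu>\<in>?X. \<Sum>D\<in>rcosets H. \<nu> (coset_rep D))" by (rule sum.swap)
  also have "\<dots> = (\<Sum>\<nu>\<in>?X. if \<nu> = \<epsilon> then of_nat (card (rcosets H)) else 0)"
    by (rule sum.cong) (use orth coset_rep_carrier in \<open>auto simp: \<epsilon>_def\<close>)
  also have "\<dots> = of_nat (card (rcosets H))" using finX \<epsilon> by simp
  finally have "of_nat (card ?X) = (of_nat (card (rcosets H)) :: complex)" .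
  then show ?thesis using out[OF h] "inside"[of h] by simp
qed

section \<open>Endomorphism algebras of direct sums\<close>

text \<open>The linear part of \<open>smooth_rep\<close>, which is what makes equivariant maps into \<open>\<sigma>\<close> a vector space.\<close>

definition linear_rep :: "'g set \<Rightarrow> ('g, 'v::complex_vector) rep \<Rightarrow> bool" where
  "linear_rep K \<sigma> \<longleftrightarrow>
     cvec.subspace (rep_space \<sigma>) \<and>
     (\<forall>h\<in>K. \<forall>v \<in> rep_space \<sigma>. act \<sigma> h v \<in> rep_space \<sigma>) \<and>
     (\<forall>h\<in>K. \<forall>u \<in> rep_space \<sigma>. \<forall>v \<in> rep_space \<sigma>. act \<sigma> h (u + v) = act \<sigma> h u + act \<sigma> h v) \<and>
     (\<forall>h\<in>K. \<forall>c. \<forall>v \<in> rep_space \<sigma>. act \<sigma> h (c *\<^sub>C v) = c *\<^sub>C act \<sigma> h v)"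

lemma linear_repD:
  assumes "linear_rep K \<sigma>"
  shows linear_rep_subspace: "cvec.subspace (rep_space \<sigma>)"
    and linear_rep_add:
      "h \<in> K \<Longrightarrow> u \<in> rep_space \<sigma> \<Longrightarrow> v \<in> rep_space \<sigma> \<Longrightarrow> act \<sigma> h (u + v) = act \<sigma> h u + act \<sigma> h v"
    and linear_rep_scale:
      "h \<in> K \<Longrightarrow> v \<in> rep_space \<sigma> \<Longrightarrow> act \<sigma> h (c *\<^sub>C v) = c *\<^sub>C act \<sigma> h v"
  using assms by (simp_all add: linear_rep_def)

lemma rep_hom_add_map:
  assumes \<tau>: "linear_rep K \<tau>" and "S \<in> rep_hom K \<sigma> \<tau>" "T \<in> rep_hom K \<sigma> \<tau>"
  shows "S + T \<in> rep_hom K \<sigma> \<tau>"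
  by (rule rep_homI)
    (use assms(2,3) in \<open>simp_all add: rep_homD linear_rep_add[OF \<tau>] cvec.scale_right_distrib
      cvec.subspace_add[OF linear_rep_subspace[OF \<tau>]]\<close>)

lemma linear_rep_act_zero:
  assumes "linear_rep K \<tau>" "h \<in> K" shows "act \<tau> h 0 = 0"
proof -
  have "act \<tau> h (0 *\<^sub>C 0) = 0 *\<^sub>C act \<tau> h 0"
    using assms cvec.subspace_0[OF linear_rep_subspace[OF assms(1)]] by (intro linear_rep_scale) auto
  then show ?thesis by simp
qed

lemma rep_hom_sum_map:
  assumes \<tau>: "linear_rep K \<tau>" and "\<And>i. i \<in> I \<Longrightarrow> T i \<in> rep_hom K \<sigma> \<tau>"
  shows "(\<Sum>i\<in>I. T i) \<in> rep_hom K \<sigma> \<tau>"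
  using assms(2)
proof (induction I rule: infinite_finite_induct)
  case (insert i I)
  show ?case
    unfolding sum.insert[OF insert.hyps] by (rule rep_hom_add_map[OF \<tau>]) (use insert in auto)
qed (simp_all add: zero_fun_def rep_hom_zero_map linear_rep_act_zero[OF \<tau>]
    cvec.subspace_0[OF linear_rep_subspace[OF \<tau>]])

definition endo_algebra ::
    "'g set \<Rightarrow> ('g, 'v::complex_vector) rep \<Rightarrow> (complex, 'v \<Rightarrow> 'v) module" where
  "endo_algebra K \<sigma> =
     \<lparr>carrier = rep_hom K \<sigma> \<sigma>, monoid.mult = (\<circ>), one = (\<lambda>v. if v \<in> rep_space \<sigma> then v else 0),
      ring.zero = 0, add = (+), smult = (*\<^sub>C)\<rparr>"

lemma hecke_algebra_endo: "hecke_algebra G H \<sigma> = endo_algebra (carrier G) (c_ind G H \<sigma>)"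
  by (simp add: hecke_algebra_def endo_algebra_def c_ind_def)

text \<open>An endomorphism \<open>T\<close> is sent to the family of its diagonal blocks \<open>p i \<circ> T \<circ> e i\<close>. Its other blocks,
  and likewise the maps \<open>p j \<circ> e i\<close> for \<open>i \<noteq> j\<close>, are equivariant maps between different summands and
  vanish, so that \<open>T\<close> is recovered from the diagonal and composition is blockwise.\<close>

theorem endo_algebra_direct_sum:
  fixes \<sigma> :: "('g, 'v::complex_vector) rep" and \<tau> :: "'i \<Rightarrow> ('g, 'w::complex_vector) rep"
  assumes I: "finite I"
    and \<sigma>: "linear_rep K \<sigma>" and \<tau>: "\<And>i. i \<in> I \<Longrightarrow> linear_rep K (\<tau> i)"
    and emb: "\<And>i. i \<in> I \<Longrightarrow> e i \<in> rep_hom K (\<tau> i) \<sigma>"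
    and prj: "\<And>i. i \<in> I \<Longrightarrow> p i \<in> rep_hom K \<sigma> (\<tau> i)"
    and split: "\<And>i w. i \<in> I \<Longrightarrow> w \<in> rep_space (\<tau> i) \<Longrightarrow> p i (e i w) = w"
    and total: "\<And>v. v \<in> rep_space \<sigma> \<Longrightarrow> (\<Sum>i\<in>I. e i (p i v)) = v"
    and disj: "\<And>i j \<phi> w. i \<in> I \<Longrightarrow> j \<in> I \<Longrightarrow> i \<noteq> j \<Longrightarrow> \<phi> \<in> rep_hom K (\<tau> i) (\<tau> j) \<Longrightarrow> \<phi> w = 0"
  shows "algebra_iso (endo_algebra K \<sigma>) (direct_sum_algebra I (\<lambda>i. endo_algebra K (\<tau> i)))"
proof -
  let ?A = "endo_algebra K \<sigma>" and ?B = "direct_sum_algebra I (\<lambda>i. endo_algebra K (\<tau> i))"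
  note V = linear_rep_subspace[OF \<sigma>]
  define C where "C T = (\<lambda>i\<in>I. p i \<circ> T \<circ> e i)" for T :: "'v \<Rightarrow> 'v"
  have C_in: "p i \<circ> T \<circ> e i \<in> rep_hom K (\<tau> i) (\<tau> i)" if "T \<in> rep_hom K \<sigma> \<sigma>" "i \<in> I" for T i
    using that by (intro rep_hom_comp[where \<tau> = \<sigma>] prj emb)
  have diagonal: "T (e i w) = e i (p i (T (e i w)))"
    if T: "T \<in> rep_hom K \<sigma> \<sigma>" and i: "i \<in> I" for T i w
  proof (cases "w \<in> rep_space (\<tau> i)")
    case True
    have in\<sigma>: "T (e i w) \<in> rep_space \<sigma>"
      using True i by (intro rep_hom_in[OF T] rep_hom_in[OF emb])
    have off: "p j (T (e i w)) = 0" if j: "j \<in> I" "j \<noteq> i" for j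
    proof -
      have "p j \<circ> (T \<circ> e i) \<in> rep_hom K (\<tau> i) (\<tau> j)"
        using T i j by (intro rep_hom_comp[where \<tau> = \<sigma>] prj emb)
      then show ?thesis using disj[of i j "p j \<circ> (T \<circ> e i)" w] i j by simp
    qed
    have "T (e i w) = (\<Sum>j\<in>I. e j (p j (T (e i w))))" using total[OF in\<sigma>] by simp
    also have "\<dots> = (\<Sum>j\<in>I. if j = i then e i (p i (T (e i w))) else 0)"
      by (rule sum.cong) (use off rep_hom_zero[OF emb] in auto)
    also have "\<dots> = e i (p i (T (e i w)))" using I i by simp
    finally show ?thesis .
  next
    case False
    then show ?thesis
      using i by (simp add: rep_hom_outside[OF emb] rep_hom_zero[OF T] rep_hom_zero[OF prj]
          rep_hom_zero[OF emb])
  qed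
  have reconstruct: "T v = (\<Sum>i\<in>I. e i (C T i (p i v)))" if T: "T \<in> rep_hom K \<sigma> \<sigma>" and v: "v \<in> rep_space \<sigma>" for T v
  proof -
    have "T v = T (\<Sum>i\<in>I. e i (p i v))" using total[OF v] by simp
    also have "\<dots> = (\<Sum>i\<in>I. T (e i (p i v)))"
      by (rule rep_hom_sum[OF T V]) (rule rep_hom_in[OF emb rep_hom_in[OF prj v]])
    also have "\<dots> = (\<Sum>i\<in>I. e i (C T i (p i v)))"
      by (rule sum.cong) (use diagonal[OF T] in \<open>auto simp: C_def\<close>)
    finally show ?thesis .
  qed
  have inj: "inj_on C (carrier ?A)"
  proof (rule inj_onI)
    fix S T assume "S \<in> carrier ?A" "T \<in> carrier ?A" and eq: "C S = C T"
    then have ST: "S \<in> rep_hom K \<sigma> \<sigma>" "T \<in> rep_hom K \<sigma> \<sigma>" by (simp_all add: endo_algebra_def)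
    show "S = T"
    proof
      fix v show "S v = T v"
      proof (cases "v \<in> rep_space \<sigma>")
        case True
        have "S v = (\<Sum>i\<in>I. e i (C S i (p i v)))" by (rule reconstruct[OF ST(1) True])
        also have "\<dots> = T v" unfolding eq by (rule reconstruct[OF ST(2) True, symmetric])
        finally show ?thesis .
      qed (simp add: rep_hom_outside[OF ST(1)] rep_hom_outside[OF ST(2)])
    qed
  qed
  have surj: "F \<in> C ` carrier ?A" if "F \<in> carrier ?B" for F
  proof -
    have F: "F i \<in> rep_hom K (\<tau> i) (\<tau> i)" if "i \<in> I" for i
      using \<open>F \<in> carrier ?B\<close> that by (auto simp: direct_sum_algebra_def endo_algebra_def)
    have Fext: "F \<in> extensional I"
      using \<open>F \<in> carrier ?B\<close> by (auto simp: direct_sum_algebra_def PiE_def)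
    define T where "T = (\<Sum>i\<in>I. e i \<circ> F i \<circ> p i)"
    have T: "T \<in> rep_hom K \<sigma> \<sigma>"
      unfolding T_def
      by (rule rep_hom_sum_map[OF \<sigma>]) (intro rep_hom_comp[OF rep_hom_comp[OF emb F] prj])
    have "C T i w = F i w" if i: "i \<in> I" for i w
    proof (cases "w \<in> rep_space (\<tau> i)")
      case False
      then show ?thesis
        using i by (simp add: C_def rep_hom_outside[OF emb] rep_hom_zero[OF T] rep_hom_zero[OF prj]
            rep_hom_outside[OF F])
    next
      case True
      have off: "p j (e i w) = 0" if j: "j \<in> I" "j \<noteq> i" for j
        using disj[of i j "p j \<circ> e i" w] rep_hom_comp[OF prj emb] i j by simp
      have "T (e i w) = (\<Sum>j\<in>I. e j (F j (p j (e i w))))" by (simp add: T_def sum_fun_apply)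
      also have "\<dots> = (\<Sum>j\<in>I. if j = i then e i (F i w) else 0)"
        by (rule sum.cong)
          (use off split[OF i True] rep_hom_zero[OF emb] rep_hom_zero[OF F] in auto)
      also have "\<dots> = e i (F i w)" using I i by simp
      finally show ?thesis using i split[OF i rep_hom_in[OF F[OF i] True]] by (simp add: C_def)
    qed
    then have "C T = F"
      by (intro extensionalityI[OF _ Fext]) (auto simp: C_def)
    moreover have "T \<in> carrier ?A" using T by (simp add: endo_algebra_def)
    ultimately show ?thesis by blast
  qed
  have carr: "C T \<in> carrier ?B" if "T \<in> carrier ?A" for T
    using that I C_in by (auto simp: direct_sum_algebra_def endo_algebra_def C_def)
  have "C \<in> ring_hom ?A ?B"
  proof (rule ring_hom_memI)
    fix T assume "T \<in> carrier ?A"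
    then show "C T \<in> carrier ?B" by (rule carr)
    from \<open>T \<in> carrier ?A\<close> have T: "T \<in> rep_hom K \<sigma> \<sigma>" by (simp add: endo_algebra_def)
    fix S assume "S \<in> carrier ?A"
    then have S: "S \<in> rep_hom K \<sigma> \<sigma>" by (simp add: endo_algebra_def)
    have "p i \<circ> (T \<circ> S) \<circ> e i = (p i \<circ> T \<circ> e i) \<circ> (p i \<circ> S \<circ> e i)" if "i \<in> I" for i
      by (rule ext) (simp add: diagonal[OF S that, symmetric])
    then show "C (T \<otimes>\<^bsub>?A\<^esub> S) = C T \<otimes>\<^bsub>?B\<^esub> C S"
      by (auto simp: direct_sum_algebra_def endo_algebra_def C_def fun_eq_iff)
    have "p i \<circ> (T + S) \<circ> e i = (p i \<circ> T \<circ> e i) + (p i \<circ> S \<circ> e i)" if i: "i \<in> I" for i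
    proof
      fix w show "(p i \<circ> (T + S) \<circ> e i) w = ((p i \<circ> T \<circ> e i) + (p i \<circ> S \<circ> e i)) w"
      proof (cases "w \<in> rep_space (\<tau> i)")
        case True
        then show ?thesis
          by (simp add: rep_hom_add[OF prj[OF i]] rep_hom_in[OF T] rep_hom_in[OF S]
              rep_hom_in[OF emb[OF i]])
      next
        case False
        then show ?thesis
          by (simp add: rep_hom_outside[OF emb[OF i]] rep_hom_zero[OF T] rep_hom_zero[OF S]
              rep_hom_zero[OF prj[OF i]])
      qed
    qed
    then show "C (T \<oplus>\<^bsub>?A\<^esub> S) = C T \<oplus>\<^bsub>?B\<^esub> C S"
      by (auto simp: direct_sum_algebra_def endo_algebra_def C_def fun_eq_iff)
  next
    have "p i ((\<lambda>v. if v \<in> rep_space \<sigma> then v else 0) (e i w)) =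
        (if w \<in> rep_space (\<tau> i) then w else 0)" if i: "i \<in> I" for i w
      using rep_hom_in[OF emb[OF i], of w] split[OF i, of w] rep_hom_outside[OF emb[OF i], of w]
        rep_hom_zero[OF prj[OF i]] by auto
    then show "C \<one>\<^bsub>?A\<^esub> = \<one>\<^bsub>?B\<^esub>"
      by (auto simp: direct_sum_algebra_def endo_algebra_def C_def fun_eq_iff)
  qed
  moreover have "bij_betw C (carrier ?A) (carrier ?B)"
    using inj surj carr by (auto simp: bij_betw_def)
  moreover have "C (c \<odot>\<^bsub>?A\<^esub> T) = c \<odot>\<^bsub>?B\<^esub> C T" if "T \<in> carrier ?A" for c T
  proof -
    have T: "T \<in> rep_hom K \<sigma> \<sigma>" using that by (simp add: endo_algebra_def)
    have "p i (c *\<^sub>C T (e i w)) = c *\<^sub>C p i (T (e i w))" if i: "i \<in> I" for i w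
    proof (cases "w \<in> rep_space (\<tau> i)")
      case True
      then show ?thesis
        by (simp add: rep_hom_scale[OF prj[OF i]] rep_hom_in[OF T] rep_hom_in[OF emb[OF i]])
    next
      case False
      then show ?thesis
        by (simp add: rep_hom_outside[OF emb[OF i]] rep_hom_zero[OF T] rep_hom_zero[OF prj[OF i]])
    qed
    then show ?thesis
      by (auto simp: direct_sum_algebra_def endo_algebra_def C_def fun_eq_iff scaleC_fun_def)
  qed
  ultimately show ?thesis unfolding algebra_iso_def ring_iso_def by blast
qed

lemma (in translation_group) linear_rep_c_ind:
  assumes H: "subgroup H G" and \<sigma>: "smooth_rep G H \<sigma>"
  shows "linear_rep (carrier G) (c_ind G H \<sigma>)"
  unfolding linear_rep_def rep_space_c_ind
proof (intro conjI ballI allI)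
  show "cvec.subspace (ind_space G H \<sigma>)" by (rule subspace_ind_space[OF H \<sigma>])
qed (auto simp: act_c_ind_in[OF H] fun_eq_iff scaleC_fun_def)


section \<open>Decomposition of induction in stages\<close>

text \<open>Through \<open>\<theta>\<close>, the representation \<open>\<rho>\<close> of \<open>J\<close> is the restriction of the representation \<open>\<sigma>\<close> of \<open>H\<close>, where
  \<open>H/J\<close> is finite and abelian. Inducing \<open>\<rho>\<close> to \<open>H\<close> then gives the sum of all \<open>\<sigma> \<otimes> \<nu>\<close> with \<open>\<nu>\<close> a
  character of \<open>H/J\<close>, and this decomposition persists after induction to \<open>G\<close>.\<close>

locale abelian_stage = translation_group G for G :: "('g::topological_space) monoid" (structure) +
  fixes J H :: "'g set"
    and \<rho> :: "('g, 'a::complex_vector) rep" and \<sigma> :: "('g, 'c::complex_vector) rep"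
    and \<theta> :: "'c \<Rightarrow> 'a"
  assumes open_J: "open_subgroup G J" and H: "subgroup H G"
    and quotient: "abelian_quotient J (G\<lparr>carrier := H\<rparr>)"
    and finite_quotient: "finite (rcosets\<^bsub>G\<lparr>carrier := H\<rparr>\<^esub> J)"
    and \<rho>: "smooth_rep G J \<rho>" and \<sigma>: "smooth_rep G H \<sigma>"
    and \<theta>: "\<theta> \<in> rep_hom J \<sigma> \<rho>" "bij_betw \<theta> (rep_space \<sigma>) (rep_space \<rho>)"
begin

sublocale Q: abelian_quotient J "G\<lparr>carrier := H\<rparr>" by (rule quotient)

lemma J_subset_H: "J \<subseteq> H" using Q.subset by simp

lemma subgroup_J: "subgroup J G" by (rule open_subgroup_subgroup[OF open_J])

lemma H_carrier: "h \<in> H \<Longrightarrow> h \<in> carrier G" by (rule subgroup.mem_carrier[OF H])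

abbreviation (input) cosets where "cosets \<equiv> rcosets\<^bsub>G\<lparr>carrier := H\<rparr>\<^esub> J"

lemma coset_rep_H: "D \<in> cosets \<Longrightarrow> coset_rep D \<in> H"
  using Q.coset_rep_carrier by simp

lemma H_decompose:
  assumes "h \<in> H" obtains D j where "D \<in> cosets" "j \<in> J" "h = j \<otimes> coset_rep D"
proof -
  let ?D = "J #> h"
  have D: "?D \<in> cosets" using assms by (auto simp: RCOSETS_def r_coset_def)
  obtain i where i: "i \<in> J" "coset_rep ?D = i \<otimes> h" using Q.coset_rep_in[OF D] by (auto simp: r_coset_def)
  have "h = inv i \<otimes> coset_rep ?D"
    using i assms H_carrier J_subset_H by (simp add: m_assoc[symmetric] subset_iff)
  with D that i(1) subgroup.m_inv_closed[OF subgroup_J] show thesis by blast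
qed

abbreviation \<theta>' where "\<theta>' \<equiv> hom_inverse \<sigma> \<rho> \<theta>"

lemma \<theta>': "\<theta>' \<in> rep_hom J \<rho> \<sigma>" "v \<in> rep_space \<sigma> \<Longrightarrow> \<theta>' (\<theta> v) = v"
  "w \<in> rep_space \<rho> \<Longrightarrow> \<theta> (\<theta>' w) = w"
  using hom_inverse[OF \<theta> smooth_rep_subspace[OF \<sigma>]] smooth_rep_in[OF \<sigma>] J_subset_H by blast+

lemma smooth_twist: "\<nu> \<in> chars G H J \<Longrightarrow> smooth_rep G H (twist \<sigma> \<nu>)"
  by (rule smooth_rep_twist[OF H \<sigma> _ open_J J_subset_H])

definition embed :: "('g \<Rightarrow> complex) \<Rightarrow> ('g \<Rightarrow> 'c) \<Rightarrow> 'g \<Rightarrow> 'a" where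
  "embed \<nu> f = (if f \<in> ind_space G H (twist \<sigma> \<nu>) then \<theta> \<circ> f else 0)"

text \<open>Up to the identification \<open>\<theta>\<close>, the group \<open>H/J\<close> acts on the functions \<open>f\<close> in the space of the induced
  representation by \<open>(h f)(x) = \<sigma>(h)\<inverse> f(h x)\<close>; this is the projection onto the part on which it acts
  by the character \<open>\<nu>\<close>.\<close>

definition project :: "('g \<Rightarrow> complex) \<Rightarrow> ('g \<Rightarrow> 'a) \<Rightarrow> 'g \<Rightarrow> 'c" where
  "project \<nu> f x = (if f \<in> ind_space G J \<rho> \<and> x \<in> carrier G
     then (1 / of_nat (card cosets)) *\<^sub>C
       (\<Sum>D\<in>cosets. inverse (\<nu> (coset_rep D)) *\<^sub>C act \<sigma> (inv (coset_rep D)) (\<theta>' (f (coset_rep D \<otimes> x))))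
     else 0)"

text \<open>Only the support needs an argument: with \<open>R\<close> a finite set of representatives of \<open>H/J\<close>, the set
  \<open>H C\<close> is \<open>J (R C)\<close>, and \<open>R C\<close> is again compact.\<close>

lemma embed_in:
  assumes \<nu>: "\<nu> \<in> chars G H J" and f: "f \<in> ind_space G H (twist \<sigma> \<nu>)"
  shows "\<theta> \<circ> f \<in> ind_space G J \<rho>"
proof -
  obtain K where K: "open_subgroup G K" "\<forall>k\<in>K. \<forall>x \<in> carrier G. f (x \<otimes> k) = f x"
    using ind_space_smooth[OF f] by blast
  obtain C where C: "C \<subseteq> carrier G" "compact C" "{x \<in> carrier G. f x \<noteq> 0} \<subseteq> H <#> C"
    using ind_space_support[OF f] by blast
  let ?C = "\<Union>D\<in>cosets. (\<lambda>c. coset_rep D \<otimes> c) ` C"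
  have in\<sigma>: "f x \<in> rep_space \<sigma>" if "x \<in> carrier G" for x using ind_space_in[OF f that] by simp
  show ?thesis
  proof (rule ind_spaceI[OF _ _ _ K(1)])
    show "compact ?C"
      by (intro compact_UN finite_quotient compact_left_translate C H_carrier coset_rep_H)
    show "?C \<subseteq> carrier G" using C(1) coset_rep_H H_carrier by auto
    show "x \<in> J <#> ?C" if x: "x \<in> carrier G" "(\<theta> \<circ> f) x \<noteq> 0" for x
    proof -
      have "f x \<noteq> 0" using x rep_hom_zero[OF \<theta>(1)] by auto
      then obtain h c where hc: "h \<in> H" "c \<in> C" "x = h \<otimes> c"
        using C(3) x by (auto simp: set_mult_def)
      obtain D j where D: "D \<in> cosets" "j \<in> J" "h = j \<otimes> coset_rep D" by (rule H_decompose[OF hc(1)])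
      have "x = j \<otimes> (coset_rep D \<otimes> c)"
        using hc D C(1) H_carrier[OF coset_rep_H[OF D(1)]] subgroup.mem_carrier[OF subgroup_J]
        by (auto simp: m_assoc)
      then show ?thesis using D hc(2) unfolding set_mult_def by blast
    qed
    show "(\<theta> \<circ> f) (j \<otimes> x) = act \<rho> j ((\<theta> \<circ> f) x)" if "j \<in> J" "x \<in> carrier G" for j x
      using that J_subset_H ind_space_left[OF f, of j x] in\<sigma>
      by (auto simp: chars_trivial[OF \<nu>] rep_hom_act[OF \<theta>(1)])
  qed (use K(2) in\<sigma> rep_hom_in[OF \<theta>(1)] rep_hom_zero[OF \<theta>(1)] ind_space_outside[OF f] in auto)
qed

lemma embed_rep_hom:
  assumes \<nu>: "\<nu> \<in> chars G H J"
  shows "embed \<nu> \<in> rep_hom (carrier G) (c_ind G H (twist \<sigma> \<nu>)) (c_ind G J \<rho>)"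
proof (rule rep_homI, unfold rep_space_c_ind)
  let ?V = "ind_space G H (twist \<sigma> \<nu>)"
  note V = subspace_ind_space[OF H smooth_twist[OF \<nu>]]
  fix f assume f: "f \<in> ?V"
  then show "embed \<nu> f \<in> ind_space G J \<rho>" using embed_in[OF \<nu>] by (simp add: embed_def)
  have in\<sigma>: "f x \<in> rep_space \<sigma> \<or> f x = 0" if "f \<in> ?V" for f x
    using ind_space_in[OF that, of x] ind_space_outside[OF that, of x] by auto
  have zero: "0 \<in> rep_space \<sigma>" by (rule cvec.subspace_0[OF smooth_rep_subspace[OF \<sigma>]])
  have val: "f x \<in> rep_space \<sigma>" if "f \<in> ?V" for f x using in\<sigma>[OF that, of x] zero by auto
  show "embed \<nu> (c *\<^sub>C f) = c *\<^sub>C embed \<nu> f" for c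
    using f val[OF f] cvec.subspace_scale[OF V f]
    by (simp add: embed_def fun_eq_iff scaleC_fun_def rep_hom_scale[OF \<theta>(1)])
  show "embed \<nu> (act (c_ind G H (twist \<sigma> \<nu>)) g f) = act (c_ind G J \<rho>) g (embed \<nu> f)"
    if "g \<in> carrier G" for g
    using f act_c_ind_in[OF H f that] rep_hom_zero[OF \<theta>(1)] by (simp add: embed_def fun_eq_iff)
  fix f' assume f': "f' \<in> ?V"
  show "embed \<nu> (f' + f) = embed \<nu> f' + embed \<nu> f"
    using f f' val[OF f] val[OF f'] cvec.subspace_add[OF V f' f]
    by (simp add: embed_def fun_eq_iff rep_hom_add[OF \<theta>(1)])
qed (simp add: embed_def)

text \<open>The summands of the average depend on \<open>h\<close> only through its coset; this makes the average independent of
  the representatives and equivariant under \<open>H\<close>.\<close>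

lemma averaged_term_left_invariant:
  assumes \<nu>: "\<nu> \<in> chars G H J" and f: "f \<in> ind_space G J \<rho>" and x: "x \<in> carrier G"
    and j: "j \<in> J" and h: "h \<in> H"
  shows "inverse (\<nu> (j \<otimes> h)) *\<^sub>C act \<sigma> (inv (j \<otimes> h)) (\<theta>' (f (j \<otimes> h \<otimes> x))) =
    inverse (\<nu> h) *\<^sub>C act \<sigma> (inv h) (\<theta>' (f (h \<otimes> x)))"
proof -
  have jH: "j \<in> H" using j J_subset_H by blast
  note G = H_carrier[OF jH] H_carrier[OF h]
  have ij: "inv j \<in> J" "inv j \<in> H" "inv h \<in> H"
    using j h jH subgroup.m_inv_closed[OF subgroup_J] subgroup.m_inv_closed[OF H] by auto
  have fh: "f (h \<otimes> x) \<in> rep_space \<rho>" using ind_space_in[OF f] G x by simp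
  note w = rep_hom_in[OF \<theta>'(1) fh]
  have "act \<sigma> (inv (j \<otimes> h)) (\<theta>' (f (j \<otimes> h \<otimes> x))) =
      act \<sigma> (inv h \<otimes> inv j) (act \<sigma> j (\<theta>' (f (h \<otimes> x))))"
    using G x j fh ind_space_left[OF f j, of "h \<otimes> x"] rep_hom_act[OF \<theta>'(1) j fh]
    by (simp add: inv_mult_group m_assoc)
  also have "\<dots> = act \<sigma> (inv h \<otimes> inv j \<otimes> j) (\<theta>' (f (h \<otimes> x)))"
    using smooth_rep_mult[OF \<sigma> _ jH w, of "inv h \<otimes> inv j"] ij subgroup.m_closed[OF H] by simp
  also have "inv h \<otimes> inv j \<otimes> j = inv h" using G by (simp add: m_assoc)
  finally show ?thesis
    using chars_mult[OF \<nu> jH h] chars_trivial[OF \<nu> j] by simp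
qed

lemma coset_sum_translate_H:
  fixes F :: "'g \<Rightarrow> 'c"
  assumes "\<And>j h. j \<in> J \<Longrightarrow> h \<in> H \<Longrightarrow> F (j \<otimes> h) = F h" "k \<in> H"
  shows "(\<Sum>D\<in>cosets. F (coset_rep D \<otimes> k)) = (\<Sum>D\<in>cosets. F (coset_rep D))"
  using Q.coset_sum_translate[of F k coset_rep] assms Q.coset_rep_in by simp

lemma project_in:
  assumes \<nu>: "\<nu> \<in> chars G H J" and f: "f \<in> ind_space G J \<rho>"
  shows "project \<nu> f \<in> ind_space G H (twist \<sigma> \<nu>)"
proof -
  obtain K where K: "open_subgroup G K" "\<forall>k\<in>K. \<forall>x \<in> carrier G. f (x \<otimes> k) = f x"
    using ind_space_smooth[OF f] by blast
  obtain C where C: "C \<subseteq> carrier G" "compact C" "{x \<in> carrier G. f x \<noteq> 0} \<subseteq> J <#> C"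
    using ind_space_support[OF f] by blast
  note V = smooth_rep_subspace[OF \<sigma>]
  let ?n = "1 / of_nat (card cosets) :: complex"
  let ?t = "\<lambda>x h. inverse (\<nu> h) *\<^sub>C act \<sigma> (inv h) (\<theta>' (f (h \<otimes> x)))"
  have p: "project \<nu> f x = ?n *\<^sub>C (\<Sum>D\<in>cosets. ?t x (coset_rep D))" if "x \<in> carrier G" for x
    using that f by (simp add: project_def)
  have t_in: "act \<sigma> (inv h) (\<theta>' (f (h \<otimes> x))) \<in> rep_space \<sigma>" if "h \<in> H" "x \<in> carrier G" for x h
    using that H_carrier subgroup.m_inv_closed[OF H]
    by (intro smooth_rep_in[OF \<sigma>] rep_hom_in[OF \<theta>'(1)] ind_space_in[OF f]) auto
  have sum_in: "(\<Sum>D\<in>cosets. ?t x (coset_rep D)) \<in> rep_space \<sigma>" if "x \<in> carrier G" for x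
    by (intro cvec.subspace_sum[OF V] cvec.subspace_scale[OF V] t_in coset_rep_H that)
  show ?thesis
  proof (rule ind_spaceI[OF _ _ _ K(1) _ C(2,1)])
    show "project \<nu> f x \<in> rep_space (twist \<sigma> \<nu>)" if "x \<in> carrier G" for x
      using p[OF that] sum_in[OF that] cvec.subspace_scale[OF V] by simp
    show "project \<nu> f x = 0" if "x \<notin> carrier G" for x using that by (simp add: project_def)
    show "project \<nu> f (x \<otimes> k) = project \<nu> f x" if k: "k \<in> K" "x \<in> carrier G" for k x
    proof -
      have kG: "k \<in> carrier G" using k(1) subgroup.mem_carrier[OF open_subgroup_subgroup[OF K(1)]] by blast
      have "f (coset_rep D \<otimes> (x \<otimes> k)) = f (coset_rep D \<otimes> x)" if D: "D \<in> cosets" for D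
        using K(2) k kG H_carrier[OF coset_rep_H[OF D]] by (simp add: m_assoc[symmetric])
      then show ?thesis using p k kG by simp
    qed
    show "x \<in> H <#> C" if x: "x \<in> carrier G" "project \<nu> f x \<noteq> 0" for x
    proof -
      have "\<exists>D\<in>cosets. f (coset_rep D \<otimes> x) \<noteq> 0"
      proof (rule ccontr)
        assume "\<not> (\<exists>D\<in>cosets. f (coset_rep D \<otimes> x) \<noteq> 0)"
        then have "?t x (coset_rep D) = 0" if "D \<in> cosets" for D
          using that rep_hom_zero[OF \<theta>'(1)] smooth_rep_act_zero[OF \<sigma>]
            subgroup.m_inv_closed[OF H coset_rep_H[OF that]] by simp
        then have "(\<Sum>D\<in>cosets. ?t x (coset_rep D)) = 0" by (intro sum.neutral) blast
        then show False using x p[OF x(1)] by simp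
      qed
      then obtain D where D: "D \<in> cosets" "f (coset_rep D \<otimes> x) \<noteq> 0" by blast
      note r = H_carrier[OF coset_rep_H[OF D(1)]]
      have "coset_rep D \<otimes> x \<in> J <#> C" using C(3) D(2) r x(1) by blast
      then obtain j c where jc: "j \<in> J" "c \<in> C" "coset_rep D \<otimes> x = j \<otimes> c" by (auto simp: set_mult_def)
      have "x = inv (coset_rep D) \<otimes> (coset_rep D \<otimes> x)" using r x(1) by (simp add: m_assoc[symmetric])
      also have "\<dots> = (inv (coset_rep D) \<otimes> j) \<otimes> c"
        using r jc C(1) subgroup.mem_carrier[OF subgroup_J] by (auto simp: m_assoc)
      finally have "x = (inv (coset_rep D) \<otimes> j) \<otimes> c" .
      moreover have "inv (coset_rep D) \<otimes> j \<in> H"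
        using jc(1) J_subset_H subgroup.m_closed[OF H] subgroup.m_inv_closed[OF H coset_rep_H[OF D(1)]] by blast
      ultimately show ?thesis using jc(2) unfolding set_mult_def by blast
    qed
    show "project \<nu> f (k \<otimes> x) = act (twist \<sigma> \<nu>) k (project \<nu> f x)"
      if k: "k \<in> H" and x: "x \<in> carrier G" for k x
    proof -
      note kG = H_carrier[OF k]
      \<comment> \<open>Translating the argument by \<open>k\<close> amounts to translating the representatives by \<open>k\<close>, which permutes
      the cosets.\<close>
      have shift: "?t (k \<otimes> x) h = act (twist \<sigma> \<nu>) k (?t x (h \<otimes> k))" if h: "h \<in> H" for h
      proof -
        note hG = H_carrier[OF h]
        have hk: "h \<otimes> k \<in> H" by (rule subgroup.m_closed[OF H h k])
        have ihk: "inv (h \<otimes> k) \<in> H" by (rule subgroup.m_inv_closed[OF H hk])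
        have w: "\<theta>' (f (h \<otimes> k \<otimes> x)) \<in> rep_space \<sigma>"
          using hG kG x by (intro rep_hom_in[OF \<theta>'(1)] ind_space_in[OF f]) auto
        have "k \<otimes> inv (h \<otimes> k) = inv h"
          using hG kG by (simp add: inv_mult_group m_assoc[symmetric])
        then have "act \<sigma> k (act \<sigma> (inv (h \<otimes> k)) (\<theta>' (f (h \<otimes> k \<otimes> x)))) =
            act \<sigma> (inv h) (\<theta>' (f (h \<otimes> k \<otimes> x)))"
          using smooth_rep_mult[OF \<sigma> k ihk w] by simp
        moreover have "\<nu> k * inverse (\<nu> (h \<otimes> k)) = inverse (\<nu> h)"
          using chars_nonzero[OF \<nu> k] chars_nonzero[OF \<nu> h]
          by (simp add: chars_mult[OF \<nu> h k] field_simps)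
        ultimately show ?thesis
          using hG kG x smooth_rep_scale[OF \<sigma> k t_in[OF hk x]] by (simp add: m_assoc)
      qed
      have lin: "act (twist \<sigma> \<nu>) k (\<Sum>D\<in>E. ?t x (h D)) = (\<Sum>D\<in>E. act (twist \<sigma> \<nu>) k (?t x (h D)))"
        if "\<And>D. D \<in> E \<Longrightarrow> h D \<in> H" for h and E :: "'g set set"
        using that
      proof (induction E rule: infinite_finite_induct)
        case (insert D E)
        have "?t x (h D) \<in> rep_space \<sigma>" by (intro cvec.subspace_scale[OF V] t_in x) (simp add: insert)
        moreover have "(\<Sum>D\<in>E. ?t x (h D)) \<in> rep_space \<sigma>"
          by (intro cvec.subspace_sum[OF V] cvec.subspace_scale[OF V] t_in x) (simp add: insert)
        ultimately show ?case
          using insert by (simp add: smooth_rep_add[OF \<sigma> k] cvec.scale_right_distrib)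
      qed (simp_all add: smooth_rep_act_zero[OF \<sigma> k])
      have "project \<nu> f (k \<otimes> x) = ?n *\<^sub>C (\<Sum>D\<in>cosets. act (twist \<sigma> \<nu>) k (?t x (coset_rep D \<otimes> k)))"
        using p[of "k \<otimes> x"] kG x by (simp add: shift coset_rep_H del: act_twist)
      also have "(\<Sum>D\<in>cosets. act (twist \<sigma> \<nu>) k (?t x (coset_rep D \<otimes> k))) =
          act (twist \<sigma> \<nu>) k (\<Sum>D\<in>cosets. ?t x (coset_rep D \<otimes> k))"
        by (rule lin[of cosets "\<lambda>D. coset_rep D \<otimes> k", symmetric]) (rule subgroup.m_closed[OF H coset_rep_H k])
      also have "(\<Sum>D\<in>cosets. ?t x (coset_rep D \<otimes> k)) = (\<Sum>D\<in>cosets. ?t x (coset_rep D))"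
        by (rule coset_sum_translate_H[OF averaged_term_left_invariant[OF \<nu> f x] k])
      also have "?n *\<^sub>C act (twist \<sigma> \<nu>) k (\<Sum>D\<in>cosets. ?t x (coset_rep D)) = act (twist \<sigma> \<nu>) k (project \<nu> f x)"
        using p[OF x] smooth_rep_scale[OF \<sigma> k sum_in[OF x]] by (simp add: mult.commute)
      finally show ?thesis .
    qed
  qed
qed

lemma project_rep_hom:
  assumes \<nu>: "\<nu> \<in> chars G H J"
  shows "project \<nu> \<in> rep_hom (carrier G) (c_ind G J \<rho>) (c_ind G H (twist \<sigma> \<nu>))"
proof (rule rep_homI, unfold rep_space_c_ind)
  let ?V = "ind_space G J \<rho>"
  note V = subspace_ind_space[OF subgroup_J \<rho>]
  fix f assume f: "f \<in> ?V"
  then show "project \<nu> f \<in> ind_space G H (twist \<sigma> \<nu>)" by (rule project_in[OF \<nu>])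
  have val: "f (coset_rep D \<otimes> x) \<in> rep_space \<rho>" if "f \<in> ?V" "D \<in> cosets" "x \<in> carrier G" for f D x
    using that H_carrier[OF coset_rep_H] by (intro ind_space_in) auto
  note irp = subgroup.m_inv_closed[OF H coset_rep_H]
  show "project \<nu> (c *\<^sub>C f) = c *\<^sub>C project \<nu> f" for c
    using f cvec.subspace_scale[OF V f]
    by (auto simp: project_def fun_eq_iff scaleC_fun_def rep_hom_scale[OF \<theta>'(1)] val[OF f]
        smooth_rep_scale[OF \<sigma> irp] rep_hom_in[OF \<theta>'(1)] cvec.scale_sum_right mult_ac
        intro!: sum.cong)
  show "project \<nu> (act (c_ind G J \<rho>) g f) = act (c_ind G H (twist \<sigma> \<nu>)) g (project \<nu> f)"
    if "g \<in> carrier G" for g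
    using f that act_c_ind_in[OF subgroup_J f that] H_carrier[OF coset_rep_H]
    by (auto simp: project_def fun_eq_iff m_assoc intro!: sum.cong)
  fix f' assume f': "f' \<in> ?V"
  show "project \<nu> (f' + f) = project \<nu> f' + project \<nu> f"
    using f f' cvec.subspace_add[OF V f' f]
    by (auto simp: project_def fun_eq_iff rep_hom_add[OF \<theta>'(1)] val
        smooth_rep_add[OF \<sigma> irp] rep_hom_in[OF \<theta>'(1)] cvec.scale_right_distrib sum.distrib)
qed (simp add: project_def fun_eq_iff)

lemma card_cosets: "card cosets > 0"
proof -
  have "J \<in> cosets" by (rule Q.subgroup_in_rcosets[OF Q.is_group])
  then show ?thesis using finite_quotient card_gt_0_iff by blast
qed

lemma project_embed:
  assumes \<nu>: "\<nu> \<in> chars G H J" and f: "f \<in> ind_space G H (twist \<sigma> \<nu>)"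
  shows "project \<nu> (embed \<nu> f) = f"
proof
  fix x
  show "project \<nu> (embed \<nu> f) x = f x"
  proof (cases "x \<in> carrier G")
    case False
    then show ?thesis using ind_space_outside[OF f] by (simp add: project_def)
  next
    case x: True
    have fx: "f x \<in> rep_space \<sigma>" using ind_space_in[OF f x] by simp
    have trm: "inverse (\<nu> h) *\<^sub>C act \<sigma> (inv h) (\<theta>' (\<theta> (f (h \<otimes> x)))) = f x" if h: "h \<in> H" for h
    proof -
      note hG = H_carrier[OF h] and ih = subgroup.m_inv_closed[OF H h]
      have a: "act \<sigma> h (f x) \<in> rep_space \<sigma>" by (rule smooth_rep_in[OF \<sigma> h fx])
      have "f (h \<otimes> x) = \<nu> h *\<^sub>C act \<sigma> h (f x)" using ind_space_left[OF f h x] by simp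
      then have "\<theta>' (\<theta> (f (h \<otimes> x))) = \<nu> h *\<^sub>C act \<sigma> h (f x)"
        using \<theta>'(2) cvec.subspace_scale[OF smooth_rep_subspace[OF \<sigma>] a] by simp
      then have "act \<sigma> (inv h) (\<theta>' (\<theta> (f (h \<otimes> x)))) = \<nu> h *\<^sub>C act \<sigma> (inv h \<otimes> h) (f x)"
        using smooth_rep_scale[OF \<sigma> ih a] smooth_rep_mult[OF \<sigma> ih h fx] by simp
      then show ?thesis
        using smooth_rep_one[OF \<sigma> fx] hG chars_nonzero[OF \<nu> h] by simp
    qed
    have "project \<nu> (embed \<nu> f) x = (1 / of_nat (card cosets)) *\<^sub>C (\<Sum>D\<in>cosets. f x)"
      using f x embed_in[OF \<nu> f] trm[OF coset_rep_H] by (simp add: project_def embed_def)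
    also have "(\<Sum>D\<in>cosets. f x) = of_nat (card cosets) *\<^sub>C f x"
      by (simp add: cvec.sum_constant_scale)
    finally show ?thesis using card_cosets by simp
  qed
qed

text \<open>By orthogonality of characters only the summand of the trivial coset \<open>J\<close> survives, and it is
  \<open>f x\<close>.\<close>

lemma sum_embed_project:
  assumes f: "f \<in> ind_space G J \<rho>"
  shows "(\<Sum>\<nu>\<in>chars G H J. embed \<nu> (project \<nu> f)) = f"
proof
  fix x
  have chars: "chars (G\<lparr>carrier := H\<rparr>) H J = chars G H J" by (simp add: chars_def)
  have orth: "(\<Sum>\<nu>\<in>chars G H J. \<nu> h) = (if h \<in> J then of_nat (card cosets) else 0)" if "h \<in> H" for h
    using Q.sum_of_characters[OF finite_quotient, of h] that by (simp add: chars)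
  show "(\<Sum>\<nu>\<in>chars G H J. embed \<nu> (project \<nu> f)) x = f x"
  proof (cases "x \<in> carrier G")
    case False
    have "embed \<nu> (project \<nu> f) x = 0" if "\<nu> \<in> chars G H J" for \<nu>
      using False project_in[OF that f] rep_hom_zero[OF \<theta>(1)]
      by (simp add: embed_def project_def)
    then show ?thesis using ind_space_outside[OF f False] by (simp add: sum_fun_apply)
  next
    case x: True
    note V = smooth_rep_subspace[OF \<sigma>]
    let ?n = "1 / of_nat (card cosets) :: complex"
    define u where "u D = act \<sigma> (inv (coset_rep D)) (\<theta>' (f (coset_rep D \<otimes> x)))" for D
    have u_in: "u D \<in> rep_space \<sigma>" if D: "D \<in> cosets" for D
      unfolding u_def using x H_carrier[OF coset_rep_H[OF D]] subgroup.m_inv_closed[OF H coset_rep_H[OF D]]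
      by (intro smooth_rep_in[OF \<sigma>] rep_hom_in[OF \<theta>'(1)] ind_space_in[OF f]) auto
    have inverse_char: "(\<Sum>\<nu>\<in>chars G H J. inverse (\<nu> h)) = (if h \<in> J then of_nat (card cosets) else 0)"
      if h: "h \<in> H" for h
    proof -
      have "inverse (\<nu> h) = \<nu> (inv h)" if \<nu>: "\<nu> \<in> chars G H J" for \<nu>
      proof -
        have "\<nu> (inv h) * \<nu> h = \<nu> \<one>"
          using chars_mult[OF \<nu> subgroup.m_inv_closed[OF H h] h] H_carrier[OF h] by simp
        then show ?thesis
          using chars_trivial[OF \<nu> subgroup.one_closed[OF subgroup_J]] chars_nonzero[OF \<nu> h]
          by (simp add: field_simps)
      qed
      moreover have "inv h \<in> J \<longleftrightarrow> h \<in> J"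
        using subgroup.m_inv_closed[OF subgroup_J] H_carrier[OF h] by (metis inv_inv)
      ultimately show ?thesis using orth[OF subgroup.m_inv_closed[OF H h]] by simp
    qed
    have in_J: "coset_rep D \<in> J \<longleftrightarrow> D = J" if D: "D \<in> cosets" for D
    proof
      assume "coset_rep D \<in> J"
      then have "D \<inter> J \<noteq> {}" using Q.coset_rep_in[OF D] by blast
      then show "D = J"
        using Q.rcos_disjoint[OF Q.is_subgroup] D Q.subgroup_in_rcosets[OF Q.is_group]
        by (auto simp: pairwise_def disjnt_def)
    qed (use Q.coset_rep_in[OF D] in simp)
    have J: "J \<in> cosets" by (rule Q.subgroup_in_rcosets[OF Q.is_group])
    then have rpJ: "coset_rep J \<in> J" using in_J by simp
    have "(\<Sum>\<nu>\<in>chars G H J. embed \<nu> (project \<nu> f)) x =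
        (\<Sum>\<nu>\<in>chars G H J. \<theta> (?n *\<^sub>C (\<Sum>D\<in>cosets. inverse (\<nu> (coset_rep D)) *\<^sub>C u D)))"
      unfolding sum_fun_apply
      by (rule sum.cong) (use project_in[OF _ f] f x in \<open>simp_all add: embed_def project_def u_def\<close>)
    also have "\<dots> = \<theta> (\<Sum>\<nu>\<in>chars G H J. ?n *\<^sub>C (\<Sum>D\<in>cosets. inverse (\<nu> (coset_rep D)) *\<^sub>C u D))"
      by (rule rep_hom_sum[OF \<theta>(1) V, symmetric])
        (intro cvec.subspace_scale[OF V] cvec.subspace_sum[OF V] u_in)
    also have "(\<Sum>\<nu>\<in>chars G H J. ?n *\<^sub>C (\<Sum>D\<in>cosets. inverse (\<nu> (coset_rep D)) *\<^sub>C u D)) =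
        ?n *\<^sub>C (\<Sum>D\<in>cosets. (\<Sum>\<nu>\<in>chars G H J. inverse (\<nu> (coset_rep D))) *\<^sub>C u D)"
      by (simp add: cvec.scale_sum_left cvec.scale_sum_right[symmetric] sum.swap[of _ cosets])
    also have "(\<Sum>D\<in>cosets. (\<Sum>\<nu>\<in>chars G H J. inverse (\<nu> (coset_rep D))) *\<^sub>C u D) =
        (\<Sum>D\<in>cosets. if D = J then of_nat (card cosets) *\<^sub>C u J else 0)"
      by (rule sum.cong) (simp_all add: inverse_char coset_rep_H in_J)
    also have "\<dots> = of_nat (card cosets) *\<^sub>C u J" using J finite_quotient by simp
    also have "?n *\<^sub>C \<dots> = u J" using card_cosets by simp
    also have "u J = \<theta>' (f x)"
    proof -
      have rG: "coset_rep J \<in> carrier G" and rH: "coset_rep J \<in> H" and ir: "inv (coset_rep J) \<in> H"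
        using rpJ subgroup.mem_carrier[OF subgroup_J] coset_rep_H[OF J] subgroup.m_inv_closed[OF H] by auto
      have fx: "f x \<in> rep_space \<rho>" by (rule ind_space_in[OF f x])
      have "u J = act \<sigma> (inv (coset_rep J)) (act \<sigma> (coset_rep J) (\<theta>' (f x)))"
        using ind_space_left[OF f rpJ x] rep_hom_act[OF \<theta>'(1) rpJ fx] by (simp add: u_def)
      also have "\<dots> = \<theta>' (f x)"
        using smooth_rep_mult[OF \<sigma> ir rH rep_hom_in[OF \<theta>'(1) fx]] rG
          smooth_rep_one[OF \<sigma> rep_hom_in[OF \<theta>'(1) fx]] by simp
      finally show ?thesis .
    qed
    also have "\<theta> (\<theta>' (f x)) = f x" by (rule \<theta>'(3)[OF ind_space_in[OF f x]])
    finally show ?thesis .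
  qed
qed

theorem hecke_algebra_decomposition:
  assumes "\<And>\<nu> \<mu> \<Phi> f. \<nu> \<in> chars G H J \<Longrightarrow> \<mu> \<in> chars G H J \<Longrightarrow> \<nu> \<noteq> \<mu> \<Longrightarrow>
      \<Phi> \<in> rep_hom (carrier G) (c_ind G H (twist \<sigma> \<nu>)) (c_ind G H (twist \<sigma> \<mu>)) \<Longrightarrow> \<Phi> f = 0"
  shows "algebra_iso (hecke_algebra G J \<rho>)
    (direct_sum_algebra (chars G H J) (\<lambda>\<nu>. hecke_algebra G H (twist \<sigma> \<nu>)))"
  unfolding hecke_algebra_endo
proof (rule endo_algebra_direct_sum[where e = embed and p = project])
  have "chars (G\<lparr>carrier := H\<rparr>) H J = chars G H J" by (simp add: chars_def)
  then show "finite (chars G H J)" using Q.finite_chars[OF finite_quotient] by simp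
qed (simp_all add: assms linear_rep_c_ind[OF subgroup_J \<rho>] linear_rep_c_ind[OF H smooth_twist]
    embed_rep_hom project_rep_hom project_embed sum_embed_project zero_fun_def)

end

section \<open>Twists of a representation that is irreducible on a normal subgroup\<close>

text \<open>On \<open>J\<close> both twists are trivial, so \<open>\<phi>\<close> is a nonzero scalar by Schur's lemma; comparing its equivariance
  under \<open>h\<close> on the two sides gives the equality.\<close>

lemma (in translation_group) schur_twists:
  assumes H: "subgroup H G" and \<sigma>: "smooth_rep G H \<sigma>" and JH: "J \<subseteq> H"
    and schur: "\<And>\<phi>. \<phi> \<in> rep_hom J \<sigma> \<sigma> \<Longrightarrow> \<exists>c. \<forall>v\<in>rep_space \<sigma>. \<phi> v = c *\<^sub>C v"
    and \<psi>: "\<And>j. j \<in> J \<Longrightarrow> \<psi> j = 1" "\<And>j. j \<in> J \<Longrightarrow> \<psi>' j = 1"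
    and \<phi>: "\<phi> \<in> rep_hom H (twist \<sigma> \<psi>) (twist \<sigma> \<psi>')" "\<phi> v \<noteq> 0"
    and h: "h \<in> H"
  shows "\<psi> h = \<psi>' h"
proof -
  note V = smooth_rep_subspace[OF \<sigma>]
  have v: "v \<in> rep_space \<sigma>" using \<phi>(2) rep_hom_outside[OF \<phi>(1)] by force
  have "\<phi> \<in> rep_hom J \<sigma> \<sigma>"
  proof (rule rep_homI)
    show "\<phi> (act \<sigma> j u) = act \<sigma> j (\<phi> u)" if "j \<in> J" "u \<in> rep_space \<sigma>" for j u
      using rep_hom_act[OF \<phi>(1), of j u] that JH \<psi> by auto
  qed (use rep_hom_in[OF \<phi>(1)] rep_hom_add[OF \<phi>(1)] rep_hom_scale[OF \<phi>(1)]
      rep_hom_outside[OF \<phi>(1)] in auto)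
  then obtain c where c: "\<And>u. u \<in> rep_space \<sigma> \<Longrightarrow> \<phi> u = c *\<^sub>C u" using schur by blast
  have hv: "act \<sigma> h v \<in> rep_space \<sigma>" by (rule smooth_rep_in[OF \<sigma> h v])
  have "act \<sigma> h v \<noteq> 0"
  proof
    assume "act \<sigma> h v = 0"
    then have "act \<sigma> (inv h \<otimes> h) v = 0"
      using smooth_rep_mult[OF \<sigma> _ h v, of "inv h"] subgroup.m_inv_closed[OF H h]
        smooth_rep_act_zero[OF \<sigma>] by simp
    then have "v = 0" using smooth_rep_one[OF \<sigma> v] subgroup.mem_carrier[OF H h] by simp
    then show False using \<phi>(2) rep_hom_zero[OF \<phi>(1)] by simp
  qed
  have "(c * \<psi> h) *\<^sub>C act \<sigma> h v = (c * \<psi>' h) *\<^sub>C act \<sigma> h v"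
    using rep_hom_act[OF \<phi>(1) h, of v] v hv smooth_rep_scale[OF \<sigma> h v]
      cvec.subspace_scale[OF V] c by (simp add: mult.commute)
  then have "c * \<psi> h = c * \<psi>' h"
    using \<open>act \<sigma> h v \<noteq> 0\<close> cvec.scale_cancel_right by blast
  moreover have "c \<noteq> 0" using c[OF v] \<phi>(2) by auto
  ultimately show ?thesis by simp
qed

text \<open>A representation \<open>\<rho>t\<close> of \<open>Jt\<close> that restricts irreducibly to \<open>\<rho>\<close> on \<open>J = Jt \<inter> N\<close>, the identification being
  \<open>\<beta>\<close>, such that \<open>\<rho>\<close> is intertwined by elements of \<open>Jt\<close> only.\<close>

locale intertwining_data = translation_group G for G :: "('g::topological_space) monoid" (structure) +
  fixes N J Jt :: "'g set"
    and \<rho> :: "('g, 'a::complex_vector) rep" and \<rho>t :: "('g, 'b::complex_vector) rep"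
    and \<beta> :: "'b \<Rightarrow> 'a"
  assumes N: "subgroup N G" and derived_N: "derived G (carrier G) \<subseteq> N"
    and Jt: "subgroup Jt G" and J_def: "J = Jt \<inter> N" and J: "J \<in> Omega G"
    and irr: "irrep G J \<rho>" and \<rho>t: "smooth_rep G Jt \<rho>t"
    and \<beta>: "\<beta> \<in> rep_hom J \<rho>t \<rho>" "bij_betw \<beta> (rep_space \<rho>t) (rep_space \<rho>)"
    and intertwining_subset: "intertwining G J \<rho> \<subseteq> Jt"
begin

lemma open_J: "open_subgroup G J" using J by (simp add: Omega_def)

lemma subgroup_J: "subgroup J G" by (rule open_subgroup_subgroup[OF open_J])

lemma commutator_in_J:
  assumes "g \<in> Jt" "h \<in> Jt" shows "g \<otimes> h \<otimes> inv g \<otimes> inv h \<in> J"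
proof -
  have "g \<otimes> h \<otimes> inv g \<otimes> inv h \<in> derived G (carrier G)"
    using assms subgroup.mem_carrier[OF Jt] unfolding derived_def by (blast intro: generate.incl)
  then show ?thesis
    using derived_N assms subgroup.m_closed[OF Jt] subgroup.m_inv_closed[OF Jt] by (auto simp: J_def)
qed

lemma schur_J:
  assumes \<sigma>: "smooth_rep G H \<sigma>" "J \<subseteq> H"
    and \<theta>: "\<theta> \<in> rep_hom J \<sigma> \<rho>" "bij_betw \<theta> (rep_space \<sigma>) (rep_space \<rho>)"
    and \<phi>: "\<phi> \<in> rep_hom J \<sigma> \<sigma>"
  shows "\<exists>c. \<forall>v\<in>rep_space \<sigma>. \<phi> v = c *\<^sub>C v"
proof -
  have st: "\<forall>h\<in>J. \<forall>v\<in>rep_space \<sigma>. act \<sigma> h v \<in> rep_space \<sigma>"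
    using smooth_rep_in[OF \<sigma>(1)] \<sigma>(2) by blast
  note inv = hom_inverse[OF \<theta> smooth_rep_subspace[OF \<sigma>(1)] st]
  let ?\<theta>' = "hom_inverse \<sigma> \<rho> \<theta>"
  obtain B where B: "finite B" "rep_space \<rho> \<subseteq> cvec.span B"
    by (rule smooth_irrep_finite_dimensional[OF J irr])
  have "\<theta> \<circ> (\<phi> \<circ> ?\<theta>') \<in> rep_hom J \<rho> \<rho>" by (intro rep_hom_comp[OF \<theta>(1)] rep_hom_comp[OF \<phi>] inv(3))
  then obtain c where c: "\<forall>v\<in>rep_space \<rho>. (\<theta> \<circ> (\<phi> \<circ> ?\<theta>')) v = c *\<^sub>C v"
    using schur[OF irr B] by blast
  have "\<phi> v = c *\<^sub>C v" if v: "v \<in> rep_space \<sigma>" for v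
  proof -
    have "\<theta> (\<phi> v) = c *\<^sub>C \<theta> v"
      using bspec[OF c rep_hom_in[OF \<theta>(1) v]] inv(1)[OF v] by simp
    also have "\<dots> = \<theta> (c *\<^sub>C v)" by (simp add: rep_hom_scale[OF \<theta>(1) v])
    finally show ?thesis
      using \<theta>(2) rep_hom_in[OF \<phi> v] cvec.subspace_scale[OF smooth_rep_subspace[OF \<sigma>(1)] v]
      by (auto simp: bij_betw_def inj_on_def)
  qed
  then show ?thesis by blast
qed

lemma intertwiner_in_Jt:
  assumes \<sigma>: "smooth_rep G H \<sigma>" "J \<subseteq> H"
    and \<theta>: "\<theta> \<in> rep_hom J \<sigma> \<rho>" "bij_betw \<theta> (rep_space \<sigma>) (rep_space \<rho>)"
    and g: "g \<in> carrier G"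
    and \<phi>: "\<phi> \<in> rep_hom (J \<inter> conj_subgroup G g J) \<sigma> (conj_rep G g \<sigma>)" "\<phi> v \<noteq> 0"
  shows "g \<in> Jt"
proof -
  have st: "\<forall>h\<in>J. \<forall>v\<in>rep_space \<sigma>. act \<sigma> h v \<in> rep_space \<sigma>"
    using smooth_rep_in[OF \<sigma>(1)] \<sigma>(2) by blast
  note inv = hom_inverse[OF \<theta> smooth_rep_subspace[OF \<sigma>(1)] st]
  let ?\<theta>' = "hom_inverse \<sigma> \<rho> \<theta>" and ?L = "J \<inter> conj_subgroup G g J"
  have conj: "inv g \<otimes> x \<otimes> g \<in> J" if "x \<in> conj_subgroup G g J" for x
    using that g subgroup.mem_carrier[OF subgroup_J]
    by (auto simp: conj_subgroup_def m_assoc) (simp add: m_assoc[symmetric])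
  have "\<theta> \<in> rep_hom ?L (conj_rep G g \<sigma>) (conj_rep G g \<rho>)"
    by (rule rep_homI) (use rep_homD[OF \<theta>(1)] conj in auto)
  moreover have "?\<theta>' \<in> rep_hom ?L \<rho> \<sigma>" by (rule rep_hom_mono[OF _ inv(3)]) auto
  ultimately have "\<theta> \<circ> (\<phi> \<circ> ?\<theta>') \<in> rep_hom ?L \<rho> (conj_rep G g \<rho>)"
    by (intro rep_hom_comp[OF _ rep_hom_comp[OF \<phi>(1)]])
  moreover have "\<theta> \<circ> (\<phi> \<circ> ?\<theta>') \<noteq> 0"
  proof
    assume "\<theta> \<circ> (\<phi> \<circ> ?\<theta>') = 0"
    then have z: "\<theta> (\<phi> (?\<theta>' (\<theta> v))) = 0" by (metis comp_apply zero_fun_apply)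
    have v: "v \<in> rep_space \<sigma>" using \<phi> rep_hom_outside by blast
    have "\<phi> v \<in> rep_space \<sigma>" using rep_hom_in[OF \<phi>(1) v] by simp
    moreover have "\<theta> (\<phi> v) = \<theta> 0" using z inv(1)[OF v] rep_hom_zero[OF \<theta>(1)] by simp
    ultimately show False
      using \<theta>(2) \<phi>(2) cvec.subspace_0[OF smooth_rep_subspace[OF \<sigma>(1)]]
      by (auto simp: bij_betw_def inj_on_def)
  qed
  ultimately have "g \<in> intertwining G J \<rho>" using g by (auto simp: intertwining_def)
  then show ?thesis using intertwining_subset by blast
qed

text \<open>Restricted to \<open>J \<inter> gJg\<inverse>\<close>, the map \<open>\<phi>\<close> intertwines \<open>\<rho>\<close>, so \<open>g\<close> lies in \<open>Jt\<close>. Then \<open>g\<close> normalises \<open>H\<close> and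
  preserves \<open>\<psi>'\<close>, as commutators of elements of \<open>Jt\<close> lie in \<open>J\<close>; hence \<open>\<rho>t(g)\<close> carries the conjugate of
  \<open>\<sigma> \<otimes> \<psi>'\<close> back to \<open>\<sigma> \<otimes> \<psi>'\<close>, and Schur's lemma for twists applies to the composite \<open>T\<close>.\<close>

lemma intertwined_twists_agree:
  assumes H: "subgroup H G" and JH: "J \<subseteq> H" "H \<subseteq> Jt" and \<sigma>: "smooth_rep G H \<sigma>"
    and \<alpha>: "\<alpha> \<in> rep_hom H \<sigma> \<rho>t" "bij_betw \<alpha> (rep_space \<sigma>) (rep_space \<rho>t)"
    and \<psi>: "\<And>j. j \<in> J \<Longrightarrow> \<psi> j = 1" "\<And>j. j \<in> J \<Longrightarrow> \<psi>' j = 1"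
    and mult: "\<And>h k. h \<in> H \<Longrightarrow> k \<in> H \<Longrightarrow> \<psi>' (h \<otimes> k) = \<psi>' h * \<psi>' k"
    and g: "g \<in> carrier G"
    and \<phi>: "\<phi> \<in> rep_hom (H \<inter> conj_subgroup G g H) (twist \<sigma> \<psi>) (conj_rep G g (twist \<sigma> \<psi>'))"
    and nz: "\<phi> v \<noteq> 0" and h: "h \<in> H"
  shows "\<psi> h = \<psi>' h"
proof -
  note Hc = subgroup.mem_carrier[OF H]
  define \<theta> where "\<theta> = \<beta> \<circ> \<alpha>"
  have \<theta>: "\<theta> \<in> rep_hom J \<sigma> \<rho>" "bij_betw \<theta> (rep_space \<sigma>) (rep_space \<rho>)"
    unfolding \<theta>_def using rep_hom_comp[OF \<beta>(1) rep_hom_mono[OF JH(1) \<alpha>(1)]]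
      bij_betw_trans[OF \<alpha>(2) \<beta>(2)] by auto
  have \<phi>J: "\<phi> \<in> rep_hom (J \<inter> conj_subgroup G g J) \<sigma> (conj_rep G g \<sigma>)"
  proof (rule rep_homI)
    fix u x assume x: "x \<in> J \<inter> conj_subgroup G g J" and u: "u \<in> rep_space \<sigma>"
    then have "x \<in> H \<inter> conj_subgroup G g H" using JH(1) by (auto simp: conj_subgroup_def)
    moreover have "inv g \<otimes> x \<otimes> g \<in> J"
      using x g subgroup.mem_carrier[OF subgroup_J]
      by (auto simp: conj_subgroup_def m_assoc) (simp add: m_assoc[symmetric])
    ultimately show "\<phi> (act \<sigma> x u) = act (conj_rep G g \<sigma>) x (\<phi> u)"
      using rep_hom_act[OF \<phi>, of x u] x u \<psi> by simp
  qed (use rep_hom_in[OF \<phi>] rep_hom_add[OF \<phi>] rep_hom_scale[OF \<phi>] rep_hom_outside[OF \<phi>] in auto)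
  have gJt: "g \<in> Jt" by (rule intertwiner_in_Jt[OF \<sigma> JH(1) \<theta> g \<phi>J nz])
  then have igJt: "inv g \<in> Jt" by (rule subgroup.m_inv_closed[OF Jt])
  have conj_in: "inv g \<otimes> x \<otimes> g \<in> H \<and> \<psi>' (inv g \<otimes> x \<otimes> g) = \<psi>' x" if x: "x \<in> H" for x
  proof -
    have c: "inv g \<otimes> x \<otimes> g \<otimes> inv x \<in> J"
      using commutator_in_J[OF igJt, of x] x JH(2) g by auto
    have e: "inv g \<otimes> x \<otimes> g = (inv g \<otimes> x \<otimes> g \<otimes> inv x) \<otimes> x"
      using g Hc[OF x] by (simp add: m_assoc)
    have cH: "inv g \<otimes> x \<otimes> g \<otimes> inv x \<in> H" using c JH(1) by blast
    show ?thesis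
      using mult[OF cH x] \<psi>(2)[OF c] subgroup.m_closed[OF H cH x] e by simp
  qed
  have conj_H: "x \<in> conj_subgroup G g H" if x: "x \<in> H" for x
  proof -
    have "x = g \<otimes> (inv g \<otimes> x \<otimes> g) \<otimes> inv g" using g Hc[OF x]
      by (simp add: m_assoc cancel_left_inv)
    then show ?thesis using conj_in[OF x] unfolding conj_subgroup_def by blast
  qed
  have st: "\<forall>h\<in>H. \<forall>v\<in>rep_space \<sigma>. act \<sigma> h v \<in> rep_space \<sigma>"
    using smooth_rep_in[OF \<sigma>] by blast
  note inv = hom_inverse[OF \<alpha> smooth_rep_subspace[OF \<sigma>] st]
  let ?\<alpha>' = "hom_inverse \<sigma> \<rho>t \<alpha>"
  define T where "T u = ?\<alpha>' (act \<rho>t g (\<alpha> (\<phi> u)))" for u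
  have \<phi>_in: "\<phi> u \<in> rep_space \<sigma>" if "u \<in> rep_space \<sigma>" for u
    using rep_hom_in[OF \<phi>] that by simp
  have g\<alpha>: "act \<rho>t g (\<alpha> u) \<in> rep_space \<rho>t" if "u \<in> rep_space \<sigma>" for u
    by (rule smooth_rep_in[OF \<rho>t gJt rep_hom_in[OF \<alpha>(1) that]])
  have T: "T \<in> rep_hom H (twist \<sigma> \<psi>) (twist \<sigma> \<psi>')"
  proof (rule rep_homI)
    fix u assume "u \<in> rep_space (twist \<sigma> \<psi>)"
    then have u: "u \<in> rep_space \<sigma>" by simp
    show "T u \<in> rep_space (twist \<sigma> \<psi>')"
      unfolding T_def using rep_hom_in[OF inv(3) g\<alpha>[OF \<phi>_in[OF u]]] by simp
    show "T (c *\<^sub>C u) = c *\<^sub>C T u" for c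
      using u unfolding T_def
      by (simp add: rep_hom_scale[OF \<phi>] rep_hom_scale[OF \<alpha>(1)] \<phi>_in
          smooth_rep_scale[OF \<rho>t gJt] rep_hom_in[OF \<alpha>(1)] rep_hom_scale[OF inv(3)] g\<alpha>)
    fix u' assume "u' \<in> rep_space (twist \<sigma> \<psi>)"
    then show "T (u' + u) = T u' + T u"
      using u unfolding T_def
      by (simp add: rep_hom_add[OF \<phi>] rep_hom_add[OF \<alpha>(1)] \<phi>_in
          smooth_rep_add[OF \<rho>t gJt] rep_hom_in[OF \<alpha>(1)] rep_hom_add[OF inv(3)] g\<alpha>)
  next
    fix x u assume x: "x \<in> H" and "u \<in> rep_space (twist \<sigma> \<psi>)"
    then have u: "u \<in> rep_space \<sigma>" by simp
    let ?k = "inv g \<otimes> x \<otimes> g"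
    have k: "?k \<in> H" "\<psi>' ?k = \<psi>' x" using conj_in[OF x] by auto
    have xJt: "x \<in> Jt" "?k \<in> Jt" using x k(1) JH(2) by auto
    have "\<phi> (act (twist \<sigma> \<psi>) x u) = \<psi>' x *\<^sub>C act \<sigma> ?k (\<phi> u)"
      using rep_hom_act[OF \<phi>, of x u] x u conj_H[OF x] k(2) by simp
    then have "T (act (twist \<sigma> \<psi>) x u) = ?\<alpha>' (act \<rho>t g (\<alpha> (\<psi>' x *\<^sub>C act \<sigma> ?k (\<phi> u))))"
      by (simp add: T_def)
    also have "\<dots> = \<psi>' x *\<^sub>C ?\<alpha>' (act \<rho>t g (act \<rho>t ?k (\<alpha> (\<phi> u))))"
    proof -
      have 1: "act \<sigma> ?k (\<phi> u) \<in> rep_space \<sigma>" by (rule smooth_rep_in[OF \<sigma> k(1) \<phi>_in[OF u]])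
      have 2: "act \<rho>t ?k (\<alpha> (\<phi> u)) \<in> rep_space \<rho>t"
        by (rule smooth_rep_in[OF \<rho>t xJt(2) rep_hom_in[OF \<alpha>(1) \<phi>_in[OF u]]])
      show ?thesis
        by (simp add: rep_hom_scale[OF \<alpha>(1) 1] rep_hom_act[OF \<alpha>(1) k(1) \<phi>_in[OF u]]
            smooth_rep_scale[OF \<rho>t gJt 2] rep_hom_scale[OF inv(3) smooth_rep_in[OF \<rho>t gJt 2]])
    qed
    also have "act \<rho>t g (act \<rho>t ?k (\<alpha> (\<phi> u))) = act \<rho>t (g \<otimes> ?k) (\<alpha> (\<phi> u))"
      by (rule smooth_rep_mult[OF \<rho>t gJt xJt(2) rep_hom_in[OF \<alpha>(1) \<phi>_in[OF u]], symmetric])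
    also have "g \<otimes> ?k = x \<otimes> g" using g Hc[OF x] by (simp add: m_assoc cancel_left_inv)
    also have "act \<rho>t (x \<otimes> g) (\<alpha> (\<phi> u)) = act \<rho>t x (act \<rho>t g (\<alpha> (\<phi> u)))"
      by (rule smooth_rep_mult[OF \<rho>t xJt(1) gJt rep_hom_in[OF \<alpha>(1) \<phi>_in[OF u]]])
    also have "?\<alpha>' \<dots> = act \<sigma> x (T u)"
      unfolding T_def by (rule rep_hom_act[OF inv(3) x g\<alpha>[OF \<phi>_in[OF u]]])
    finally show "T (act (twist \<sigma> \<psi>) x u) = act (twist \<sigma> \<psi>') x (T u)" by simp
  next
    fix u assume "u \<notin> rep_space (twist \<sigma> \<psi>)"
    then have "\<phi> u = 0" by (rule rep_hom_outside[OF \<phi>])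
    then show "T u = 0"
      by (simp add: T_def rep_hom_zero[OF \<alpha>(1)] smooth_rep_act_zero[OF \<rho>t gJt] rep_hom_zero[OF inv(3)])
  qed
  have Tv: "T v \<noteq> 0"
  proof
    assume T0: "T v = 0"
    have v: "v \<in> rep_space \<sigma>" using nz rep_hom_outside[OF \<phi>] by force
    have "act \<rho>t g (\<alpha> (\<phi> v)) = \<alpha> (T v)"
      unfolding T_def using inv(2)[OF g\<alpha>[OF \<phi>_in[OF v]]] by simp
    then have "act \<rho>t g (\<alpha> (\<phi> v)) = 0" using T0 rep_hom_zero[OF \<alpha>(1)] by simp
    then have "act \<rho>t (inv g \<otimes> g) (\<alpha> (\<phi> v)) = 0"
      using smooth_rep_mult[OF \<rho>t igJt gJt rep_hom_in[OF \<alpha>(1) \<phi>_in[OF v]]]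
        smooth_rep_act_zero[OF \<rho>t igJt] by simp
    then have "\<alpha> (\<phi> v) = 0" using g smooth_rep_one[OF \<rho>t rep_hom_in[OF \<alpha>(1) \<phi>_in[OF v]]] by simp
    then have "?\<alpha>' (\<alpha> (\<phi> v)) = 0" using rep_hom_zero[OF inv(3)] by simp
    then show False using inv(1)[OF \<phi>_in[OF v]] nz by simp
  qed
  show ?thesis
  proof (rule schur_twists[OF H \<sigma> JH(1) _ _ _ T Tv h])
    show "\<exists>c. \<forall>v\<in>rep_space \<sigma>. \<phi> v = c *\<^sub>C v" if "\<phi> \<in> rep_hom J \<sigma> \<sigma>" for \<phi>
      by (rule schur_J[OF \<sigma> JH(1) \<theta> that])
  qed (simp_all add: \<psi>)
qed

text \<open>For \<open>\<omega> = 1\<close> this is the disjointness of the representations induced from different twists; for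
  \<open>\<psi> = \<psi>' = 1\<close> it shows that a character \<open>\<omega>\<close> of \<open>G\<close> that is trivial on \<open>J\<close> and fixes the representation
  induced from \<open>\<sigma>\<close> is trivial on \<open>H\<close>.\<close>

lemma induced_twists_agree:
  assumes H: "subgroup H G" and JH: "J \<subseteq> H" "H \<subseteq> Jt" and \<sigma>: "smooth_rep G H \<sigma>"
    and \<alpha>: "\<alpha> \<in> rep_hom H \<sigma> \<rho>t" "bij_betw \<alpha> (rep_space \<sigma>) (rep_space \<rho>t)"
    and sm: "smooth_rep G H (twist \<sigma> \<psi>)"
    and \<psi>: "\<And>j. j \<in> J \<Longrightarrow> \<psi> j = 1" "\<And>j. j \<in> J \<Longrightarrow> \<psi>' j = 1" "\<And>j. j \<in> J \<Longrightarrow> \<omega> j = 1"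
    and \<omega>: "\<And>g. g \<in> carrier G \<Longrightarrow> \<omega> g \<noteq> 0"
    and mult: "\<And>h k. h \<in> H \<Longrightarrow> k \<in> H \<Longrightarrow> \<psi>' (h \<otimes> k) = \<psi>' h * \<psi>' k"
    and \<Phi>: "\<Phi> \<in> rep_hom (carrier G) (twist (c_ind G H (twist \<sigma> \<psi>)) \<omega>) (c_ind G H (twist \<sigma> \<psi>'))"
    and nz: "\<Phi> f \<noteq> 0" and h: "h \<in> H"
  shows "\<omega> h * \<psi> h = \<psi>' h"
proof -
  have oH: "open_subgroup G H" by (rule open_subgroup_superset[OF open_J H JH(1)])
  obtain g \<phi> v where g: "g \<in> carrier G"
    and \<phi>: "\<phi> \<in> rep_hom (H \<inter> conj_subgroup G g H) (twist (twist \<sigma> \<psi>) \<omega>) (conj_rep G g (twist \<sigma> \<psi>'))"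
    and v: "\<phi> v \<noteq> 0"
    by (rule intertwining_of_induced_map[OF oH sm H \<omega> \<Phi> nz])
  have "twist (twist \<sigma> \<psi>) \<omega> = twist \<sigma> (\<lambda>h. \<omega> h * \<psi> h)"
    by (simp add: twist_def fun_eq_iff)
  with \<phi> have \<phi>': "\<phi> \<in> rep_hom (H \<inter> conj_subgroup G g H) (twist \<sigma> (\<lambda>h. \<omega> h * \<psi> h))
      (conj_rep G g (twist \<sigma> \<psi>'))" by simp
  have triv: "\<omega> j * \<psi> j = 1" if "j \<in> J" for j using \<psi>(1,3) that by simp
  show ?thesis by (rule intertwined_twists_agree[OF H JH \<sigma> \<alpha> triv \<psi>(2) mult g \<phi>' v h])
qed

end


section \<open>Groups of rational points\<close>

lemma group_GL: "group (GL :: ('a::field ^ 'n ^ 'n::finite) monoid)"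
proof (rule groupI)
  fix A assume "A \<in> carrier (GL :: ('a ^ 'n ^ 'n) monoid)"
  then obtain B where "A ** B = mat 1" "B ** A = mat 1" by (auto simp: GL_def invertible_def)
  then show "\<exists>B\<in>carrier GL. B \<otimes>\<^bsub>GL\<^esub> A = \<one>\<^bsub>GL\<^esub>"
    by (intro bexI[of _ B]) (auto simp: GL_def invertible_def)
next
  show "\<one>\<^bsub>GL\<^esub> \<in> carrier (GL :: ('a ^ 'n ^ 'n) monoid)"
    by (auto simp: GL_def invertible_def intro: exI[of _ "mat 1"])
qed (auto simp: GL_def matrix_mul_assoc intro: invertible_mult)

lemma map_matrix_mult: "map_matrix to_ac (A ** B) = map_matrix to_ac A ** map_matrix to_ac B"
  by (simp add: vec_eq_iff matrix_matrix_mult_def to_ac_sum)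

lemma map_matrix_one: "map_matrix to_ac (mat 1) = mat 1"
  by (simp add: vec_eq_iff mat_def)

lemma map_matrix_GL: "A \<in> carrier GL \<Longrightarrow> map_matrix to_ac A \<in> carrier GL"
  unfolding GL_def invertible_def by simp (metis map_matrix_mult map_matrix_one)

lemma subgroup_rational_points:
  fixes \<G> :: "('f::field alg_closure ^ 'n ^ 'n::finite) set"
  assumes \<G>: "subgroup \<G> GL"
  shows "subgroup {g \<in> carrier GL. map_matrix to_ac g \<in> \<G>} GL"
proof -
  interpret F: group "GL :: ('f ^ 'n ^ 'n) monoid" by (rule group_GL)
  interpret A: group "GL :: ('f alg_closure ^ 'n ^ 'n) monoid" by (rule group_GL)
  have mult: "A \<otimes>\<^bsub>GL\<^esub> B = A ** B" and one: "\<one>\<^bsub>GL\<^esub> = mat 1"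
    for A B :: "'a::field ^ 'm ^ 'm::finite" by (simp_all add: GL_def)
  have inv: "map_matrix to_ac (inv\<^bsub>GL\<^esub> g) = inv\<^bsub>GL\<^esub> (map_matrix to_ac g)"
    if g: "g \<in> carrier GL" for g :: "'f ^ 'n ^ 'n"
  proof (rule A.inv_equality[symmetric])
    show "map_matrix to_ac (inv\<^bsub>GL\<^esub> g) \<otimes>\<^bsub>GL\<^esub> map_matrix to_ac g = \<one>\<^bsub>GL\<^esub>"
      using F.l_inv[OF g] by (simp add: mult one map_matrix_one flip: map_matrix_mult)
  qed (use g in \<open>simp_all add: map_matrix_GL\<close>)
  show ?thesis
  proof (rule F.subgroupI)
    have "mat 1 \<in> {g \<in> carrier GL. map_matrix to_ac g \<in> \<G>}"
      using subgroup.one_closed[OF \<G>] F.one_closed by (simp add: map_matrix_one one)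
    then show "{g \<in> carrier GL. map_matrix to_ac g \<in> \<G>} \<noteq> {}" by blast
  next
    fix a assume "a \<in> {g \<in> carrier GL. map_matrix to_ac g \<in> \<G>}"
    then show "inv\<^bsub>GL\<^esub> a \<in> {g \<in> carrier GL. map_matrix to_ac g \<in> \<G>}"
      using subgroup.m_inv_closed[OF \<G>] by (simp add: inv)
  next
    fix a b assume ab: "a \<in> {g \<in> carrier GL. map_matrix to_ac g \<in> \<G>}"
      "b \<in> {g \<in> carrier GL. map_matrix to_ac g \<in> \<G>}"
    then have "map_matrix to_ac (a ** b) \<in> \<G>"
      using subgroup.m_closed[OF \<G>, of "map_matrix to_ac a" "map_matrix to_ac b"]
      by (simp add: mult map_matrix_mult)
    moreover have "a \<otimes>\<^bsub>GL\<^esub> b \<in> carrier GL" using ab by (intro F.m_closed) auto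
    ultimately show "a \<otimes>\<^bsub>GL\<^esub> b \<in> {g \<in> carrier GL. map_matrix to_ac g \<in> \<G>}" by (simp add: mult)
  qed auto
qed

lemma nabs_zero: "nabs (0 :: 'f::nonarch_local_field) = 0"
  using dist_nabs[of 0 "0 :: 'f"] by simp

lemma nabs_pos: "x \<noteq> 0 \<Longrightarrow> nabs (x :: 'f::nonarch_local_field) > 0"
  using dist_nabs[of x 0] zero_less_dist_iff[of x 0] by simp

lemma nabs_nonneg: "nabs (x :: 'f::nonarch_local_field) \<ge> 0"
  by (cases "x = 0") (simp_all add: nabs_zero nabs_pos less_imp_le)

lemma continuous_on_nonarch_add:
  fixes f g :: "'x::topological_space \<Rightarrow> 'f::nonarch_local_field"
  assumes "continuous_on S f" "continuous_on S g"
  shows "continuous_on S (\<lambda>x. f x + g x)"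
  unfolding continuous_on_def
proof (intro ballI tendstoI)
  fix x and e :: real assume x: "x \<in> S" and e: "e > 0"
  have "eventually (\<lambda>y. dist (f y) (f x) < e) (at x within S)"
    "eventually (\<lambda>y. dist (g y) (g x) < e) (at x within S)"
    using assms x e by (auto simp: continuous_on_def tendsto_iff)
  then show "eventually (\<lambda>y. dist (f y + g y) (f x + g x) < e) (at x within S)"
  proof eventually_elim
    case (elim y)
    have "dist (f y + g y) (f x + g x) = nabs ((f y - f x) + (g y - g x))"
      by (simp add: dist_nabs algebra_simps)
    also have "\<dots> \<le> max (dist (f y) (f x)) (dist (g y) (g x))"
      unfolding dist_nabs by (rule nabs_ultrametric)
    finally show ?case using elim by simp
  qed
qed

lemma continuous_on_nonarch_mult_left:
  fixes f :: "'x::topological_space \<Rightarrow> 'f::nonarch_local_field"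
  assumes "continuous_on S f"
  shows "continuous_on S (\<lambda>x. c * f x)"
proof (cases "c = 0")
  case False
  show ?thesis
    unfolding continuous_on_def
  proof (intro ballI tendstoI)
    fix x and e :: real assume x: "x \<in> S" and e: "e > 0"
    have c: "nabs c > 0" by (rule nabs_pos[OF False])
    then have "eventually (\<lambda>y. dist (f y) (f x) < e / nabs c) (at x within S)"
      using assms x e by (auto simp: continuous_on_def tendsto_iff)
    then show "eventually (\<lambda>y. dist (c * f y) (c * f x) < e) (at x within S)"
    proof eventually_elim
      case (elim y)
      have "dist (c * f y) (c * f x) = nabs c * dist (f y) (f x)"
        by (simp add: dist_nabs right_diff_distrib[symmetric] nabs_mult)
      then show ?case using elim c by (simp add: field_simps)
    qed
  qed
qed simp

lemma continuous_on_nonarch_sum: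
  fixes f :: "'i \<Rightarrow> 'x::topological_space \<Rightarrow> 'f::nonarch_local_field"
  assumes "\<And>i. i \<in> I \<Longrightarrow> continuous_on S (f i)"
  shows "continuous_on S (\<lambda>x. \<Sum>i\<in>I. f i x)"
  using assms by (induction I rule: infinite_finite_induct) (simp_all add: continuous_on_nonarch_add)

lemma continuous_on_matrix_mult:
  fixes A :: "'f::nonarch_local_field ^ 'n ^ 'n::finite"
  shows "continuous_on S (\<lambda>B. A ** B)" "continuous_on S (\<lambda>B. B ** A)"
proof -
  show "continuous_on S (\<lambda>B. A ** B)"
    unfolding matrix_matrix_mult_def
    by (intro continuous_on_vec_lambda continuous_on_nonarch_sum continuous_on_nonarch_mult_left
        continuous_on_component continuous_on_id)
  have eq: "(\<lambda>B. B ** A) = (\<lambda>B. \<chi> i j. \<Sum>k\<in>UNIV. A $ k $ j * B $ i $ k)"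
    by (simp add: fun_eq_iff matrix_matrix_mult_def mult.commute)
  show "continuous_on S (\<lambda>B. B ** A)"
    unfolding eq by (intro continuous_on_vec_lambda continuous_on_nonarch_sum
        continuous_on_nonarch_mult_left continuous_on_component continuous_on_id)
qed

lemma translation_group_rational_points:
  fixes \<G> :: "('f::nonarch_local_field alg_closure ^ 'n ^ 'n::finite) set"
  assumes "subgroup \<G> GL"
  shows "translation_group (rational_points \<G>)"
proof (intro translation_group.intro translation_group_axioms.intro)
  show "group (rational_points \<G>)"
    unfolding rational_points_def
    by (rule subgroup.subgroup_is_group[OF subgroup_rational_points[OF assms] group_GL])
qed (simp_all add: rational_points_def GL_def continuous_on_matrix_mult)

text \<open>In particular, a rational character takes values in the base field on rational points, where
  \<open>to_ac\<close> can be inverted.\<close>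

lemma reg_funs_rational:
  assumes "p \<in> reg_funs (range to_ac)"
  shows "p (map_matrix to_ac g) \<in> range to_ac"
  using assms
proof (induction rule: reg_funs.induct)
  case inv_det
  have "inverse (det (map_matrix to_ac g)) = to_ac (inverse (det g))"
    by (simp add: det_def to_ac_sum to_ac_prod)
  then show ?case by blast
next
  case (add p q)
  then show ?case by (metis (no_types, lifting) imageE rangeI to_ac_add)
next
  case (mult p q)
  then show ?case by (metis (no_types, lifting) imageE rangeI to_ac_mult)
qed auto

lemma unramified_character_mult:
  fixes \<G> :: "('f::nonarch_local_field alg_closure ^ 'n ^ 'n::finite) set"
  assumes \<psi>: "\<psi> \<in> rational_characters \<G>"
    and g: "g \<in> carrier (rational_points \<G>)" and h: "h \<in> carrier (rational_points \<G>)"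
  shows "unramified_character \<psi> s (g ** h) = unramified_character \<psi> s g * unramified_character \<psi> s h"
proof -
  have mem: "map_matrix to_ac x \<in> \<G>" if "x \<in> carrier (rational_points \<G>)" for x
    using that by (simp add: rational_points_def)
  obtain p where p: "p \<in> reg_funs (range to_ac)" "\<forall>g\<in>\<G>. \<psi> g = p g"
    using \<psi> by (auto simp: rational_characters_def)
  have ex: "\<exists>a. \<psi> (map_matrix to_ac x) = to_ac a" if "x \<in> carrier (rational_points \<G>)" for x
    using reg_funs_rational[OF p(1), of x] p(2) mem[OF that] by auto
  obtain a b where ab: "\<psi> (map_matrix to_ac g) = to_ac a" "\<psi> (map_matrix to_ac h) = to_ac b"
    using ex g h by blast
  have "\<psi> (map_matrix to_ac (g ** h)) = to_ac (a * b)"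
    using \<psi> mem[OF g] mem[OF h] ab
    by (auto simp: rational_characters_def hom_def map_matrix_mult GL_def)
  then show ?thesis
    unfolding unramified_character_def ab
    by (simp add: the_inv_f_f[OF inj_to_ac] nabs_mult powr_times_real_left nabs_nonneg del: to_ac_mult)
qed

text \<open>Unramified characters are multiplicative and nonzero on rational points, so they are homomorphisms
  and the subset where all of them are \<open>1\<close> is a subgroup.\<close>

lemma subgroup_zero_subgroup:
  fixes \<G> :: "('f::nonarch_local_field alg_closure ^ 'n ^ 'n::finite) set"
  assumes \<G>: "subgroup \<G> GL"
  shows "subgroup (zero_subgroup \<G>) (rational_points \<G>)"
proof -
  interpret group "rational_points \<G>"
    by (rule translation_group.axioms(1)[OF translation_group_rational_points[OF \<G>]])
  let ?G = "rational_points \<G>"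
  have m: "a \<otimes>\<^bsub>?G\<^esub> b = a ** b" for a b by (simp add: rational_points_def GL_def)
  have nz: "unramified_character \<psi> s g \<noteq> 0"
    if \<psi>: "\<psi> \<in> rational_characters \<G>" and g: "g \<in> carrier ?G" for \<psi> s g
  proof -
    obtain p where p: "p \<in> reg_funs (range to_ac)" "\<forall>g\<in>\<G>. \<psi> g = p g"
      using \<psi> by (auto simp: rational_characters_def)
    have g': "map_matrix to_ac g \<in> \<G>" using g by (simp add: rational_points_def)
    then obtain a where a: "\<psi> (map_matrix to_ac g) = to_ac a"
      using reg_funs_rational[OF p(1), of g] p(2) by auto
    have "\<psi> (map_matrix to_ac g) \<noteq> 0"
      using \<psi> g' by (auto simp: rational_characters_def hom_def)
    then have "a \<noteq> 0" using a by auto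
    then show ?thesis
      using nabs_pos[of a] by (simp add: unramified_character_def a the_inv_f_f[OF inj_to_ac])
  qed
  have one: "unramified_character \<psi> s \<one>\<^bsub>?G\<^esub> = 1" if \<psi>: "\<psi> \<in> rational_characters \<G>" for \<psi> s
    using unramified_character_mult[OF \<psi> one_closed one_closed, of s] nz[OF \<psi> one_closed, of s]
      l_one[OF one_closed] by (simp add: m)
  show ?thesis
  proof (rule subgroupI)
    have "\<one>\<^bsub>?G\<^esub> \<in> zero_subgroup \<G>" using one by (simp add: zero_subgroup_def)
    then show "zero_subgroup \<G> \<noteq> {}" by blast
  next
    fix a assume a: "a \<in> zero_subgroup \<G>"
    then have aG: "a \<in> carrier ?G" by (simp add: zero_subgroup_def)
    have "unramified_character \<psi> s (inv\<^bsub>?G\<^esub> a) = 1" if \<psi>: "\<psi> \<in> rational_characters \<G>" for \<psi> s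
      using unramified_character_mult[OF \<psi> inv_closed[OF aG] aG, of s] l_inv[OF aG] one[OF \<psi>, of s] a \<psi>
      by (simp add: m zero_subgroup_def)
    then show "inv\<^bsub>?G\<^esub> a \<in> zero_subgroup \<G>" using aG by (simp add: zero_subgroup_def)
  next
    fix a b assume "a \<in> zero_subgroup \<G>" "b \<in> zero_subgroup \<G>"
    then show "a \<otimes>\<^bsub>?G\<^esub> b \<in> zero_subgroup \<G>"
      using m_closed[of a b] by (auto simp: zero_subgroup_def m unramified_character_mult)
  qed (auto simp: zero_subgroup_def)
qed


section \<open>The Hecke algebra of a cuspidal pair\<close>

lemma direct_sum_algebra_cong:
  assumes "\<And>i. i \<in> I \<Longrightarrow> A i = B i"
  shows "direct_sum_algebra I A = direct_sum_algebra I B"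
proof -
  have "{i \<in> I. f i \<noteq> \<zero>\<^bsub>A i\<^esub>} = {i \<in> I. f i \<noteq> \<zero>\<^bsub>B i\<^esub>}" for f
    using assms by auto
  then show ?thesis
    unfolding direct_sum_algebra_def using assms by (simp cong: restrict_cong PiE_cong)
qed

theorem corollary4p4:
  fixes \<G> :: "('f::nonarch_local_field alg_closure ^ 'n ^ 'n::finite) set"
    and G :: "('f ^ 'n ^ 'n) monoid"
    and Z G0 Gflat Gdagger J Jtilde J0 Jsharp Jnat :: "('f ^ 'n ^ 'n) set"
    and \<rho> :: "('f ^ 'n ^ 'n, 'a::complex_vector) rep"
    and \<rho>tilde :: "('f ^ 'n ^ 'n, 'b::complex_vector) rep"
    and \<rho>0 :: "('f ^ 'n ^ 'n, 'c::complex_vector) rep"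
    and \<rho>sharp :: "('f ^ 'n ^ 'n, 'd::complex_vector) rep"
  assumes "connected_reductive_group \<G>"
    and "G = rational_points \<G>"
    and "Z = center_points \<G>"
    and "G0 = zero_subgroup \<G>"
    and "Gflat \<lhd> G"
    and "openin (top_of_set (carrier G)) Gflat"
    and "Gflat \<subseteq> G0"
    and "finite (rcosets\<^bsub>G\<lparr>carrier := G0\<rparr>\<^esub> Gflat)"
    and "derived G (carrier G) \<subseteq> Gflat"
    and "cuspidal_pair G Z Gflat J \<rho> Jtilde \<rho>tilde"
    and "Jtilde = intertwining G J \<rho>"
    and "rep_iso J \<rho>tilde \<rho>"
    and "J0 = Jtilde \<inter> G0"
    and "irrep G J0 \<rho>0"
    and "occurs_in J0 \<rho>0 \<rho>tilde"
    and "occurs_in J \<rho> \<rho>0"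
    and "Jsharp = twist_kernel G J0 J \<rho>0"
    and "irrep G Jsharp \<rho>sharp"
    and "occurs_in Jsharp \<rho>sharp \<rho>0"
    and "rep_iso J \<rho>sharp \<rho>"
    and "Gdagger = twist_kernel G (carrier G) Gflat (c_ind G Jtilde \<rho>tilde)"
    and "Jnat = Gdagger \<inter> J0"
  shows "Jnat = J0 \<and> rep_iso Jnat \<rho>sharp \<rho>0 \<and>
    (\<forall>\<nu> \<in> chars G J0 J. \<exists>\<mu> \<in> chars G (carrier G) Gflat. restrict \<mu> J0 = \<nu>) \<and>
    (\<forall>\<nu>bar. (\<forall>\<nu> \<in> chars G J0 J. \<nu>bar \<nu> \<in> chars G (carrier G) Gflat \<and> restrict (\<nu>bar \<nu>) J0 = \<nu>) \<longrightarrow>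
       algebra_iso (hecke_algebra G J \<rho>)
         (direct_sum_algebra (chars G J0 J)
            (\<lambda>\<nu>. hecke_algebra G J0 (twist \<rho>0 (restrict (\<nu>bar \<nu>) J0)))))"
proof -
  have sub\<G>: "subgroup \<G> GL" using assms(1) by (simp add: connected_reductive_group_def)
  interpret translation_group G
    unfolding assms(2) by (rule translation_group_rational_points[OF sub\<G>])
  interpret flat: abelian_quotient Gflat G
    by (intro abelian_quotient.intro abelian_quotient_axioms.intro assms)
  have G0: "subgroup G0 G" unfolding assms(2,4) by (rule subgroup_zero_subgroup[OF sub\<G>])
  have JG: "J \<in> Omega G" "irrep G J \<rho>" "Jtilde \<in> Omega_mod G Z" "J = Jtilde \<inter> Gflat"
    "irrep G Jtilde \<rho>tilde"
    using assms(10) by (auto simp: cuspidal_pair_def JG_pair_def)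
  have oJt: "open_subgroup G Jtilde" using JG(3) by (simp add: Omega_mod_def)
  note Jt = open_subgroup_subgroup[OF oJt]
  have smt: "smooth_rep G Jtilde \<rho>tilde" using JG(5) by (simp add: irrep_def)
  have smJ: "smooth_rep G J \<rho>" using JG(2) by (simp add: irrep_def)
  obtain \<beta> where \<beta>: "\<beta> \<in> rep_hom J \<rho>tilde \<rho>" "bij_betw \<beta> (rep_space \<rho>tilde) (rep_space \<rho>)"
    using assms(12) by (auto simp: rep_iso_def)
  interpret D: intertwining_data G Gflat J Jtilde \<rho> \<rho>tilde \<beta>
    by (intro intertwining_data.intro intertwining_data_axioms.intro translation_group_axioms
        flat.is_subgroup assms(9) Jt JG(4,1,2) smt \<beta> equalityD2[OF assms(11)])
  have J0: "subgroup J0 G" unfolding assms(13) by (rule subgroups_Inter_pair[OF Jt G0])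
  have JJ0: "J \<subseteq> J0" "J0 \<subseteq> Jtilde" using JG(4) assms(7,13) by auto
  have J0flat: "J0 \<inter> Gflat = J" using JG(4) assms(7,13) by auto
  have sm0: "smooth_rep G J0 \<rho>0" using assms(14) by (simp add: irrep_def)
  have st0: "act \<rho>0 h v \<in> rep_space \<rho>0" if "h \<in> J0" "v \<in> rep_space \<rho>0" for h v
    using smooth_rep_in[OF sm0] that by blast

  obtain \<alpha> where \<alpha>: "\<alpha> \<in> rep_hom J0 \<rho>0 \<rho>tilde" "inj_on \<alpha> (rep_space \<rho>0)"
    using assms(15) by (auto simp: occurs_in_def)
  \<comment> \<open>The image of \<open>\<rho>0\<close> in \<open>\<rho>tilde\<close> is \<open>J\<close>-invariant, hence everything: \<open>\<alpha>\<close> and \<open>\<theta>\<close> are bijective.\<close>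
  define \<theta> where "\<theta> = \<beta> \<circ> \<alpha>"
  have \<theta>: "\<theta> \<in> rep_hom J \<rho>0 \<rho>"
    unfolding \<theta>_def by (rule rep_hom_comp[OF \<beta>(1) rep_hom_mono[OF JJ0(1) \<alpha>(1)]])
  have \<theta>_inj: "inj_on \<theta> (rep_space \<rho>0)"
    unfolding \<theta>_def using \<alpha>(2) \<beta>(2) rep_hom_in[OF \<alpha>(1)] by (auto simp: bij_betw_def inj_on_def)
  obtain v0 where v0: "v0 \<in> rep_space \<rho>0" "v0 \<noteq> 0"
    using assms(14) cvec.subspace_0[OF smooth_rep_subspace[OF sm0]] by (auto simp: irrep_def)
  have "\<theta> v0 \<noteq> 0"
    using inj_onD[OF \<theta>_inj _ v0(1) cvec.subspace_0[OF smooth_rep_subspace[OF sm0]]] v0(2)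
      rep_hom_zero[OF \<theta>] by auto
  then have \<theta>_onto: "\<theta> ` rep_space \<rho>0 = rep_space \<rho>"
    using rep_hom_onto_irrep[OF \<theta> _ JG(2) smooth_rep_subspace[OF sm0]] st0 JJ0(1) by blast
  then have \<theta>_bij: "bij_betw \<theta> (rep_space \<rho>0) (rep_space \<rho>)" using \<theta>_inj by (simp add: bij_betw_def)
  have \<alpha>_bij: "bij_betw \<alpha> (rep_space \<rho>0) (rep_space \<rho>tilde)"
  proof -
    have "w \<in> \<alpha> ` rep_space \<rho>0" if w: "w \<in> rep_space \<rho>tilde" for w
    proof -
      have "\<beta> w \<in> \<theta> ` rep_space \<rho>0" unfolding \<theta>_onto by (rule rep_hom_in[OF \<beta>(1) w])
      then obtain v where "v \<in> rep_space \<rho>0" "\<beta> w = \<beta> (\<alpha> v)" by (auto simp: \<theta>_def)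
      then show ?thesis
        using \<beta>(2) w rep_hom_in[OF \<alpha>(1)] by (auto simp: bij_betw_def inj_on_def)
    qed
    then show ?thesis using \<alpha>(2) rep_hom_in[OF \<alpha>(1)] by (auto simp: bij_betw_def)
  qed

  have Jsharp: "Jsharp = J0"
  proof -
    have "\<psi> x = 1" if \<psi>: "\<psi> \<in> chars G J0 J" and iso: "rep_iso J0 (twist \<rho>0 \<psi>) \<rho>0" and x: "x \<in> J0" for \<psi> x
    proof -
      obtain \<phi> where \<phi>: "\<phi> \<in> rep_hom J0 (twist \<rho>0 \<psi>) \<rho>0" "bij_betw \<phi> (rep_space \<rho>0) (rep_space \<rho>0)"
        using iso by (auto simp: rep_iso_def)
      have nz: "\<phi> v0 \<noteq> 0"
        using \<phi>(2) v0 rep_hom_zero[OF \<phi>(1)] cvec.subspace_0[OF smooth_rep_subspace[OF sm0]]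
        by (metis bij_betw_inv_into_left)
      have \<phi>': "\<phi> \<in> rep_hom J0 (twist \<rho>0 \<psi>) (twist \<rho>0 (\<lambda>_. 1))"
        using \<phi>(1) by (simp add: twist_trivial)
      show ?thesis
      proof (rule schur_twists[OF J0 sm0 JJ0(1) _ _ _ \<phi>' nz x])
        show "\<exists>c. \<forall>v\<in>rep_space \<rho>0. \<phi> v = c *\<^sub>C v" if "\<phi> \<in> rep_hom J \<rho>0 \<rho>0" for \<phi>
          by (rule D.schur_J[OF sm0 JJ0(1) \<theta> \<theta>_bij that])
      qed (simp_all add: chars_trivial[OF \<psi>])
    qed
    then show ?thesis unfolding assms(17) twist_kernel_def by blast
  qed
  have J0_dagger: "J0 \<subseteq> Gdagger"
  proof
    fix x assume x: "x \<in> J0"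
    have "\<psi> x = 1" if \<psi>: "\<psi> \<in> chars G (carrier G) Gflat"
      and iso: "rep_iso (carrier G) (twist (c_ind G Jtilde \<rho>tilde) \<psi>) (c_ind G Jtilde \<rho>tilde)" for \<psi>
    proof -
      let ?V = "ind_space G Jtilde \<rho>tilde"
      obtain \<Phi> where \<Phi>: "\<Phi> \<in> rep_hom (carrier G) (twist (c_ind G Jtilde \<rho>tilde) \<psi>) (c_ind G Jtilde \<rho>tilde)"
        "bij_betw \<Phi> ?V ?V"
        using iso by (auto simp: rep_iso_def)
      have w: "\<alpha> v0 \<in> rep_space \<rho>tilde" by (rule rep_hom_in[OF \<alpha>(1) v0(1)])
      let ?f = "elementary_fun Jtilde \<rho>tilde (\<alpha> v0)"
      have f: "?f \<in> ?V" by (rule elementary_fun_in_ind_space[OF oJt smt w])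
      have "\<alpha> v0 \<noteq> 0" using \<open>\<theta> v0 \<noteq> 0\<close> rep_hom_zero[OF \<beta>(1)] by (auto simp: \<theta>_def)
      then have "?f \<one>\<^bsub>G\<^esub> \<noteq> 0"
        using subgroup.one_closed[OF Jt] smooth_rep_one[OF smt w] by (simp add: elementary_fun_def)
      then have "?f \<noteq> 0" by auto
      then have nz: "\<Phi> ?f \<noteq> 0"
        using \<Phi>(2) f rep_hom_zero[OF \<Phi>(1)] cvec.subspace_0[OF subspace_ind_space[OF Jt smt]]
        by (metis bij_betw_inv_into_left)
      \<comment> \<open>The identity of \<open>\<rho>tilde\<close>, with the value \<open>0\<close> elsewhere that \<open>rep_hom\<close> prescribes.\<close>
      have id: "(\<lambda>v. if v \<in> rep_space \<rho>tilde then v else 0) \<in> rep_hom Jtilde \<rho>tilde \<rho>tilde"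
        using smooth_rep_subspace[OF smt] smooth_rep_in[OF smt]
        by (intro rep_homI) (auto simp: cvec.subspace_add cvec.subspace_scale)
      have id_bij: "bij_betw (\<lambda>v. if v \<in> rep_space \<rho>tilde then v else 0) (rep_space \<rho>tilde) (rep_space \<rho>tilde)"
        by (auto simp: bij_betw_def inj_on_def image_iff)
      have triv: "\<psi> j = 1" if "j \<in> J" for j using chars_trivial[OF \<psi>] that JG(4) by blast
      have "\<psi> x * 1 = 1"
        by (rule D.induced_twists_agree[OF Jt _ _ smt id id_bij, of "\<lambda>_. 1" "\<lambda>_. 1" \<psi> \<Phi> ?f])
          (use x JJ0 \<Phi>(1) nz triv smt chars_nonzero[OF \<psi>] in \<open>auto simp: twist_trivial\<close>)
      then show ?thesis by simp
    qed
    moreover have "x \<in> carrier G" using x subgroup.mem_carrier[OF J0] by blast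
    ultimately show "x \<in> Gdagger" unfolding assms(21) twist_kernel_def by blast
  qed
  then have Jnat: "Jnat = J0" using assms(22) by blast

  have sharp_iso: "rep_iso J0 \<rho>sharp \<rho>0"
  proof -
    have irr: "irrep G J0 \<rho>sharp" using assms(18) Jsharp by simp
    then have sm: "smooth_rep G J0 \<rho>sharp" by (simp add: irrep_def)
    obtain \<phi> where \<phi>: "\<phi> \<in> rep_hom J0 \<rho>sharp \<rho>0" "inj_on \<phi> (rep_space \<rho>sharp)"
      using assms(19) Jsharp by (auto simp: occurs_in_def)
    note z = cvec.subspace_0[OF smooth_rep_subspace[OF sm]]
    obtain v where v: "v \<in> rep_space \<rho>sharp" "v \<noteq> 0" using irr z by (auto simp: irrep_def)
    then have "\<phi> v \<noteq> 0" using inj_onD[OF \<phi>(2) _ v(1) z] rep_hom_zero[OF \<phi>(1)] by auto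
    then have "\<phi> ` rep_space \<rho>sharp = rep_space \<rho>0"
      using rep_hom_onto_irrep[OF \<phi>(1) _ assms(14) smooth_rep_subspace[OF sm]] smooth_rep_in[OF sm]
      by blast
    then show ?thesis using \<phi> by (auto simp: rep_iso_def bij_betw_def)
  qed

  have extend: "\<exists>\<mu> \<in> chars G (carrier G) Gflat. restrict \<mu> J0 = \<nu>" if "\<nu> \<in> chars G J0 J" for \<nu>
    using flat.character_extends[OF J0, of \<nu>] that by (auto simp: J0flat)

  let ?Q = "G\<lparr>carrier := J0\<rparr>"
  have quotient: "abelian_quotient J ?Q"
  proof (intro abelian_quotient.intro abelian_quotient_axioms.intro)
    interpret Q: group ?Q by (rule subgroup.subgroup_is_group[OF J0 is_group])
    have "subgroup J ?Q"
      by (rule subgroup_incl[OF D.subgroup_J J0 JJ0(1)])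
    moreover have "x \<otimes>\<^bsub>?Q\<^esub> h \<otimes>\<^bsub>?Q\<^esub> inv\<^bsub>?Q\<^esub> x \<in> J" if "x \<in> carrier ?Q" "h \<in> J" for x h
    proof -
      have x: "x \<in> J0" using that by simp
      have "x \<otimes>\<^bsub>G\<^esub> h \<otimes>\<^bsub>G\<^esub> inv\<^bsub>G\<^esub> x \<in> J0"
        using x that JJ0(1) subgroup.m_closed[OF J0] subgroup.m_inv_closed[OF J0] by blast
      moreover have "x \<otimes>\<^bsub>G\<^esub> h \<otimes>\<^bsub>G\<^esub> inv\<^bsub>G\<^esub> x \<in> Gflat"
        using flat.inv_op_closed2 x that JG(4) subgroup.mem_carrier[OF J0] by auto
      ultimately show ?thesis using J0flat m_inv_consistent[OF J0 x] by auto
    qed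
    ultimately show "J \<lhd> ?Q" by (simp add: Q.normal_inv_iff)
    have "derived ?Q J0 = derived G J0" by (rule derived_consistent[OF _ J0]) simp
    moreover have "derived G J0 \<subseteq> J0" by (rule derived_incl[OF _ J0]) simp
    moreover have "derived G J0 \<subseteq> Gflat"
      using mono_derived[OF subgroup.subset[OF J0]] assms(9) by blast
    ultimately show "derived ?Q (carrier ?Q) \<subseteq> J" using J0flat by auto
  qed
  have finite_quotient: "finite (rcosets\<^bsub>?Q\<^esub> J)"
  proof -
    have "rcosets\<^bsub>?Q\<^esub> J \<subseteq> (\<lambda>D. D \<inter> Jtilde) ` (rcosets\<^bsub>G\<lparr>carrier := G0\<rparr>\<^esub> Gflat)"
    proof
      fix E assume "E \<in> rcosets\<^bsub>?Q\<^esub> J"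
      then obtain x where x: "x \<in> J0" "E = J #>\<^bsub>G\<^esub> x" by (auto simp: RCOSETS_def r_coset_def)
      have xG: "x \<in> carrier G" and xt: "x \<in> Jtilde" and x0: "x \<in> G0"
        using x(1) assms(13) subgroup.mem_carrier[OF J0] by auto
      \<comment> \<open>A coset of \<open>J\<close> in \<open>J0\<close> is recovered from the coset of \<open>Gflat\<close> in \<open>G0\<close> that contains it.\<close>
      have "J #>\<^bsub>G\<^esub> x = (Gflat #>\<^bsub>G\<^esub> x) \<inter> Jtilde"
        unfolding r_coset_def JG(4)
        using subgroup_right_mult_iff[OF Jt xt] flat.mem_carrier by auto
      moreover have "Gflat #>\<^bsub>G\<^esub> x \<in> rcosets\<^bsub>G\<lparr>carrier := G0\<rparr>\<^esub> Gflat"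
        using x0 by (auto simp: RCOSETS_def r_coset_def)
      ultimately show "E \<in> (\<lambda>D. D \<inter> Jtilde) ` (rcosets\<^bsub>G\<lparr>carrier := G0\<rparr>\<^esub> Gflat)"
        using x(2) by blast
    qed
    then show ?thesis using assms(8) finite_surj by blast
  qed
  interpret S: abelian_stage G J J0 \<rho> \<rho>0 \<theta>
    by (intro abelian_stage.intro abelian_stage_axioms.intro translation_group_axioms D.open_J J0
        quotient finite_quotient smJ sm0 \<theta> \<theta>_bij)
  have disjoint: "\<Phi> f = 0"
    if \<nu>: "\<nu> \<in> chars G J0 J" and \<mu>: "\<mu> \<in> chars G J0 J" and ne: "\<nu> \<noteq> \<mu>"
      and \<Phi>: "\<Phi> \<in> rep_hom (carrier G) (c_ind G J0 (twist \<rho>0 \<nu>)) (c_ind G J0 (twist \<rho>0 \<mu>))"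
    for \<nu> \<mu> \<Phi> f
  proof (rule ccontr)
    assume nz: "\<Phi> f \<noteq> 0"
    have "1 * \<nu> h = \<mu> h" if "h \<in> J0" for h
      by (rule D.induced_twists_agree[OF J0 JJ0 sm0 \<alpha>(1) \<alpha>_bij S.smooth_twist[OF \<nu>],
            where \<omega> = "\<lambda>_. 1" and \<Phi> = \<Phi> and f = f])
        (use that \<Phi> nz chars_trivial[OF \<nu>] chars_trivial[OF \<mu>] chars_mult[OF \<mu>] in
          \<open>auto simp: twist_trivial\<close>)
    then have "\<nu> = \<mu>"
      by (intro extensionalityI[OF chars_extensional[OF \<nu>] chars_extensional[OF \<mu>]]) simp
    with ne show False by simp
  qed
  have hecke: "algebra_iso (hecke_algebra G J \<rho>)
         (direct_sum_algebra (chars G J0 J)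
            (\<lambda>\<nu>. hecke_algebra G J0 (twist \<rho>0 (restrict (\<nu>bar \<nu>) J0))))"
    if "\<forall>\<nu> \<in> chars G J0 J. \<nu>bar \<nu> \<in> chars G (carrier G) Gflat \<and> restrict (\<nu>bar \<nu>) J0 = \<nu>" for \<nu>bar
  proof -
    have "direct_sum_algebra (chars G J0 J)
        (\<lambda>\<nu>. hecke_algebra G J0 (twist \<rho>0 (restrict (\<nu>bar \<nu>) J0))) =
      direct_sum_algebra (chars G J0 J) (\<lambda>\<nu>. hecke_algebra G J0 (twist \<rho>0 \<nu>))"
      by (rule direct_sum_algebra_cong) (use that in simp)
    moreover have "algebra_iso (hecke_algebra G J \<rho>)
        (direct_sum_algebra (chars G J0 J) (\<lambda>\<nu>. hecke_algebra G J0 (twist \<rho>0 \<nu>)))"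
      by (rule S.hecke_algebra_decomposition) (rule disjoint)
    ultimately show ?thesis by simp
  qed
  show ?thesis using Jnat sharp_iso extend hecke by blast
qed

end
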